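(* Let $R$ be an associative algebra. Assume that there are finitely many isomorphism classes of finite simple $R$-modules, and that $\operatorname{Ext}^1_R(M,N)$ is finite for all finite $R$-modules $M,N$. Let $\mu$ be a measure on the set of isomorphism classes of finite $R$-modules, and let $(\mu_t)_{t\in\mathbb N}$ be a sequence of measures on the same set. Assume that for every finite $R$-module $M$, \[ \lim_{t\to\infty}\int\operatorname{Sur}_R(X,M)\,d\mu_t(X)=\int\operatorname{Sur}_R(X,M)\,d\mu(X), \] and that \[ \int\operatorname{Sur}_R(X,M)\,d\mu(X)=O\left(|M|^{O(1)}\right), \] i.e. there are constants $A,B$ independent of $M$ such that $\int\operatorname{Sur}_R(X,M)\,d\mu(X)\le A|M|^B$ for every finite $R$-module $M$. Then for all finite $R$-modules $M$ we have \[ \lim_{t\to\infty}\mu_t(M)=\mu(M). \]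
   Context: "Finite module" means a module with finitely many elements. $\operatorname{Sur}_R(X,M)$ denotes the number of surjective $R$-module homomorphisms $X\to M$. The set of isomorphism classes carries the discrete topology, and measures are nonnegative; $\mu(M)$ is the measure of the isomorphism class of $M$. *)

theory Defs
  imports "HOL-Algebra.AbelCoset" "HOL-Algebra.Module"
    "HOL-Analysis.Nonnegative_Lebesgue_Integration"
begin

section \<open>Left modules over a possibly non-commutative ring\<close>

text \<open>The library locale \<^locale>\<open>Module.module\<close> demands a commutative base ring, so we restate its
  axioms over an arbitrary (associative, unital) ring, keeping the record type. As in the library,
  the multiplicative fields of the record play no role.\<close>

locale lmodule = R?: ring R + M?: abelian_group M
  for R :: "('r, 'k) ring_scheme" (structure) and M :: "('r, 'a) module" (structure) +
  assumes smult_closed: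
      "\<lbrakk>a \<in> carrier R; x \<in> carrier M\<rbrakk> \<Longrightarrow> a \<odot>\<^bsub>M\<^esub> x \<in> carrier M"
    and smult_l_distr:
      "\<lbrakk>a \<in> carrier R; b \<in> carrier R; x \<in> carrier M\<rbrakk> \<Longrightarrow>
        (a \<oplus>\<^bsub>R\<^esub> b) \<odot>\<^bsub>M\<^esub> x = a \<odot>\<^bsub>M\<^esub> x \<oplus>\<^bsub>M\<^esub> b \<odot>\<^bsub>M\<^esub> x"
    and smult_r_distr:
      "\<lbrakk>a \<in> carrier R; x \<in> carrier M; y \<in> carrier M\<rbrakk> \<Longrightarrow>
        a \<odot>\<^bsub>M\<^esub> (x \<oplus>\<^bsub>M\<^esub> y) = a \<odot>\<^bsub>M\<^esub> x \<oplus>\<^bsub>M\<^esub> a \<odot>\<^bsub>M\<^esub> y"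
    and smult_assoc:
      "\<lbrakk>a \<in> carrier R; b \<in> carrier R; x \<in> carrier M\<rbrakk> \<Longrightarrow>
        (a \<otimes>\<^bsub>R\<^esub> b) \<odot>\<^bsub>M\<^esub> x = a \<odot>\<^bsub>M\<^esub> (b \<odot>\<^bsub>M\<^esub> x)"
    and smult_one:
      "x \<in> carrier M \<Longrightarrow> \<one>\<^bsub>R\<^esub> \<odot>\<^bsub>M\<^esub> x = x"

definition lmod_hom ::
  "('r, 'k) ring_scheme \<Rightarrow> ('r, 'a) module \<Rightarrow> ('r, 'b) module \<Rightarrow> ('a \<Rightarrow> 'b) set" where
  "lmod_hom R M N = {f \<in> hom (add_monoid M) (add_monoid N).
     \<forall>r\<in>carrier R. \<forall>x\<in>carrier M. f (r \<odot>\<^bsub>M\<^esub> x) = r \<odot>\<^bsub>N\<^esub> f x}"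

definition lmod_iso ::
  "('r, 'k) ring_scheme \<Rightarrow> ('r, 'a) module \<Rightarrow> ('r, 'b) module \<Rightarrow> ('a \<Rightarrow> 'b) set" where
  "lmod_iso R M N = {f \<in> lmod_hom R M N. bij_betw f (carrier M) (carrier N)}"

definition lmod_isomorphic ::
  "('r, 'k) ring_scheme \<Rightarrow> ('r, 'a) module \<Rightarrow> ('r, 'b) module \<Rightarrow> bool" where
  "lmod_isomorphic R M N \<longleftrightarrow> lmod_iso R M N \<noteq> {}"

definition lmod_simple :: "('r, 'k) ring_scheme \<Rightarrow> ('r, 'a) module \<Rightarrow> bool" where
  "lmod_simple R M \<longleftrightarrow> lmodule R M \<and> carrier M \<noteq> {\<zero>\<^bsub>M\<^esub>} \<and>
     (\<forall>H. submodule H R M \<longrightarrow> H = {\<zero>\<^bsub>M\<^esub>} \<or> H = carrier M)"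

text \<open>Homomorphisms are represented by functions that are extensional on the carrier, so that
  each surjective homomorphism is counted exactly once.\<close>

definition Sur ::
  "('r, 'k) ring_scheme \<Rightarrow> ('r, 'a) module \<Rightarrow> ('r, 'b) module \<Rightarrow> ('a \<Rightarrow> 'b) set" where
  "Sur R X M = {f \<in> extensional (carrier X). f \<in> lmod_hom R X M \<and> f ` carrier X = carrier M}"


section \<open>First extension groups\<close>

text \<open>\<open>Ext\<^sup>1(M, N)\<close> is rendered as the set of Yoneda classes of short exact sequences
  \<open>0 \<rightarrow> N \<rightarrow> E \<rightarrow> M \<rightarrow> 0\<close>. Only the underlying set is needed, not the Baer sum.\<close>

type_synonym ('r, 'a, 'b, 'e) ext = "('r, 'e) module \<times> ('b \<Rightarrow> 'e) \<times> ('e \<Rightarrow> 'a)"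

definition is_extension ::
  "('r, 'k) ring_scheme \<Rightarrow> ('r, 'a) module \<Rightarrow> ('r, 'b) module \<Rightarrow> ('r, 'a, 'b, 'e) ext \<Rightarrow> bool" where
  "is_extension R M N = (\<lambda>(E, i, p). lmodule R E \<and>
     i \<in> lmod_hom R N E \<and> inj_on i (carrier N) \<and>
     p \<in> lmod_hom R E M \<and> p ` carrier E = carrier M \<and>
     i ` carrier N = a_kernel E M p)"

definition ext_equiv ::
  "('r, 'k) ring_scheme \<Rightarrow> ('r, 'a) module \<Rightarrow> ('r, 'b) module \<Rightarrow>
   ('r, 'a, 'b, 'e) ext \<Rightarrow> ('r, 'a, 'b, 'f) ext \<Rightarrow> bool" where
  "ext_equiv R M N = (\<lambda>(E, i, p) (E', i', p'). \<exists>f \<in> lmod_iso R E E'.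
     (\<forall>y\<in>carrier N. f (i y) = i' y) \<and> (\<forall>e\<in>carrier E. p' (f e) = p e))"

text \<open>It suffices to let the middle term range over modules on subsets of \<open>'b \<times> 'a\<close>, since every
  extension of \<open>M\<close> by \<open>N\<close> is equivalent to one with underlying set \<open>N \<times> M\<close>;
  see \<open>extension_representative\<close> below.\<close>

definition ext_rel ::
  "('r, 'k) ring_scheme \<Rightarrow> ('r, 'a) module \<Rightarrow> ('r, 'b) module \<Rightarrow>
   (('r, 'a, 'b, 'b \<times> 'a) ext \<times> ('r, 'a, 'b, 'b \<times> 'a) ext) set" where
  "ext_rel R M N =
     {(e, e'). is_extension R M N e \<and> is_extension R M N e' \<and> ext_equiv R M N e e'}"

definition Ext1 ::
  "('r, 'k) ring_scheme \<Rightarrow> ('r, 'a) module \<Rightarrow> ('r, 'b) module \<Rightarrow>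
   ('r, 'a, 'b, 'b \<times> 'a) ext set set" where
  "Ext1 R M N = {e. is_extension R M N e} // ext_rel R M N"


section \<open>Isomorphism classes of finite modules and moments\<close>

text \<open>Up to isomorphism every finite module lives on a set of natural numbers
  (\<open>fin_modules_representative\<close> below), so these modules represent all isomorphism classes.\<close>

definition fin_modules :: "('r, 'k) ring_scheme \<Rightarrow> ('r, nat) module set" where
  "fin_modules R = {M. lmodule R M \<and> finite (carrier M)}"

definition iso_rel :: "('r, 'k) ring_scheme \<Rightarrow> (('r, nat) module \<times> ('r, nat) module) set" where
  "iso_rel R = {(M, N). M \<in> fin_modules R \<and> N \<in> fin_modules R \<and> lmod_isomorphic R M N}"

definition iso_classes :: "('r, 'k) ring_scheme \<Rightarrow> ('r, nat) module set set" where
  "iso_classes R = fin_modules R // iso_rel R"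

definition iso_class :: "('r, 'k) ring_scheme \<Rightarrow> ('r, 'a) module \<Rightarrow> ('r, nat) module set" where
  "iso_class R M = {X \<in> fin_modules R. lmod_isomorphic R M X}"

text \<open>The number of surjections depends only on the isomorphism class of the source
  (\<open>sur_count_iso_class\<close> below), hence the choice of representative is immaterial.\<close>

definition sur_count ::
  "('r, 'k) ring_scheme \<Rightarrow> ('r, nat) module set \<Rightarrow> ('r, 'a) module \<Rightarrow> nat" where
  "sur_count R C M = card (Sur R (SOME X. X \<in> C) M)"

definition moment ::
  "('r, 'k) ring_scheme \<Rightarrow> ('r, nat) module set measure \<Rightarrow> ('r, 'a) module \<Rightarrow> ennreal" where
  "moment R \<mu> M = (\<integral>\<^sup>+ C. of_nat (sur_count R C M) \<partial>\<mu>)"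


section \<open>The definitions are independent of the choices made\<close>

lemma lmod_homI:
  assumes "\<And>x. x \<in> carrier M \<Longrightarrow> f x \<in> carrier N"
    and "\<And>x y. \<lbrakk>x \<in> carrier M; y \<in> carrier M\<rbrakk> \<Longrightarrow> f (x \<oplus>\<^bsub>M\<^esub> y) = f x \<oplus>\<^bsub>N\<^esub> f y"
    and "\<And>r x. \<lbrakk>r \<in> carrier R; x \<in> carrier M\<rbrakk> \<Longrightarrow> f (r \<odot>\<^bsub>M\<^esub> x) = r \<odot>\<^bsub>N\<^esub> f x"
  shows "f \<in> lmod_hom R M N"
  using assms by (auto simp: lmod_hom_def hom_def)

lemma lmod_homD:
  assumes "f \<in> lmod_hom R M N"
  shows "x \<in> carrier M \<Longrightarrow> f x \<in> carrier N"
    and "\<lbrakk>x \<in> carrier M; y \<in> carrier M\<rbrakk> \<Longrightarrow> f (x \<oplus>\<^bsub>M\<^esub> y) = f x \<oplus>\<^bsub>N\<^esub> f y"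
    and "\<lbrakk>r \<in> carrier R; x \<in> carrier M\<rbrakk> \<Longrightarrow> f (r \<odot>\<^bsub>M\<^esub> x) = r \<odot>\<^bsub>N\<^esub> f x"
  using assms by (auto simp: lmod_hom_def hom_def)

lemma lmod_hom_comp:
  "\<lbrakk>f \<in> lmod_hom R L M; g \<in> lmod_hom R M N\<rbrakk> \<Longrightarrow> g \<circ> f \<in> lmod_hom R L N"
  by (rule lmod_homI) (auto simp: lmod_homD)

lemma lmod_iso_id: "id \<in> lmod_iso R M M"
  unfolding lmod_iso_def by (auto intro!: lmod_homI)

lemma lmod_iso_comp:
  "\<lbrakk>f \<in> lmod_iso R L M; g \<in> lmod_iso R M N\<rbrakk> \<Longrightarrow> g \<circ> f \<in> lmod_iso R L N"
  unfolding lmod_iso_def by (auto intro: lmod_hom_comp bij_betw_trans)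

lemma lmod_iso_inv:
  assumes "f \<in> lmod_iso R M N" and "lmodule R M"
  shows "inv_into (carrier M) f \<in> lmod_iso R N M"
proof -
  interpret lmodule R M by fact
  have f: "f \<in> lmod_hom R M N" and b: "bij_betw f (carrier M) (carrier N)"
    using assms(1) by (auto simp: lmod_iso_def)
  let ?g = "inv_into (carrier M) f"
  have g: "?g y \<in> carrier M" "f (?g y) = y" if "y \<in> carrier N" for y
    using b that bij_betw_inv_into_right[OF b] by (auto simp: bij_betw_def inv_into_into)
  have gf: "?g (f x) = x" if "x \<in> carrier M" for x
    using b that by (simp add: bij_betw_inv_into_left)
  have "?g \<in> lmod_hom R N M"
  proof (rule lmod_homI)
    fix x y assume "x \<in> carrier N" "y \<in> carrier N"
    then show "?g (x \<oplus>\<^bsub>N\<^esub> y) = ?g x \<oplus>\<^bsub>M\<^esub> ?g y"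
      using gf[of "?g x \<oplus>\<^bsub>M\<^esub> ?g y"] by (simp add: lmod_homD(2)[OF f] g)
  next
    fix r x assume "r \<in> carrier R" "x \<in> carrier N"
    then show "?g (r \<odot>\<^bsub>N\<^esub> x) = r \<odot>\<^bsub>M\<^esub> ?g x"
      using gf[of "r \<odot>\<^bsub>M\<^esub> ?g x"] by (simp add: lmod_homD(3)[OF f] g smult_closed)
  qed (use g in auto)
  with b show ?thesis by (simp add: lmod_iso_def bij_betw_inv_into)
qed

lemma lmod_isomorphic_refl: "lmod_isomorphic R M M"
  using lmod_iso_id by (auto simp: lmod_isomorphic_def)

lemma lmod_isomorphic_sym:
  "\<lbrakk>lmod_isomorphic R M N; lmodule R M\<rbrakk> \<Longrightarrow> lmod_isomorphic R N M"
  using lmod_iso_inv by (fastforce simp: lmod_isomorphic_def)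

lemma lmod_isomorphic_trans:
  "\<lbrakk>lmod_isomorphic R L M; lmod_isomorphic R M N\<rbrakk> \<Longrightarrow> lmod_isomorphic R L N"
  using lmod_iso_comp by (fastforce simp: lmod_isomorphic_def)

lemma equiv_iso_rel: "equiv (fin_modules R) (iso_rel R)"
proof (rule equivI)
  show "refl_on (fin_modules R) (iso_rel R)"
    by (auto simp: refl_on_def iso_rel_def lmod_isomorphic_refl)
  show "sym (iso_rel R)"
    by (auto simp: sym_def iso_rel_def fin_modules_def intro: lmod_isomorphic_sym)
  show "trans (iso_rel R)"
    by (auto simp: trans_def iso_rel_def intro: lmod_isomorphic_trans)
qed (auto simp: iso_rel_def)

lemma lmodule_transport:
  fixes M :: "('r, 'a) module" and f :: "'a \<Rightarrow> 'b"
  assumes "lmodule R M" and inj: "inj_on f (carrier M)"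
  obtains N :: "('r, 'b) module"
  where "lmodule R N" "carrier N = f ` carrier M" "f \<in> lmod_iso R M N"
proof -
  interpret lmodule R M by fact
  define g where "g = inv_into (carrier M) f"
  define N :: "('r, 'b) module" where
    "N = \<lparr>carrier = f ` carrier M, monoid.mult = undefined, one = undefined, zero = f \<zero>\<^bsub>M\<^esub>,
      add = (\<lambda>x y. f (g x \<oplus>\<^bsub>M\<^esub> g y)), smult = (\<lambda>r x. f (r \<odot>\<^bsub>M\<^esub> g x))\<rparr>"
  have g [simp]: "g (f x) = x" if "x \<in> carrier M" for x
    using inj that by (simp add: g_def)
  have "abelian_group N"
  proof (rule abelian_groupI)
    fix x assume "x \<in> carrier N"
    then obtain a where a: "a \<in> carrier M" "x = f a" by (auto simp: N_def)
    then have "f (\<ominus>\<^bsub>M\<^esub> a) \<in> carrier N" "f (\<ominus>\<^bsub>M\<^esub> a) \<oplus>\<^bsub>N\<^esub> x = \<zero>\<^bsub>N\<^esub>"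
      by (auto simp: N_def M.l_neg)
    then show "\<exists>y\<in>carrier N. y \<oplus>\<^bsub>N\<^esub> x = \<zero>\<^bsub>N\<^esub>" by blast
  qed (auto simp: N_def M.a_assoc intro!: arg_cong[where f = f] M.a_comm)
  moreover have "lmodule_axioms R N"
    by unfold_locales
      (auto simp: N_def smult_closed smult_l_distr smult_r_distr smult_assoc smult_one)
  ultimately have "lmodule R N"
    by (intro lmodule.intro R.ring_axioms)
  moreover have "f \<in> lmod_iso R M N"
    unfolding lmod_iso_def using inj by (auto intro!: lmod_homI simp: N_def bij_betw_def)
  ultimately show ?thesis by (intro that) (auto simp: N_def)
qed

lemma fin_modules_representative:
  fixes M :: "('r, 'a) module"
  assumes "lmodule R M" and "finite (carrier M)"
  obtains X where "X \<in> fin_modules R" "lmod_isomorphic R M X"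
proof -
  obtain f :: "'a \<Rightarrow> nat" where "inj_on f (carrier M)"
    using finite_imp_inj_to_nat_seg[OF assms(2)] by blast
  then obtain X :: "('r, nat) module" where
    "lmodule R X" "carrier X = f ` carrier M" "f \<in> lmod_iso R M X"
    using lmodule_transport[OF assms(1)] by blast
  with assms(2) have "X \<in> fin_modules R" "lmod_isomorphic R M X"
    by (auto simp: fin_modules_def lmod_isomorphic_def)
  then show ?thesis by (rule that)
qed

lemma iso_class_in_iso_classes:
  assumes "lmodule R M" and "finite (carrier M)"
  shows "iso_class R M \<in> iso_classes R"
proof -
  obtain X where X: "X \<in> fin_modules R" "lmod_isomorphic R M X"
    using fin_modules_representative[OF assms] .
  have "iso_class R M = iso_rel R `` {X}"
    using X assms(1)
    by (auto simp: iso_class_def iso_rel_def intro: lmod_isomorphic_trans lmod_isomorphic_sym)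
  with X(1) show ?thesis by (auto simp: iso_classes_def intro: quotientI)
qed

lemma card_Sur_le:
  assumes "lmodule R X" "lmodule R Y" "f \<in> lmod_iso R X Y" "finite (carrier X)" "finite (carrier M)"
  shows "card (Sur R X M) \<le> card (Sur R Y M)"
proof -
  interpret X: lmodule R X by fact
  interpret Y: lmodule R Y by fact
  let ?g = "inv_into (carrier X) f"
  have g: "?g \<in> lmod_iso R Y X" using lmod_iso_inv assms by blast
  have b: "bij_betw f (carrier X) (carrier Y)" "bij_betw ?g (carrier Y) (carrier X)"
    using assms(3) g by (auto simp: lmod_iso_def)
  let ?F = "\<lambda>h. restrict (h \<circ> ?g) (carrier Y)"
  have "finite (carrier Y)" using b(1) assms(4) bij_betw_finite by blast
  have "Sur R Y M \<subseteq> carrier Y \<rightarrow>\<^sub>E carrier M"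
    by (auto simp: Sur_def PiE_def)
  then have fin: "finite (Sur R Y M)"
    using finite_PiE[OF \<open>finite (carrier Y)\<close>, of "\<lambda>_. carrier M"] assms(5) finite_subset by blast
  have inj: "inj_on ?F (Sur R X M)"
  proof (rule inj_onI)
    fix h k assume hk: "h \<in> Sur R X M" "k \<in> Sur R X M" "?F h = ?F k"
    show "h = k"
    proof (rule extensionalityI[of _ "carrier X"])
      fix x assume x: "x \<in> carrier X"
      then have "f x \<in> carrier Y" "?g (f x) = x" using b by (auto simp: bij_betw_def)
      with fun_cong[OF hk(3), of "f x"] show "h x = k x" by simp
    qed (use hk in \<open>auto simp: Sur_def\<close>)
  qed
  have "?F h \<in> Sur R Y M" if h: "h \<in> Sur R X M" for h
  proof -
    have hom: "h \<circ> ?g \<in> lmod_hom R Y M"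
      using h g by (auto simp: Sur_def lmod_iso_def intro: lmod_hom_comp)
    have "?F h \<in> lmod_hom R Y M"
      by (rule lmod_homI) (auto simp: lmod_homD[OF hom, simplified] Y.smult_closed)
    moreover have "?F h ` carrier Y = carrier M"
    proof -
      have "?F h ` carrier Y = h ` (?g ` carrier Y)" by (auto simp: image_comp)
      then show ?thesis using b(2) h by (simp add: bij_betw_def Sur_def)
    qed
    ultimately show ?thesis by (simp add: Sur_def)
  qed
  then show ?thesis using card_inj_on_le[OF inj _ fin] by blast
qed

lemma sur_count_iso_class:
  assumes "lmodule R X" "finite (carrier X)" "finite (carrier M)"
  shows "sur_count R (iso_class R X) M = card (Sur R X M)"
proof -
  have "iso_class R X \<noteq> {}"
    using fin_modules_representative[OF assms(1,2)] by (auto simp: iso_class_def)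
  then have "(SOME Y. Y \<in> iso_class R X) \<in> iso_class R X" by (simp add: some_in_eq)
  then obtain f where Y: "(SOME Y. Y \<in> iso_class R X) \<in> fin_modules R"
    and f: "f \<in> lmod_iso R X (SOME Y. Y \<in> iso_class R X)"
    by (auto simp: iso_class_def lmod_isomorphic_def)
  show ?thesis
    unfolding sur_count_def using Y assms
    by (intro antisym card_Sur_le[OF _ _ f] card_Sur_le[OF _ _ lmod_iso_inv[OF f]])
      (auto simp: fin_modules_def)
qed

lemma ext_equiv_refl: "ext_equiv R M N e e"
  by (cases e) (auto simp: ext_equiv_def intro!: bexI[OF _ lmod_iso_id])

lemma ext_equiv_sym:
  assumes "is_extension R M N e" and "ext_equiv R M N e e'"
  shows "ext_equiv R M N e' e"
proof -
  obtain E i p E' i' p' where e: "e = (E, i, p)" "e' = (E', i', p')"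
    by (metis prod_cases3)
  obtain f where f: "f \<in> lmod_iso R E E'"
      "\<And>y. y \<in> carrier N \<Longrightarrow> f (i y) = i' y" "\<And>x. x \<in> carrier E \<Longrightarrow> p' (f x) = p x"
    using assms(2) by (auto simp: ext_equiv_def e)
  have i: "i \<in> lmod_hom R N E" and E: "lmodule R E"
    using assms(1) by (auto simp: is_extension_def e)
  let ?g = "inv_into (carrier E) f"
  have b: "bij_betw f (carrier E) (carrier E')" using f(1) by (simp add: lmod_iso_def)
  have "?g (i' y) = i y" if "y \<in> carrier N" for y
    using that lmod_homD(1)[OF i that] b f(2) by (metis bij_betw_inv_into_left)
  moreover have "p (?g x) = p' x" if "x \<in> carrier E'" for x
    using that b f(3)[of "?g x"] bij_betw_inv_into_right[OF b that]
    by (simp add: bij_betw_def inv_into_into)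
  ultimately show ?thesis
    using lmod_iso_inv[OF f(1) E] by (auto simp: ext_equiv_def e)
qed

lemma ext_equiv_trans:
  assumes "ext_equiv R M N e1 e2" and "ext_equiv R M N e2 e3"
  shows "ext_equiv R M N e1 e3"
proof -
  obtain E1 i1 p1 E2 i2 p2 E3 i3 p3
    where e: "e1 = (E1, i1, p1)" "e2 = (E2, i2, p2)" "e3 = (E3, i3, p3)"
    by (metis prod_cases3)
  obtain f g where f: "f \<in> lmod_iso R E1 E2" "\<forall>y\<in>carrier N. f (i1 y) = i2 y"
      "\<forall>x\<in>carrier E1. p2 (f x) = p1 x"
    and g: "g \<in> lmod_iso R E2 E3" "\<forall>y\<in>carrier N. g (i2 y) = i3 y"
      "\<forall>x\<in>carrier E2. p3 (g x) = p2 x"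
    using assms by (auto simp: ext_equiv_def e)
  have "f x \<in> carrier E2" if "x \<in> carrier E1" for x
    using f(1) that by (auto simp: lmod_iso_def lmod_homD)
  then show ?thesis
    using f g lmod_iso_comp[OF f(1) g(1)]
    by (auto simp: ext_equiv_def e intro!: bexI[of _ "g \<circ> f"])
qed

lemma equiv_ext_rel: "equiv {e. is_extension R M N e} (ext_rel R M N)"
proof (rule equivI)
  show "refl_on {e. is_extension R M N e} (ext_rel R M N)"
    by (auto simp: refl_on_def ext_rel_def ext_equiv_refl)
  show "sym (ext_rel R M N)"
    by (rule symI) (simp add: ext_rel_def ext_equiv_sym)
  show "trans (ext_rel R M N)"
    by (rule transI) (auto simp: ext_rel_def intro: ext_equiv_trans)
qed (auto simp: ext_rel_def)

lemma extension_representative: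
  fixes M :: "('r, 'a) module" and N :: "('r, 'b) module" and e :: "('r, 'a, 'b, 'e) ext"
  assumes M: "lmodule R M" and N: "lmodule R N" and e: "is_extension R M N e"
  obtains e' :: "('r, 'a, 'b, 'b \<times> 'a) ext"
  where "is_extension R M N e'" "ext_equiv R M N e e'"
proof -
  obtain E i p where eq: "e = (E, i, p)" by (metis prod_cases3)
  have E: "lmodule R E" and i: "i \<in> lmod_hom R N E" "inj_on i (carrier N)"
    and p: "p \<in> lmod_hom R E M" "p ` carrier E = carrier M"
    and ex: "i ` carrier N = a_kernel E M p"
    using e by (auto simp: is_extension_def eq)
  interpret E: lmodule R E by fact
  interpret M: lmodule R M by fact
  define s where "s = inv_into (carrier E) p"
  have s: "s y \<in> carrier E" "p (s y) = y" if "y \<in> carrier M" for y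
    using that p(2) by (auto simp: s_def inv_into_into f_inv_into_f)
  have pE: "p x \<in> carrier M" if "x \<in> carrier E" for x
    using that p(2) by blast
  have pz: "p \<zero>\<^bsub>E\<^esub> = \<zero>\<^bsub>M\<^esub>"
    using lmod_homD(2)[OF p(1), of "\<zero>\<^bsub>E\<^esub>" "\<zero>\<^bsub>E\<^esub>"] pE[of "\<zero>\<^bsub>E\<^esub>"]
    by (metis E.M.l_zero E.M.zero_closed M.M.add.l_cancel_one')
  have pneg: "p (\<ominus>\<^bsub>E\<^esub> x) = \<ominus>\<^bsub>M\<^esub> p x" if "x \<in> carrier E" for x
    using lmod_homD(2)[OF p(1), of "\<ominus>\<^bsub>E\<^esub> x" x] that pz
    by (metis E.M.a_inv_closed E.M.l_neg M.M.minus_equality pE)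
  have ker: "x \<oplus>\<^bsub>E\<^esub> \<ominus>\<^bsub>E\<^esub> s (p x) \<in> i ` carrier N" if "x \<in> carrier E" for x
    using that pE[OF that] s[of "p x"]
    by (simp add: ex a_kernel_def kernel_def lmod_homD(2)[OF p(1)] pneg M.M.r_neg)
  define f where "f = (\<lambda>x. (inv_into (carrier N) i (x \<oplus>\<^bsub>E\<^esub> \<ominus>\<^bsub>E\<^esub> s (p x)), p x))"
  have inj: "inj_on f (carrier E)"
  proof (rule inj_onI)
    fix x y assume xy: "x \<in> carrier E" "y \<in> carrier E" "f x = f y"
    then have "p x = p y"
      "inv_into (carrier N) i (x \<oplus>\<^bsub>E\<^esub> \<ominus>\<^bsub>E\<^esub> s (p x)) = inv_into (carrier N) i (y \<oplus>\<^bsub>E\<^esub> \<ominus>\<^bsub>E\<^esub> s (p y))"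
      by (auto simp: f_def)
    then have "x \<oplus>\<^bsub>E\<^esub> \<ominus>\<^bsub>E\<^esub> s (p x) = y \<oplus>\<^bsub>E\<^esub> \<ominus>\<^bsub>E\<^esub> s (p x)"
      using inv_into_injective[OF _ ker[OF xy(1)] ker[OF xy(2)]] by simp
    then show "x = y" using xy(1,2) s[OF pE[OF xy(1)]] by simp
  qed
  obtain F :: "('r, 'b \<times> 'a) module"
    where F: "lmodule R F" "carrier F = f ` carrier E" "f \<in> lmod_iso R E F"
    using lmodule_transport[OF E inj] by blast
  let ?g = "inv_into (carrier E) f"
  have fh: "f \<in> lmod_hom R E F" using F(3) by (simp add: lmod_iso_def)
  have gh: "?g \<in> lmod_hom R F E" using lmod_iso_inv[OF F(3) E] by (simp add: lmod_iso_def)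
  have gf: "?g (f x) = x" if "x \<in> carrier E" for x using inj that by simp
  have iE: "i y \<in> carrier E" if "y \<in> carrier N" for y using lmod_homD(1)[OF i(1) that] .
  have "inj_on (f \<circ> i) (carrier N)"
    using i(2) inj iE by (auto intro!: comp_inj_on inj_on_subset[OF inj])
  moreover have "(p \<circ> ?g) ` carrier F = carrier M"
    using p(2) by (auto simp: F(2) gf image_image)
  moreover have "(f \<circ> i) ` carrier N = a_kernel F M (p \<circ> ?g)"
    unfolding image_comp[symmetric] ex by (auto simp: a_kernel_def kernel_def F(2) gf)
  ultimately have "is_extension R M N (F, f \<circ> i, p \<circ> ?g)"
    using F(1) lmod_hom_comp[OF i(1) fh] lmod_hom_comp[OF gh p(1)]
    by (simp add: is_extension_def)
  moreover have "ext_equiv R M N e (F, f \<circ> i, p \<circ> ?g)"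
    using F(3) gf by (auto simp: ext_equiv_def eq intro!: bexI[of _ f])
  ultimately show ?thesis by (rule that)
qed

end

theory Submission
  imports Defs "HOL-Analysis.Bochner_Integration"
begin

text \<open>
  Let \<open>S\<^sub>i\<close> be the finite simple modules and \<open>q\<^sub>i = |Hom(S\<^sub>i, S\<^sub>i)|\<close>. For a surjection \<open>f: X \<rightarrow> M\<close> put
  \<open>x\<^sub>i = |Hom(ker f, S\<^sub>i)|\<close>; this is a power of \<open>q\<^sub>i\<close>, and \<open>f\<close> is an isomorphism iff all \<open>x\<^sub>i\<close> are \<open>1\<close>.
  The indicator of \<open>x\<^sub>i = 1\<close> has a Newton expansion in the products \<open>\<Prod>l<j. (x\<^sub>i - q\<^sub>i\<^sup>l)\<close>, and truncating
  it makes an error bounded by the first omitted term (a Bonferroni inequality). Multiplying over \<open>i\<close>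
  and summing over \<open>f\<close> sandwiches the number of isomorphisms \<open>X \<rightarrow> M\<close>.

  A product \<open>\<Prod>i. \<Prod>l<e\<^sub>i. (x\<^sub>i - q\<^sub>i\<^sup>l)\<close>, summed over \<open>f\<close>, is a fixed multiple of a sum of surjection counts
  from \<open>X\<close> onto iterated fibre products over \<open>M\<close> of extensions of \<open>M\<close> by simple modules, because
  extensions of \<open>M\<close> by \<open>S\<close> together with a lift of \<open>f\<close> are the same, up to \<open>Hom(M, S)\<close>, as
  homomorphisms \<open>ker f \<rightarrow> S\<close>. Hence every truncation converges, and since there are at most
  \<open>\<Prod>i. |Ext\<^sup>1(M, S\<^sub>i)|^e\<^sub>i\<close> such fibre products while the Newton coefficients decay like
  \<open>\<Prod>i. q\<^sub>i^(-e\<^sub>i\<^sup>2/2)\<close>, polynomially bounded moments force the truncation error for \<open>\<mu>\<close> to tend to \<open>0\<close>.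
\<close>

section \<open>Homomorphisms, quotients and products\<close>

text \<open>Moments converge for each module separately, and nothing bounds the measures
  \<open>\<mu>t t\<close> or makes the convergence uniform. The sieve is therefore arranged so that
  its main term and its error term are both finite combinations of moments: at a fixed level both
  converge in \<open>t\<close>, and only the limiting error, which belongs to \<open>\<mu>\<close>,
  has to be made small. The growth bound is applied to \<open>\<mu>\<close> alone. It suffices
  because the modules that occur have size \<open>|M|\<close> times a product of the
  \<open>|S i| ^ e i\<close>, so that a polynomial bound costs only an exponential in
  \<open>e\<close>, as does their number, against coefficients whose exponents are quadratic in
  \<open>e\<close>. The number of isomorphisms onto \<open>M\<close> is a positive constant on the
  class of \<open>M\<close> and 0 elsewhere, so its integral is a fixed multiple of the measure of
  that class. Quotients, pushouts and fibre products tend to change the underlying type, while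
  moments are known to converge for modules on \<open>nat\<close>. Hence the repeated transports
  back to \<open>nat\<close>.\<close>

lemma mem_a_kernel: "x \<in> a_kernel X Y f \<longleftrightarrow> x \<in> carrier X \<and> f x = \<zero>\<^bsub>Y\<^esub>"
  by (auto simp: a_kernel_def kernel_def)

context lmodule
begin

lemma minus_add_cancel: "\<lbrakk>x \<in> carrier M; y \<in> carrier M\<rbrakk> \<Longrightarrow> (x \<ominus>\<^bsub>M\<^esub> y) \<oplus>\<^bsub>M\<^esub> y = x"
  by (simp add: a_minus_def M.a_assoc M.l_neg)

lemma add_minus_cancel: "\<lbrakk>x \<in> carrier M; y \<in> carrier M\<rbrakk> \<Longrightarrow> (x \<oplus>\<^bsub>M\<^esub> y) \<ominus>\<^bsub>M\<^esub> y = x"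
  by (simp add: a_minus_def M.a_assoc M.r_neg)

lemma minus_zero: "x \<in> carrier M \<Longrightarrow> x \<ominus>\<^bsub>M\<^esub> \<zero>\<^bsub>M\<^esub> = x"
  using add_minus_cancel[of x "\<zero>\<^bsub>M\<^esub>"] by simp

lemma minus_eq_zero_iff:
  assumes "x \<in> carrier M" "y \<in> carrier M"
  shows "x \<ominus>\<^bsub>M\<^esub> y = \<zero>\<^bsub>M\<^esub> \<longleftrightarrow> x = y"
  using assms minus_add_cancel[OF assms] by (auto simp: a_minus_def M.r_neg)

lemma add_minus_add:
  "\<lbrakk>a \<in> carrier M; b \<in> carrier M; c \<in> carrier M; d \<in> carrier M\<rbrakk> \<Longrightarrow>
    (a \<oplus>\<^bsub>M\<^esub> b) \<ominus>\<^bsub>M\<^esub> (c \<oplus>\<^bsub>M\<^esub> d) = (a \<ominus>\<^bsub>M\<^esub> c) \<oplus>\<^bsub>M\<^esub> (b \<ominus>\<^bsub>M\<^esub> d)"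
  by (simp add: a_minus_def M.minus_add M.a_ac)

lemma smult_zero: "r \<in> carrier R \<Longrightarrow> r \<odot>\<^bsub>M\<^esub> \<zero>\<^bsub>M\<^esub> = \<zero>\<^bsub>M\<^esub>"
  using smult_r_distr[of r "\<zero>\<^bsub>M\<^esub>" "\<zero>\<^bsub>M\<^esub>"] smult_closed[of r "\<zero>\<^bsub>M\<^esub>"]
  by (metis M.add.l_cancel_one' M.l_zero M.zero_closed)

lemma smult_neg: "\<lbrakk>r \<in> carrier R; x \<in> carrier M\<rbrakk> \<Longrightarrow> r \<odot>\<^bsub>M\<^esub> (\<ominus>\<^bsub>M\<^esub> x) = \<ominus>\<^bsub>M\<^esub> (r \<odot>\<^bsub>M\<^esub> x)"
  using smult_r_distr[of r "\<ominus>\<^bsub>M\<^esub> x" x]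
  by (metis M.a_inv_closed M.l_neg M.minus_equality smult_closed smult_zero)

lemma smult_minus:
  "\<lbrakk>r \<in> carrier R; x \<in> carrier M; y \<in> carrier M\<rbrakk> \<Longrightarrow>
    r \<odot>\<^bsub>M\<^esub> (x \<ominus>\<^bsub>M\<^esub> y) = r \<odot>\<^bsub>M\<^esub> x \<ominus>\<^bsub>M\<^esub> r \<odot>\<^bsub>M\<^esub> y"
  by (simp add: a_minus_def smult_r_distr smult_neg)

text \<open>Closure under differences is the form in which membership is met below, where kernels,
  cosets and congruences are all expressed by subtraction.\<close>

lemma submodule_iff:
  "submodule H R M \<longleftrightarrow> H \<subseteq> carrier M \<and> \<zero>\<^bsub>M\<^esub> \<in> H \<and> (\<forall>x\<in>H. \<forall>y\<in>H. x \<ominus>\<^bsub>M\<^esub> y \<in> H) \<and>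
     (\<forall>r\<in>carrier R. \<forall>x\<in>H. r \<odot>\<^bsub>M\<^esub> x \<in> H)"
proof (intro iffI conjI ballI)
  assume "submodule H R M"
  then interpret H: submodule H R M .
  show "H \<subseteq> carrier M" "\<zero>\<^bsub>M\<^esub> \<in> H" using H.subset H.one_closed by auto
  show "r \<odot>\<^bsub>M\<^esub> x \<in> H" if "r \<in> carrier R" "x \<in> H" for r x using that by simp
  show "x \<ominus>\<^bsub>M\<^esub> y \<in> H" if "x \<in> H" "y \<in> H" for x y
    using that H.m_closed[OF that(1) H.m_inv_closed[OF that(2)]] by (simp add: a_minus_def a_inv_def)
next
  assume *: "H \<subseteq> carrier M \<and> \<zero>\<^bsub>M\<^esub> \<in> H \<and> (\<forall>x\<in>H. \<forall>y\<in>H. x \<ominus>\<^bsub>M\<^esub> y \<in> H) \<and>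
     (\<forall>r\<in>carrier R. \<forall>x\<in>H. r \<odot>\<^bsub>M\<^esub> x \<in> H)"
  have neg: "\<ominus>\<^bsub>M\<^esub> x \<in> H" if "x \<in> H" for x
    using * that M.l_zero[of "\<ominus>\<^bsub>M\<^esub> x"] by (metis M.a_inv_closed a_minus_def subsetD)
  have "x \<oplus>\<^bsub>M\<^esub> y \<in> H" if "x \<in> H" "y \<in> H" for x y
    using * that neg M.minus_minus by (metis a_minus_def subsetD)
  with * neg show "submodule H R M"
    by (intro submodule.intro subgroup.intro submodule_axioms.intro)
      (auto simp flip: a_inv_def)
qed

lemma submodule_add: "\<lbrakk>submodule H R M; x \<in> H; y \<in> H\<rbrakk> \<Longrightarrow> x \<oplus>\<^bsub>M\<^esub> y \<in> H"
  by (metis submodule_def subgroup.m_closed monoid.simps(1))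

lemma submodule_neg: "\<lbrakk>submodule H R M; x \<in> H\<rbrakk> \<Longrightarrow> \<ominus>\<^bsub>M\<^esub> x \<in> H"
  by (metis submodule_def subgroup.m_inv_closed a_inv_def)

lemma submodule_lmodule:
  assumes "submodule H R M"
  shows "lmodule R (M\<lparr>carrier := H\<rparr>)"
proof -
  have H: "H \<subseteq> carrier M" "\<zero>\<^bsub>M\<^esub> \<in> H" "\<And>r x. r \<in> carrier R \<Longrightarrow> x \<in> H \<Longrightarrow> r \<odot>\<^bsub>M\<^esub> x \<in> H"
    using assms by (auto simp: submodule_iff)
  have "abelian_group (M\<lparr>carrier := H\<rparr>)"
  proof (rule abelian_groupI)
    fix x assume x: "x \<in> carrier (M\<lparr>carrier := H\<rparr>)"
    then have "\<ominus>\<^bsub>M\<^esub> x \<oplus>\<^bsub>M\<^esub> x = \<zero>\<^bsub>M\<^esub>" using H by (simp add: subset_iff M.l_neg)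
    then show "\<exists>y\<in>carrier (M\<lparr>carrier := H\<rparr>). y \<oplus>\<^bsub>M\<lparr>carrier := H\<rparr>\<^esub> x = \<zero>\<^bsub>M\<lparr>carrier := H\<rparr>\<^esub>"
      using submodule_neg[OF assms, of x] x by auto
  qed (use H submodule_add[OF assms] in \<open>auto simp: subset_iff M.a_ac\<close>)
  moreover have "lmodule_axioms R (M\<lparr>carrier := H\<rparr>)"
    by unfold_locales (use H in \<open>auto simp: subset_iff smult_closed smult_l_distr smult_r_distr smult_assoc smult_one\<close>)
  ultimately show ?thesis by (intro lmodule.intro R.ring_axioms)
qed

end

lemma lmod_hom_zero:
  assumes "lmodule R X" "lmodule R Y" "f \<in> lmod_hom R X Y"
  shows "f \<zero>\<^bsub>X\<^esub> = \<zero>\<^bsub>Y\<^esub>"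
proof -
  interpret X: lmodule R X by fact
  interpret Y: lmodule R Y by fact
  show ?thesis
    using lmod_homD(1,2)[OF assms(3), of "\<zero>\<^bsub>X\<^esub>"] lmod_homD(2)[OF assms(3), of "\<zero>\<^bsub>X\<^esub>" "\<zero>\<^bsub>X\<^esub>"]
    by (metis X.M.l_zero X.M.zero_closed Y.M.add.l_cancel_one')
qed

lemma lmod_hom_neg:
  assumes "lmodule R X" "lmodule R Y" "f \<in> lmod_hom R X Y" "x \<in> carrier X"
  shows "f (\<ominus>\<^bsub>X\<^esub> x) = \<ominus>\<^bsub>Y\<^esub> f x"
proof -
  interpret X: lmodule R X by fact
  interpret Y: lmodule R Y by fact
  show ?thesis
    using lmod_homD(1)[OF assms(3)] lmod_homD(2)[OF assms(3), of "\<ominus>\<^bsub>X\<^esub> x" x] assms(4)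
      lmod_hom_zero[OF assms(1-3)]
    by (metis X.M.a_inv_closed X.M.l_neg Y.M.minus_equality)
qed

lemma lmod_hom_minus:
  assumes "lmodule R X" "lmodule R Y" "f \<in> lmod_hom R X Y" "x \<in> carrier X" "y \<in> carrier X"
  shows "f (x \<ominus>\<^bsub>X\<^esub> y) = f x \<ominus>\<^bsub>Y\<^esub> f y"
proof -
  interpret X: lmodule R X by fact
  show ?thesis
    using assms by (simp add: a_minus_def lmod_homD lmod_hom_neg)
qed

lemma a_kernel_submodule:
  assumes "lmodule R X" "lmodule R Y" "f \<in> lmod_hom R X Y"
  shows "submodule (a_kernel X Y f) R X"
proof -
  interpret X: lmodule R X by fact
  interpret Y: lmodule R Y by fact
  show ?thesis
    using assms
    by (auto simp: X.submodule_iff mem_a_kernel lmod_hom_zero lmod_hom_minus lmod_homD X.smult_closed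
        Y.smult_zero Y.minus_eq_zero_iff)
qed

lemma image_submodule:
  assumes "lmodule R X" "lmodule R Y" "f \<in> lmod_hom R X Y" "submodule H R X"
  shows "submodule (f ` H) R Y"
proof -
  interpret X: lmodule R X by fact
  interpret Y: lmodule R Y by fact
  have H: "H \<subseteq> carrier X" "\<zero>\<^bsub>X\<^esub> \<in> H" "\<And>x y. x \<in> H \<Longrightarrow> y \<in> H \<Longrightarrow> x \<ominus>\<^bsub>X\<^esub> y \<in> H"
    "\<And>r x. r \<in> carrier R \<Longrightarrow> x \<in> H \<Longrightarrow> r \<odot>\<^bsub>X\<^esub> x \<in> H"
    using assms(4) by (auto simp: X.submodule_iff)
  show ?thesis
    unfolding Y.submodule_iff
  proof (intro conjI ballI)
    show "f ` H \<subseteq> carrier Y" using H lmod_homD(1)[OF assms(3)] by auto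
    show "\<zero>\<^bsub>Y\<^esub> \<in> f ` H" using H lmod_hom_zero[OF assms(1-3)] by (metis imageI)
  next
    fix x y assume "x \<in> f ` H" "y \<in> f ` H"
    then obtain a b where "a \<in> H" "b \<in> H" "x = f a" "y = f b" by auto
    then show "x \<ominus>\<^bsub>Y\<^esub> y \<in> f ` H"
      using H lmod_hom_minus[OF assms(1-3), of a b] by (metis imageI subsetD)
  next
    fix r x assume "r \<in> carrier R" "x \<in> f ` H"
    then obtain a where "a \<in> H" "x = f a" by auto
    then show "r \<odot>\<^bsub>Y\<^esub> x \<in> f ` H"
      using H lmod_homD(3)[OF assms(3), of r a] \<open>r \<in> carrier R\<close> by (metis imageI subsetD)
  qed
qed

lemma lmod_hom_inj_iff:
  assumes "lmodule R X" "lmodule R Y" "f \<in> lmod_hom R X Y"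
  shows "inj_on f (carrier X) \<longleftrightarrow> a_kernel X Y f = {\<zero>\<^bsub>X\<^esub>}"
proof -
  interpret X: lmodule R X by fact
  interpret Y: lmodule R Y by fact
  have z: "f \<zero>\<^bsub>X\<^esub> = \<zero>\<^bsub>Y\<^esub>" using lmod_hom_zero[OF assms] .
  show ?thesis
  proof
    assume "inj_on f (carrier X)"
    then show "a_kernel X Y f = {\<zero>\<^bsub>X\<^esub>}"
      using z by (auto simp: mem_a_kernel inj_on_def)
  next
    assume k: "a_kernel X Y f = {\<zero>\<^bsub>X\<^esub>}"
    show "inj_on f (carrier X)"
    proof (rule inj_onI)
      fix x y assume xy: "x \<in> carrier X" "y \<in> carrier X" "f x = f y"
      then have "f (x \<ominus>\<^bsub>X\<^esub> y) = \<zero>\<^bsub>Y\<^esub>"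
        using lmod_hom_minus[OF assms xy(1,2)] lmod_homD(1)[OF assms(3)] Y.minus_eq_zero_iff by simp
      with xy k have "x \<ominus>\<^bsub>X\<^esub> y = \<zero>\<^bsub>X\<^esub>" by (metis X.M.minus_closed mem_a_kernel singletonD)
      with xy show "x = y" using X.minus_eq_zero_iff by blast
    qed
  qed
qed

text \<open>The underlying set consists of coset representatives rather than of cosets, so the
  quotient of a module on \<open>'a\<close> again lives on \<open>'a\<close>. For \<open>nat\<close>
  this lets simple quotients be compared with the given family of simple modules.\<close>

lemma lmodule_quotient:
  fixes X :: "('r, 'a) module"
  assumes "lmodule R X" and L: "submodule L R X"
  obtains Q :: "('r, 'a) module" and \<pi>
  where "lmodule R Q" "\<pi> \<in> lmod_hom R X Q" "\<pi> ` carrier X = carrier Q" "a_kernel X Q \<pi> = L"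
proof -
  interpret lmodule R X by fact
  have LX: "L \<subseteq> carrier X" and L0: "\<zero>\<^bsub>X\<^esub> \<in> L"
    and Lm: "\<And>x y. x \<in> L \<Longrightarrow> y \<in> L \<Longrightarrow> x \<ominus>\<^bsub>X\<^esub> y \<in> L"
    and Ls: "\<And>r x. r \<in> carrier R \<Longrightarrow> x \<in> L \<Longrightarrow> r \<odot>\<^bsub>X\<^esub> x \<in> L"
    using L by (auto simp: submodule_iff)
  \<comment> \<open>The predicate depends only on the coset of \<open>x\<close>, so
    \<open>\<rho>\<close> selects one representative per coset, and equal values of
    \<open>\<rho>\<close> mean congruence modulo \<open>L\<close>.\<close>
  define \<rho> where "\<rho> x = (SOME y. y \<in> carrier X \<and> x \<ominus>\<^bsub>X\<^esub> y \<in> L)" for x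
  have \<rho>: "\<rho> x \<in> carrier X \<and> x \<ominus>\<^bsub>X\<^esub> \<rho> x \<in> L" if "x \<in> carrier X" for x
    unfolding \<rho>_def by (rule someI[of _ x]) (use that L0 in \<open>simp add: minus_eq_zero_iff[THEN iffD2]\<close>)
  have \<rho>c: "\<rho> x \<in> carrier X" if "x \<in> carrier X" for x using \<rho> that by blast
  have sym: "y \<ominus>\<^bsub>X\<^esub> x \<in> L" if "x \<in> carrier X" "y \<in> carrier X" "x \<ominus>\<^bsub>X\<^esub> y \<in> L" for x y
    using submodule_neg[OF L that(3)] that(1,2) by (simp add: a_minus_def M.minus_add M.a_ac)
  have trans: "x \<ominus>\<^bsub>X\<^esub> z \<in> L"
    if "x \<in> carrier X" "y \<in> carrier X" "z \<in> carrier X" "x \<ominus>\<^bsub>X\<^esub> y \<in> L" "y \<ominus>\<^bsub>X\<^esub> z \<in> L" for x y z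
  proof -
    have "(x \<ominus>\<^bsub>X\<^esub> y) \<oplus>\<^bsub>X\<^esub> (y \<ominus>\<^bsub>X\<^esub> z) = ((x \<ominus>\<^bsub>X\<^esub> y) \<oplus>\<^bsub>X\<^esub> y) \<ominus>\<^bsub>X\<^esub> z"
      using that by (simp add: a_minus_def M.a_assoc)
    also have "\<dots> = x \<ominus>\<^bsub>X\<^esub> z" using that by (simp add: minus_add_cancel)
    finally show ?thesis using submodule_add[OF L that(4,5)] by simp
  qed
  have eq: "\<rho> x = \<rho> y \<longleftrightarrow> x \<ominus>\<^bsub>X\<^esub> y \<in> L" if "x \<in> carrier X" "y \<in> carrier X" for x y
  proof
    assume "\<rho> x = \<rho> y"
    then show "x \<ominus>\<^bsub>X\<^esub> y \<in> L"
      using \<rho>[OF that(1)] \<rho>[OF that(2)] that trans[of x "\<rho> y" y] sym[of y "\<rho> y"] by simp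
  next
    assume "x \<ominus>\<^bsub>X\<^esub> y \<in> L"
    then have "(z \<in> carrier X \<and> x \<ominus>\<^bsub>X\<^esub> z \<in> L) = (z \<in> carrier X \<and> y \<ominus>\<^bsub>X\<^esub> z \<in> L)" for z
      using that trans[of x y z] trans[of y x z] sym by blast
    then show "\<rho> x = \<rho> y" by (simp add: \<rho>_def)
  qed
  have sym': "\<rho> x \<ominus>\<^bsub>X\<^esub> x \<in> L" if "x \<in> carrier X" for x
    using \<rho>[OF that] sym that by blast
  have add1: "\<rho> (\<rho> x \<oplus>\<^bsub>X\<^esub> y) = \<rho> (x \<oplus>\<^bsub>X\<^esub> y)" if "x \<in> carrier X" "y \<in> carrier X" for x y
    using that sym'[OF that(1)] \<rho>c[OF that(1)] submodule_add[OF L _ L0]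
    by (simp add: eq add_minus_add) (simp add: a_minus_def M.r_neg)
  have add2: "\<rho> (x \<oplus>\<^bsub>X\<^esub> \<rho> y) = \<rho> (x \<oplus>\<^bsub>X\<^esub> y)" if "x \<in> carrier X" "y \<in> carrier X" for x y
    using add1[OF that(2,1)] that \<rho>c by (simp add: M.a_comm)
  have sm: "\<rho> (r \<odot>\<^bsub>X\<^esub> \<rho> x) = \<rho> (r \<odot>\<^bsub>X\<^esub> x)" if "r \<in> carrier R" "x \<in> carrier X" for r x
    using that sym'[OF that(2)] \<rho>c[OF that(2)] Ls[OF that(1)]
    by (simp add: eq smult_closed flip: smult_minus)
  have \<rho>\<rho>: "\<rho> (\<rho> x) = \<rho> x" if "x \<in> carrier X" for x
    using that sym' by (simp add: eq \<rho>c)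
  \<comment> \<open>Operations are computed in \<open>X\<close> and then normalised by
    \<open>\<rho>\<close>. The facts \<open>add1\<close>, \<open>add2\<close> and \<open>sm\<close>
    erase inner normalisations and so reduce the axioms for \<open>Q\<close> to those for
    \<open>X\<close>.\<close>
  define Q :: "('r, 'a) module" where
    "Q = \<lparr>carrier = \<rho> ` carrier X, monoid.mult = undefined, one = undefined, zero = \<rho> \<zero>\<^bsub>X\<^esub>,
      add = (\<lambda>x y. \<rho> (x \<oplus>\<^bsub>X\<^esub> y)), smult = (\<lambda>r x. \<rho> (r \<odot>\<^bsub>X\<^esub> x))\<rparr>"
  have "abelian_group Q"
  proof (rule abelian_groupI)
    fix x assume "x \<in> carrier Q"
    then obtain a where a: "a \<in> carrier X" "x = \<rho> a" by (auto simp: Q_def)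
    then have "\<rho> (\<ominus>\<^bsub>X\<^esub> a) \<in> carrier Q" "\<rho> (\<ominus>\<^bsub>X\<^esub> a) \<oplus>\<^bsub>Q\<^esub> x = \<zero>\<^bsub>Q\<^esub>"
      by (auto simp: Q_def M.l_neg add1 add2 \<rho>c)
    then show "\<exists>y\<in>carrier Q. y \<oplus>\<^bsub>Q\<^esub> x = \<zero>\<^bsub>Q\<^esub>" by blast
  next
    fix x assume "x \<in> carrier Q"
    then show "\<zero>\<^bsub>Q\<^esub> \<oplus>\<^bsub>Q\<^esub> x = x" by (auto simp: Q_def add1 add2 \<rho>c)
  next
    fix x y assume "x \<in> carrier Q" "y \<in> carrier Q"
    then show "x \<oplus>\<^bsub>Q\<^esub> y = y \<oplus>\<^bsub>Q\<^esub> x" by (auto simp: Q_def M.a_comm \<rho>c)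
  qed (auto simp: Q_def add1 add2 \<rho>c M.a_assoc)
  moreover have "lmodule_axioms R Q"
    by (unfold_locales; clarsimp simp: Q_def smult_closed add1 add2 sm \<rho>c)
      (simp_all add: smult_closed smult_l_distr smult_r_distr smult_assoc smult_one add1 add2 sm \<rho>\<rho>)
  ultimately have "lmodule R Q"
    by (intro lmodule.intro R.ring_axioms)
  moreover have "\<rho> \<in> lmod_hom R X Q"
    by (auto intro!: lmod_homI simp: Q_def add1 add2 sm \<rho>c)
  moreover have "a_kernel X Q \<rho> = L"
    using eq[OF _ M.zero_closed] LX minus_zero by (auto simp: mem_a_kernel Q_def)
  ultimately show ?thesis by (intro that) (auto simp: Q_def)
qed

text \<open>Two preimages of one point differ by an element of the kernel, so \<open>g\<close>
  agrees on them. The form with any surjection \<open>\<pi>\<close> allows descent along surjections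
  onto \<open>M\<close> or \<open>G\<close>, not only along quotient maps.\<close>

lemma lmod_hom_factor:
  assumes "lmodule R X" "lmodule R Q" "lmodule R Y" "\<pi> \<in> lmod_hom R X Q" "\<pi> ` carrier X = carrier Q"
    "g \<in> lmod_hom R X Y" "a_kernel X Q \<pi> \<subseteq> a_kernel X Y g"
  obtains \<phi> where "\<phi> \<in> lmod_hom R Q Y" "\<And>x. x \<in> carrier X \<Longrightarrow> \<phi> (\<pi> x) = g x"
proof -
  interpret X: lmodule R X by fact
  interpret Q: lmodule R Q by fact
  interpret Y: lmodule R Y by fact
  define \<phi> where "\<phi> = g \<circ> inv_into (carrier X) \<pi>"
  have *: "\<phi> (\<pi> x) = g x" if x: "x \<in> carrier X" for x
  proof -
    let ?y = "inv_into (carrier X) \<pi> (\<pi> x)"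
    have y: "?y \<in> carrier X" "\<pi> ?y = \<pi> x" using x by (auto simp: inv_into_into f_inv_into_f)
    then have "?y \<ominus>\<^bsub>X\<^esub> x \<in> a_kernel X Q \<pi>"
      using x lmod_hom_minus[OF assms(1,2,4)] lmod_homD(1)[OF assms(4)]
      by (simp add: mem_a_kernel Q.minus_eq_zero_iff)
    then have "?y \<ominus>\<^bsub>X\<^esub> x \<in> a_kernel X Y g" using assms(7) by blast
    then have "g ?y = g x"
      using x y lmod_hom_minus[OF assms(1,3,6)] lmod_homD(1)[OF assms(6)]
      by (simp add: mem_a_kernel Y.minus_eq_zero_iff)
    then show ?thesis by (simp add: \<phi>_def)
  qed
  have "\<phi> \<in> lmod_hom R Q Y"
  proof (rule lmod_homI; (unfold assms(5)[symmetric])?; clarify?)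
    fix x assume "x \<in> carrier X" then show "\<phi> (\<pi> x) \<in> carrier Y"
      using * lmod_homD(1)[OF assms(6)] by simp
  next
    fix x y assume "x \<in> carrier X" "y \<in> carrier X" then show "\<phi> (\<pi> x \<oplus>\<^bsub>Q\<^esub> \<pi> y) = \<phi> (\<pi> x) \<oplus>\<^bsub>Y\<^esub> \<phi> (\<pi> y)"
      using *[of "x \<oplus>\<^bsub>X\<^esub> y"] by (simp add: * lmod_homD(2)[OF assms(6)] lmod_homD(2)[OF assms(4)])
  next
    fix r x assume "r \<in> carrier R" "x \<in> carrier X" then show "\<phi> (r \<odot>\<^bsub>Q\<^esub> \<pi> x) = r \<odot>\<^bsub>Y\<^esub> \<phi> (\<pi> x)"
      using *[of "r \<odot>\<^bsub>X\<^esub> x"] by (simp add: * X.smult_closed lmod_homD(3)[OF assms(6)] lmod_homD(3)[OF assms(4)])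
  qed
  with * show ?thesis by (rule that[rotated])
qed

text \<open>Serves to compare two extensions that are both quotients of one module
  \<open>dprod N X\<close> by the same kernel.\<close>

lemma lmod_iso_factor:
  assumes "lmodule R X" "lmodule R Q" "lmodule R Y" "\<pi> \<in> lmod_hom R X Q" "\<pi> ` carrier X = carrier Q"
    "g \<in> lmod_hom R X Y" "g ` carrier X = carrier Y" "a_kernel X Q \<pi> = a_kernel X Y g"
  obtains \<phi> where "\<phi> \<in> lmod_iso R Q Y" "\<And>x. x \<in> carrier X \<Longrightarrow> \<phi> (\<pi> x) = g x"
proof -
  interpret X: lmodule R X by fact
  interpret Q: lmodule R Q by fact
  obtain \<phi> where \<phi>: "\<phi> \<in> lmod_hom R Q Y" "\<And>x. x \<in> carrier X \<Longrightarrow> \<phi> (\<pi> x) = g x"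
    using lmod_hom_factor[OF assms(1-6)] assms(8) by blast
  have "x = \<zero>\<^bsub>Q\<^esub>" if "x \<in> a_kernel Q Y \<phi>" for x
  proof -
    have "x \<in> \<pi> ` carrier X" using that assms(5) by (simp add: mem_a_kernel)
    then obtain a where "a \<in> carrier X" "x = \<pi> a" by blast
    with that \<phi>(2) have "a \<in> a_kernel X Y g" by (simp add: mem_a_kernel)
    then show ?thesis using assms(8) \<open>x = \<pi> a\<close> by (metis mem_a_kernel)
  qed
  then have "a_kernel Q Y \<phi> = {\<zero>\<^bsub>Q\<^esub>}"
    using lmod_hom_zero[OF assms(2,3) \<phi>(1)] by (auto simp: mem_a_kernel)
  then have "inj_on \<phi> (carrier Q)" using lmod_hom_inj_iff[OF assms(2,3) \<phi>(1)] by simp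
  moreover have "\<phi> ` carrier Q = carrier Y"
    using assms(7) \<phi>(2) by (auto simp: assms(5)[symmetric] image_image)
  ultimately have "\<phi> \<in> lmod_iso R Q Y" using \<phi>(1) by (simp add: lmod_iso_def bij_betw_def)
  with \<phi>(2) show ?thesis by (rule that[rotated])
qed

definition dprod :: "('r, 'a) module \<Rightarrow> ('r, 'b) module \<Rightarrow> ('r, 'a \<times> 'b) module" where
  "dprod A B = \<lparr>carrier = carrier A \<times> carrier B, monoid.mult = undefined, one = undefined,
     zero = (\<zero>\<^bsub>A\<^esub>, \<zero>\<^bsub>B\<^esub>), add = (\<lambda>(a, b) (a', b'). (a \<oplus>\<^bsub>A\<^esub> a', b \<oplus>\<^bsub>B\<^esub> b')),
     smult = (\<lambda>r (a, b). (r \<odot>\<^bsub>A\<^esub> a, r \<odot>\<^bsub>B\<^esub> b))\<rparr>"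

lemma dprod_simps [simp]:
  "carrier (dprod A B) = carrier A \<times> carrier B"
  "\<zero>\<^bsub>dprod A B\<^esub> = (\<zero>\<^bsub>A\<^esub>, \<zero>\<^bsub>B\<^esub>)"
  "(a, b) \<oplus>\<^bsub>dprod A B\<^esub> (a', b') = (a \<oplus>\<^bsub>A\<^esub> a', b \<oplus>\<^bsub>B\<^esub> b')"
  "r \<odot>\<^bsub>dprod A B\<^esub> (a, b) = (r \<odot>\<^bsub>A\<^esub> a, r \<odot>\<^bsub>B\<^esub> b)"
  by (simp_all add: dprod_def)

lemma lmodule_dprod:
  assumes "lmodule R A" "lmodule R B"
  shows "lmodule R (dprod A B)"
proof -
  interpret A: lmodule R A by fact
  interpret B: lmodule R B by fact
  have "abelian_group (dprod A B)"
  proof (rule abelian_groupI)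
    fix x assume "x \<in> carrier (dprod A B)"
    then have "(\<ominus>\<^bsub>A\<^esub> fst x, \<ominus>\<^bsub>B\<^esub> snd x) \<in> carrier (dprod A B)"
      "(\<ominus>\<^bsub>A\<^esub> fst x, \<ominus>\<^bsub>B\<^esub> snd x) \<oplus>\<^bsub>dprod A B\<^esub> x = \<zero>\<^bsub>dprod A B\<^esub>"
      by (auto simp: A.M.l_neg B.M.l_neg)
    then show "\<exists>y\<in>carrier (dprod A B). y \<oplus>\<^bsub>dprod A B\<^esub> x = \<zero>\<^bsub>dprod A B\<^esub>" by blast
  qed (auto simp: A.M.a_ac B.M.a_ac)
  moreover have "lmodule_axioms R (dprod A B)"
    by unfold_locales
      (auto simp: A.smult_closed A.smult_l_distr A.smult_r_distr A.smult_assoc A.smult_one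
        B.smult_closed B.smult_l_distr B.smult_r_distr B.smult_assoc B.smult_one)
  ultimately show ?thesis by (intro lmodule.intro A.R.ring_axioms)
qed

lemma dprod_minus:
  assumes "lmodule R A" "lmodule R B" "a \<in> carrier A" "a' \<in> carrier A" "b \<in> carrier B" "b' \<in> carrier B"
  shows "(a, b) \<ominus>\<^bsub>dprod A B\<^esub> (a', b') = (a \<ominus>\<^bsub>A\<^esub> a', b \<ominus>\<^bsub>B\<^esub> b')"
proof -
  interpret A: lmodule R A by fact
  interpret B: lmodule R B by fact
  interpret P: lmodule R "dprod A B" using lmodule_dprod[OF assms(1,2)] .
  have "\<ominus>\<^bsub>dprod A B\<^esub> (a', b') = (\<ominus>\<^bsub>A\<^esub> a', \<ominus>\<^bsub>B\<^esub> b')"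
    using assms(3-6) by (intro P.M.minus_equality) (auto simp: A.M.l_neg B.M.l_neg)
  then show ?thesis by (simp add: a_minus_def)
qed

section \<open>Lifting surjections to extensions\<close>

definition mhom ::
  "('r, 'k) ring_scheme \<Rightarrow> ('r, 'a) module \<Rightarrow> ('r, 'b) module \<Rightarrow> ('a \<Rightarrow> 'b) set" where
  "mhom R X Y = {f \<in> extensional (carrier X). f \<in> lmod_hom R X Y}"

definition hom_over ::
  "('r, 'k) ring_scheme \<Rightarrow> ('r, 'a) module \<Rightarrow> ('a \<Rightarrow> 'c) \<Rightarrow> ('r, 'b) module \<Rightarrow> ('b \<Rightarrow> 'c) \<Rightarrow> ('a \<Rightarrow> 'b) set" where
  "hom_over R X f E p = {g \<in> mhom R X E. \<forall>x\<in>carrier X. p (g x) = f x}"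

abbreviation kmod :: "('r, 'a) module \<Rightarrow> ('r, 'b) module \<Rightarrow> ('a \<Rightarrow> 'b) \<Rightarrow> ('r, 'a) module" where
  "kmod X Y f \<equiv> X\<lparr>carrier := a_kernel X Y f\<rparr>"

lemma kmod_lmodule:
  assumes "lmodule R X" "lmodule R Y" "f \<in> lmod_hom R X Y"
  shows "lmodule R (kmod X Y f)"
  using lmodule.submodule_lmodule[OF assms(1) a_kernel_submodule[OF assms]] .

lemma finite_mhom: "finite (carrier X) \<Longrightarrow> finite (carrier Y) \<Longrightarrow> finite (mhom R X Y)"
  by (rule finite_subset[OF _ finite_PiE[of "carrier X" "\<lambda>_. carrier Y"]])
    (auto simp: mhom_def PiE_def lmod_homD)

lemma finite_hom_over: "finite (carrier X) \<Longrightarrow> finite (carrier Y) \<Longrightarrow> finite (hom_over R X f Y p)"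
  using finite_mhom[of X Y R] by (simp add: hom_over_def)

lemma lmod_hom_cong:
  assumes "lmodule R X" "f \<in> lmod_hom R X Y" "\<And>x. x \<in> carrier X \<Longrightarrow> g x = f x"
  shows "g \<in> lmod_hom R X Y"
proof -
  interpret X: lmodule R X by fact
  show ?thesis
    by (rule lmod_homI) (use assms in \<open>auto simp: lmod_homD[OF assms(2)] X.smult_closed\<close>)
qed

lemma restrict_mhom:
  "lmodule R X \<Longrightarrow> f \<in> lmod_hom R X Y \<Longrightarrow> restrict f (carrier X) \<in> mhom R X Y"
  by (auto simp: mhom_def intro: lmod_hom_cong)

text \<open>Injectivity of \<open>i\<close> lets every identity be checked after applying
  \<open>i\<close>, where it becomes an identity for \<open>\<psi>\<close>.\<close>

lemma lmod_hom_lift: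
  assumes "lmodule R Y" "lmodule R N" "i \<in> lmod_hom R N E" "inj_on i (carrier N)" "\<psi> \<in> lmod_hom R Y E"
    "\<psi> ` carrier Y \<subseteq> i ` carrier N"
  shows "inv_into (carrier N) i \<circ> \<psi> \<in> lmod_hom R Y N"
    "\<And>y. y \<in> carrier Y \<Longrightarrow> i ((inv_into (carrier N) i \<circ> \<psi>) y) = \<psi> y"
proof -
  interpret Y: lmodule R Y by fact
  interpret N: lmodule R N by fact
  let ?\<phi> = "inv_into (carrier N) i \<circ> \<psi>"
  show i: "i (?\<phi> y) = \<psi> y" if "y \<in> carrier Y" for y
    using subsetD[OF assms(6) imageI[OF that]] by (simp add: f_inv_into_f)
  have c: "?\<phi> y \<in> carrier N" if "y \<in> carrier Y" for y
    using subsetD[OF assms(6) imageI[OF that]] by (simp add: inv_into_into)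
  note inj = inj_onD[OF assms(4)]
  show "?\<phi> \<in> lmod_hom R Y N"
  proof (rule lmod_homI)
    fix x y assume "x \<in> carrier Y" "y \<in> carrier Y"
    then show "?\<phi> (x \<oplus>\<^bsub>Y\<^esub> y) = ?\<phi> x \<oplus>\<^bsub>N\<^esub> ?\<phi> y"
      by (intro inj) (simp_all add: c i lmod_homD[OF assms(3)] lmod_homD[OF assms(5)] del: comp_apply)
  next
    fix r x assume "r \<in> carrier R" "x \<in> carrier Y"
    then show "?\<phi> (r \<odot>\<^bsub>Y\<^esub> x) = r \<odot>\<^bsub>N\<^esub> ?\<phi> x"
      by (intro inj) (simp_all add: c i lmod_homD[OF assms(3)] lmod_homD[OF assms(5)] Y.smult_closed
          N.smult_closed del: comp_apply)
  qed (use c in auto)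
qed

lemma lmod_hom_add:
  assumes "lmodule R Y" "f \<in> lmod_hom R X Y" "g \<in> lmod_hom R X Y"
  shows "(\<lambda>x. f x \<oplus>\<^bsub>Y\<^esub> g x) \<in> lmod_hom R X Y"
proof -
  interpret Y: lmodule R Y by fact
  show ?thesis
    using assms(2,3)
    by (intro lmod_homI) (auto simp: lmod_homD Y.M.a_ac Y.smult_r_distr Y.smult_closed)
qed

lemma lmod_hom_diff:
  assumes "lmodule R Y" "f \<in> lmod_hom R X Y" "g \<in> lmod_hom R X Y"
  shows "(\<lambda>x. f x \<ominus>\<^bsub>Y\<^esub> g x) \<in> lmod_hom R X Y"
proof -
  interpret Y: lmodule R Y by fact
  show ?thesis
    using assms(2,3)
    by (intro lmod_homI) (auto simp: lmod_homD Y.add_minus_add Y.smult_minus)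
qed

section \<open>Extensions as pushouts, and the lifts to them\<close>

lemma is_extensionD:
  assumes "is_extension R M N (E, i, p)"
  shows "lmodule R E" "i \<in> lmod_hom R N E" "inj_on i (carrier N)" "p \<in> lmod_hom R E M"
    "p ` carrier E = carrier M" "i ` carrier N = a_kernel E M p"
    "\<And>y. y \<in> carrier N \<Longrightarrow> p (i y) = \<zero>\<^bsub>M\<^esub>"
  using assms by (auto simp: is_extension_def mem_a_kernel)

text \<open>Exhibits \<open>E\<close> as the pushout of the inclusion of \<open>ker f\<close> in
  \<open>X\<close> along \<open>h\<close>. The point is that the kernel is described by
  \<open>f\<close> and \<open>h\<close> alone, without \<open>E\<close>, \<open>i\<close>,
  \<open>p\<close> or \<open>g\<close>.\<close>

lemma pushout_cover:
  assumes M: "lmodule R M" and N: "lmodule R N" and X: "lmodule R X"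
    and e: "is_extension R M N (E, i, p)"
    and f: "f \<in> lmod_hom R X M" "f ` carrier X = carrier M"
    and g: "g \<in> lmod_hom R X E" "\<And>x. x \<in> carrier X \<Longrightarrow> p (g x) = f x"
    and h: "\<And>x. x \<in> a_kernel X M f \<Longrightarrow> h x \<in> carrier N \<and> g x = i (h x)"
  defines "\<pi> \<equiv> \<lambda>(s, x). i s \<oplus>\<^bsub>E\<^esub> g x"
  shows "\<pi> \<in> lmod_hom R (dprod N X) E" "\<pi> ` carrier (dprod N X) = carrier E"
    "a_kernel (dprod N X) E \<pi> = {(s, x). s \<in> carrier N \<and> x \<in> a_kernel X M f \<and> s \<oplus>\<^bsub>N\<^esub> h x = \<zero>\<^bsub>N\<^esub>}"
proof -
  note ext = is_extensionD[OF e]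
  interpret M: lmodule R M by fact
  interpret N: lmodule R N by fact
  interpret X: lmodule R X by fact
  interpret E: lmodule R E using ext by blast
  show \<pi>: "\<pi> \<in> lmod_hom R (dprod N X) E"
    unfolding \<pi>_def using ext(2) g(1)
    by (intro lmod_homI) (auto simp: lmod_homD E.M.a_ac E.smult_r_distr E.smult_closed)
  show "\<pi> ` carrier (dprod N X) = carrier E"
  proof
    show "\<pi> ` carrier (dprod N X) \<subseteq> carrier E" using lmod_homD(1)[OF \<pi>] by blast
    show "carrier E \<subseteq> \<pi> ` carrier (dprod N X)"
    proof
      fix y assume y: "y \<in> carrier E"
      then have "p y \<in> f ` carrier X" using ext(5) f(2) by blast
      then obtain x where x: "x \<in> carrier X" "f x = p y" by auto
      then have gx: "g x \<in> carrier E" using lmod_homD(1)[OF g(1)] by blast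
      have "p (y \<ominus>\<^bsub>E\<^esub> g x) = \<zero>\<^bsub>M\<^esub>"
        using lmod_hom_minus[OF ext(1) M ext(4) y gx] g(2)[OF x(1)] x lmod_homD(1)[OF ext(4) y]
        by (simp add: M.minus_eq_zero_iff)
      then have "y \<ominus>\<^bsub>E\<^esub> g x \<in> i ` carrier N" using y gx by (simp add: ext(6) mem_a_kernel)
      then obtain s where "s \<in> carrier N" "y \<ominus>\<^bsub>E\<^esub> g x = i s" by auto
      then have "y = \<pi> (s, x)" using E.minus_add_cancel[OF y gx] by (simp add: \<pi>_def)
      with x \<open>s \<in> carrier N\<close> show "y \<in> \<pi> ` carrier (dprod N X)" by auto
    qed
  qed
  have zeroE: "i \<zero>\<^bsub>N\<^esub> = \<zero>\<^bsub>E\<^esub>" using lmod_hom_zero[OF N ext(1,2)] .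
  \<comment> \<open>Applying \<open>p\<close> to the relation removes \<open>i s\<close> and leaves
    \<open>f x = \<zero>\<close>; only then is \<open>h x\<close> available.\<close>
  have 1: "x \<in> a_kernel X M f" if "s \<in> carrier N" "x \<in> carrier X" "i s \<oplus>\<^bsub>E\<^esub> g x = \<zero>\<^bsub>E\<^esub>" for s x
  proof -
    have "p (i s \<oplus>\<^bsub>E\<^esub> g x) = f x"
      using that(1,2) lmod_homD(2)[OF ext(4)] lmod_homD(1)[OF ext(2)] lmod_homD(1)[OF g(1)] ext(7) g(2)
        lmod_homD(1)[OF f(1)] by simp
    then show ?thesis using that(2) lmod_hom_zero[OF ext(1) M ext(4)] unfolding that(3) by (simp add: mem_a_kernel)
  qed
  have 2: "i s \<oplus>\<^bsub>E\<^esub> g x = \<zero>\<^bsub>E\<^esub> \<longleftrightarrow> s \<oplus>\<^bsub>N\<^esub> h x = \<zero>\<^bsub>N\<^esub>" if "s \<in> carrier N" "x \<in> a_kernel X M f" for s x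
  proof -
    have hx: "h x \<in> carrier N" "g x = i (h x)" using h[OF that(2)] by auto
    have "i s \<oplus>\<^bsub>E\<^esub> g x = i (s \<oplus>\<^bsub>N\<^esub> h x)"
      unfolding hx(2) using lmod_homD(2)[OF ext(2) that(1) hx(1)] by (rule sym)
    moreover have "i (s \<oplus>\<^bsub>N\<^esub> h x) = \<zero>\<^bsub>E\<^esub> \<longleftrightarrow> s \<oplus>\<^bsub>N\<^esub> h x = \<zero>\<^bsub>N\<^esub>"
      unfolding zeroE[symmetric]
      by (rule inj_on_eq_iff[OF ext(3) N.M.add.m_closed[OF that(1) hx(1)] N.M.zero_closed])
    ultimately show ?thesis by simp
  qed
  show "a_kernel (dprod N X) E \<pi> = {(s, x). s \<in> carrier N \<and> x \<in> a_kernel X M f \<and> s \<oplus>\<^bsub>N\<^esub> h x = \<zero>\<^bsub>N\<^esub>}"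
  proof (intro subset_antisym subrelI)
    fix s x assume "(s, x) \<in> a_kernel (dprod N X) E \<pi>"
    then have "s \<in> carrier N" "x \<in> carrier X" "i s \<oplus>\<^bsub>E\<^esub> g x = \<zero>\<^bsub>E\<^esub>"
      by (simp_all add: mem_a_kernel \<pi>_def)
    with 1 2 show "(s, x) \<in> {(s, x). s \<in> carrier N \<and> x \<in> a_kernel X M f \<and> s \<oplus>\<^bsub>N\<^esub> h x = \<zero>\<^bsub>N\<^esub>}" by blast
  next
    fix s x assume "(s, x) \<in> {(s, x). s \<in> carrier N \<and> x \<in> a_kernel X M f \<and> s \<oplus>\<^bsub>N\<^esub> h x = \<zero>\<^bsub>N\<^esub>}"
    then have *: "s \<in> carrier N" "x \<in> a_kernel X M f" "s \<oplus>\<^bsub>N\<^esub> h x = \<zero>\<^bsub>N\<^esub>" by auto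
    then have "i s \<oplus>\<^bsub>E\<^esub> g x = \<zero>\<^bsub>E\<^esub>" using 2 by blast
    with * show "(s, x) \<in> a_kernel (dprod N X) E \<pi>" by (simp add: mem_a_kernel \<pi>_def)
  qed
qed

text \<open>By \<open>pushout_cover\<close> both middle terms are quotients of
  \<open>dprod N X\<close> by the same kernel. Hence a map on \<open>ker f\<close> extends to a lift
  of \<open>f\<close> for at most one extension class.\<close>

lemma ext_equiv_if_same_restriction:
  assumes M: "lmodule R M" and N: "lmodule R N" and X: "lmodule R X"
    and e: "is_extension R M N (E, i, p)" "is_extension R M N (E', i', p')"
    and f: "f \<in> lmod_hom R X M" "f ` carrier X = carrier M"
    and g: "g \<in> lmod_hom R X E" "\<And>x. x \<in> carrier X \<Longrightarrow> p (g x) = f x"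
      "\<And>x. x \<in> a_kernel X M f \<Longrightarrow> h x \<in> carrier N \<and> g x = i (h x)"
    and g': "g' \<in> lmod_hom R X E'" "\<And>x. x \<in> carrier X \<Longrightarrow> p' (g' x) = f x"
      "\<And>x. x \<in> a_kernel X M f \<Longrightarrow> h x \<in> carrier N \<and> g' x = i' (h x)"
  shows "ext_equiv R M N (E, i, p) (E', i', p')"
proof -
  note ext = is_extensionD[OF e(1)] and ext' = is_extensionD[OF e(2)]
  interpret M: lmodule R M by fact
  interpret N: lmodule R N by fact
  interpret X: lmodule R X by fact
  interpret E: lmodule R E using ext by blast
  interpret E': lmodule R E' using ext' by blast
  note c = pushout_cover[OF M N X e(1) f g] and c' = pushout_cover[OF M N X e(2) f g']
  have k: "a_kernel (dprod N X) E (\<lambda>(s, x). i s \<oplus>\<^bsub>E\<^esub> g x) = a_kernel (dprod N X) E' (\<lambda>(s, x). i' s \<oplus>\<^bsub>E'\<^esub> g' x)"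
    using c(3) c'(3) by simp
  obtain \<phi> where \<phi>: "\<phi> \<in> lmod_iso R E E'"
    "\<And>z. z \<in> carrier (dprod N X) \<Longrightarrow> \<phi> ((\<lambda>(s, x). i s \<oplus>\<^bsub>E\<^esub> g x) z) = (\<lambda>(s, x). i' s \<oplus>\<^bsub>E'\<^esub> g' x) z"
    using lmod_iso_factor[OF lmodule_dprod[OF N X] ext(1) ext'(1) c(1,2) c'(1,2) k] by blast
  have \<phi>': "\<phi> (i s \<oplus>\<^bsub>E\<^esub> g x) = i' s \<oplus>\<^bsub>E'\<^esub> g' x" if "s \<in> carrier N" "x \<in> carrier X" for s x
    using \<phi>(2)[of "(s, x)"] that by simp
  have "\<phi> (i s) = i' s" if "s \<in> carrier N" for s
    using \<phi>'[OF that X.M.zero_closed] that lmod_hom_zero[OF X ext(1) g(1)] lmod_hom_zero[OF X ext'(1) g'(1)]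
      lmod_homD(1)[OF ext(2)] lmod_homD(1)[OF ext'(2)] by simp
  moreover have "p' (\<phi> y) = p y" if y: "y \<in> carrier E" for y
  proof -
    have "y \<in> (\<lambda>(s, x). i s \<oplus>\<^bsub>E\<^esub> g x) ` carrier (dprod N X)" using y c(2) by simp
    then obtain s x where sx: "s \<in> carrier N" "x \<in> carrier X" "y = i s \<oplus>\<^bsub>E\<^esub> g x" by auto
    have "p y = f x"
      using sx lmod_homD(2)[OF ext(4)] lmod_homD(1)[OF ext(2)] lmod_homD(1)[OF g(1)] ext(7) g(2)
        lmod_homD(1)[OF f(1)] by simp
    moreover have "p' (\<phi> y) = f x"
      using sx \<phi>' lmod_homD(2)[OF ext'(4)] lmod_homD(1)[OF ext'(2)] lmod_homD(1)[OF g'(1)] ext'(7) g'(2)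
        lmod_homD(1)[OF f(1)] by simp
    ultimately show ?thesis by simp
  qed
  ultimately show ?thesis using \<phi>(1) by (auto simp: ext_equiv_def)
qed

text \<open>The existence half: \<open>h\<close> extends to \<open>X\<close> once \<open>N\<close>
  is enlarged to the quotient of \<open>dprod N X\<close> by an antidiagonal copy of
  \<open>ker f\<close>.\<close>

lemma pushout_extension:
  fixes M :: "('r, 'a) module" and N :: "('r, 'b) module" and X :: "('r, 'c) module"
  assumes M: "lmodule R M" and N: "lmodule R N" and X: "lmodule R X"
    and f: "f \<in> lmod_hom R X M" "f ` carrier X = carrier M"
    and h: "h \<in> lmod_hom R (kmod X M f) N"
  obtains E :: "('r, 'b \<times> 'c) module" and i p g
  where "is_extension R M N (E, i, p)" "g \<in> lmod_hom R X E" "\<And>x. x \<in> carrier X \<Longrightarrow> p (g x) = f x"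
    "\<And>x. x \<in> a_kernel X M f \<Longrightarrow> g x = i (h x)"
proof -
  interpret M: lmodule R M by fact
  interpret N: lmodule R N by fact
  interpret X: lmodule R X by fact
  interpret K: lmodule R "kmod X M f" using kmod_lmodule[OF X M f(1)] .
  define P where "P = dprod N X"
  interpret P: lmodule R P unfolding P_def using lmodule_dprod[OF N X] .
  have hc: "h x \<in> carrier N" if "x \<in> a_kernel X M f" for x
    using lmod_homD(1)[OF h] that by simp
  have hadd: "h (x \<oplus>\<^bsub>X\<^esub> y) = h x \<oplus>\<^bsub>N\<^esub> h y" if "x \<in> a_kernel X M f" "y \<in> a_kernel X M f" for x y
    using lmod_homD(2)[OF h] that by simp
  have hsm: "h (r \<odot>\<^bsub>X\<^esub> x) = r \<odot>\<^bsub>N\<^esub> h x" if "x \<in> a_kernel X M f" "r \<in> carrier R" for x r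
    using lmod_homD(3)[OF h] that by simp
  have h0: "h \<zero>\<^bsub>X\<^esub> = \<zero>\<^bsub>N\<^esub>" using lmod_hom_zero[OF K.lmodule_axioms N h] by simp
  have Ks: "submodule (a_kernel X M f) R X" using a_kernel_submodule[OF X M f(1)] .
  note Ks' = Ks[unfolded X.submodule_iff]
  \<comment> \<open>The sign identifies \<open>(\<zero>, x)\<close> with
    \<open>(h x, \<zero>)\<close>, which becomes \<open>g x = i (h x)\<close>.\<close>
  define L where "L = {(\<ominus>\<^bsub>N\<^esub> h x, x) | x. x \<in> a_kernel X M f}"
  have hneg: "h (x \<ominus>\<^bsub>X\<^esub> y) = h x \<ominus>\<^bsub>N\<^esub> h y" if "x \<in> a_kernel X M f" "y \<in> a_kernel X M f" for x y
  proof -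
    have xy: "x \<ominus>\<^bsub>X\<^esub> y \<in> a_kernel X M f" "x \<in> carrier X" "y \<in> carrier X" using Ks' that by auto
    have "h x = h (x \<ominus>\<^bsub>X\<^esub> y) \<oplus>\<^bsub>N\<^esub> h y"
      using hadd[OF xy(1) that(2)] X.minus_add_cancel xy by simp
    then show ?thesis using N.add_minus_cancel hc xy that by simp
  qed
  have L: "submodule L R P"
    unfolding P.submodule_iff
  proof (intro conjI ballI)
    show "L \<subseteq> carrier P" using Ks' hc by (auto simp: L_def P_def)
    show "\<zero>\<^bsub>P\<^esub> \<in> L" using Ks' h0 N.M.add.inv_one by (force simp: L_def P_def a_inv_def)
    fix u v assume "u \<in> L" "v \<in> L"
    then obtain x y where xy: "u = (\<ominus>\<^bsub>N\<^esub> h x, x)" "v = (\<ominus>\<^bsub>N\<^esub> h y, y)" "x \<in> a_kernel X M f" "y \<in> a_kernel X M f"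
      by (auto simp: L_def)
    then have xy': "x \<in> carrier X" "y \<in> carrier X" "h x \<in> carrier N" "h y \<in> carrier N"
      using Ks' hc by auto
    then have "\<ominus>\<^bsub>N\<^esub> h x \<ominus>\<^bsub>N\<^esub> \<ominus>\<^bsub>N\<^esub> h y = \<ominus>\<^bsub>N\<^esub> (h x \<ominus>\<^bsub>N\<^esub> h y)"
      by (simp add: a_minus_def N.M.minus_add)
    then have "u \<ominus>\<^bsub>P\<^esub> v = (\<ominus>\<^bsub>N\<^esub> h (x \<ominus>\<^bsub>X\<^esub> y), x \<ominus>\<^bsub>X\<^esub> y)"
      using xy' xy by (simp add: P_def dprod_minus[OF N X] hneg)
    then show "u \<ominus>\<^bsub>P\<^esub> v \<in> L" using Ks' xy by (auto simp: L_def)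
  next
    fix r u assume r: "r \<in> carrier R" and "u \<in> L"
    then obtain x where x: "u = (\<ominus>\<^bsub>N\<^esub> h x, x)" "x \<in> a_kernel X M f" by (auto simp: L_def)
    then have "r \<odot>\<^bsub>P\<^esub> u = (\<ominus>\<^bsub>N\<^esub> h (r \<odot>\<^bsub>X\<^esub> x), r \<odot>\<^bsub>X\<^esub> x)"
      using r by (simp add: P_def hsm N.smult_neg hc)
    then show "r \<odot>\<^bsub>P\<^esub> u \<in> L" using Ks' x r by (auto simp: L_def)
  qed
  obtain E :: "('r, 'b \<times> 'c) module" and \<pi> where E: "lmodule R E" and \<pi>: "\<pi> \<in> lmod_hom R P E"
    "\<pi> ` carrier P = carrier E" and k\<pi>: "a_kernel P E \<pi> = L"
    using lmodule_quotient[OF P.lmodule_axioms L] .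
  interpret E: lmodule R E by fact
  define i where "i = (\<lambda>s. \<pi> (s, \<zero>\<^bsub>X\<^esub>))"
  define g where "g = (\<lambda>x. \<pi> (\<zero>\<^bsub>N\<^esub>, x))"
  have i1: "(\<lambda>s. (s, \<zero>\<^bsub>X\<^esub>)) \<in> lmod_hom R N P" by (intro lmod_homI) (auto simp: P_def X.smult_zero)
  have g1: "(\<lambda>x. (\<zero>\<^bsub>N\<^esub>, x)) \<in> lmod_hom R X P" by (intro lmod_homI) (auto simp: P_def N.smult_zero)
  have i: "i \<in> lmod_hom R N E" using lmod_hom_comp[OF i1 \<pi>(1)] by (simp add: i_def comp_def)
  have g: "g \<in> lmod_hom R X E" using lmod_hom_comp[OF g1 \<pi>(1)] by (simp add: g_def comp_def)
  have fs: "(f \<circ> snd) \<in> lmod_hom R P M"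
    by (rule lmod_hom_comp[OF _ f(1)]) (auto intro!: lmod_homI simp: P_def)
  have "L \<subseteq> a_kernel P M (f \<circ> snd)"
    using P.submodule_iff[THEN iffD1, OF L] by (auto simp: L_def mem_a_kernel P_def hc)
  then obtain p where p: "p \<in> lmod_hom R E M" "\<And>z. z \<in> carrier P \<Longrightarrow> p (\<pi> z) = (f \<circ> snd) z"
    using lmod_hom_factor[OF P.lmodule_axioms E M \<pi> fs] k\<pi> by blast
  have pg: "p (g x) = f x" if "x \<in> carrier X" for x
    using p(2)[of "(\<zero>\<^bsub>N\<^esub>, x)"] that by (simp add: g_def P_def)
  have \<pi>eq: "\<pi> u = \<pi> v" if "u \<in> carrier P" "v \<in> carrier P" "u \<ominus>\<^bsub>P\<^esub> v \<in> L" for u v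
    using that lmod_hom_minus[OF P.lmodule_axioms E \<pi>(1) that(1,2)] lmod_homD(1)[OF \<pi>(1)]
    by (simp add: k\<pi>[symmetric] mem_a_kernel E.minus_eq_zero_iff)
  \<comment> \<open>A pair whose second entry lies in \<open>ker f\<close> can be moved into
    \<open>N\<close>. This yields both \<open>g x = i (h x)\<close> and the inclusion of
    \<open>ker p\<close> in the image of \<open>i\<close>.\<close>
  have key: "\<pi> (s, x) = i (s \<oplus>\<^bsub>N\<^esub> h x)" if "s \<in> carrier N" "x \<in> a_kernel X M f" for s x
    unfolding i_def
  proof (rule \<pi>eq)
    have x: "x \<in> carrier X" using that by (simp add: mem_a_kernel)
    have "s \<ominus>\<^bsub>N\<^esub> (s \<oplus>\<^bsub>N\<^esub> h x) = \<ominus>\<^bsub>N\<^esub> h x"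
      using that hc by (simp add: a_minus_def N.M.minus_add N.M.r_neg flip: N.M.a_assoc)
    then have "(s, x) \<ominus>\<^bsub>P\<^esub> (s \<oplus>\<^bsub>N\<^esub> h x, \<zero>\<^bsub>X\<^esub>) = (\<ominus>\<^bsub>N\<^esub> h x, x)"
      using that hc x by (simp add: P_def dprod_minus[OF N X] X.minus_zero)
    then show "(s, x) \<ominus>\<^bsub>P\<^esub> (s \<oplus>\<^bsub>N\<^esub> h x, \<zero>\<^bsub>X\<^esub>) \<in> L" using that by (auto simp: L_def)
  qed (use that hc in \<open>auto simp: P_def mem_a_kernel\<close>)
  have gi: "g x = i (h x)" if "x \<in> a_kernel X M f" for x
    using key[OF _ that, of "\<zero>\<^bsub>N\<^esub>"] that hc by (simp add: g_def)
  have "a_kernel N E i = {\<zero>\<^bsub>N\<^esub>}"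
  proof -
    have "s = \<zero>\<^bsub>N\<^esub>" if "s \<in> a_kernel N E i" for s
    proof -
      have "(s, \<zero>\<^bsub>X\<^esub>) \<in> L" using that by (simp add: k\<pi>[symmetric] mem_a_kernel P_def i_def)
      then show ?thesis using h0 by (auto simp: L_def)
    qed
    then show ?thesis using lmod_hom_zero[OF N E i] by (auto simp: mem_a_kernel)
  qed
  then have inj: "inj_on i (carrier N)" using lmod_hom_inj_iff[OF N E i] by simp
  have psurj: "p ` carrier E = carrier M"
  proof
    show "p ` carrier E \<subseteq> carrier M" using lmod_homD(1)[OF p(1)] by blast
    show "carrier M \<subseteq> p ` carrier E" using pg lmod_homD(1)[OF g] unfolding f(2)[symmetric] by force
  qed
  have "i ` carrier N = a_kernel E M p"
  proof
    show "i ` carrier N \<subseteq> a_kernel E M p"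
    proof
      fix y assume "y \<in> i ` carrier N"
      then obtain s where s: "s \<in> carrier N" "y = i s" by auto
      then have "p y = f \<zero>\<^bsub>X\<^esub>" using p(2)[of "(s, \<zero>\<^bsub>X\<^esub>)"] by (simp add: i_def P_def)
      then show "y \<in> a_kernel E M p"
        using s lmod_homD(1)[OF i] lmod_hom_zero[OF X M f(1)] by (simp add: mem_a_kernel)
    qed
    show "a_kernel E M p \<subseteq> i ` carrier N"
    proof
      fix y assume y: "y \<in> a_kernel E M p"
      then have "y \<in> \<pi> ` carrier P" using \<pi>(2) by (simp add: mem_a_kernel)
      then obtain s x where sx: "s \<in> carrier N" "x \<in> carrier X" "y = \<pi> (s, x)" by (auto simp: P_def)
      then have "x \<in> a_kernel X M f"
        using y p(2)[of "(s, x)"] by (simp add: mem_a_kernel P_def)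
      then show "y \<in> i ` carrier N" using key sx hc by auto
    qed
  qed
  with E i inj p(1) psurj have "is_extension R M N (E, i, p)" by (simp add: is_extension_def)
  from that[OF this g pg gi] show ?thesis .
qed

lemma card_eq_sum_fibers:
  assumes "finite A" "finite B" "f ` A \<subseteq> B"
  shows "card A = (\<Sum>b\<in>B. card {a \<in> A. f a = b})"
  using sum.group[OF assms, of "\<lambda>_. 1 :: nat"] by simp

text \<open>Two lifts with the same restriction to \<open>ker f\<close> differ by a map that
  vanishes on \<open>ker f\<close> and is killed by \<open>p\<close>, which is a homomorphism from
  \<open>M\<close> to \<open>N\<close> placed between \<open>f\<close> and \<open>i\<close>. So one
  lift \<open>g0\<close> turns the set of all of them into a copy of
  \<open>Hom(M, N)\<close>.\<close>

lemma card_hom_over_restriction: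
  assumes M: "lmodule R M" and N: "lmodule R N" and X: "lmodule R X"
    and e: "is_extension R M N (E, i, p)"
    and f: "f \<in> lmod_hom R X M" "f ` carrier X = carrier M"
    and g0: "g0 \<in> lmod_hom R X E" "\<And>x. x \<in> carrier X \<Longrightarrow> p (g0 x) = f x"
      "\<And>x. x \<in> a_kernel X M f \<Longrightarrow> g0 x = i (h x)"
  shows "card {g \<in> hom_over R X f E p. \<forall>x\<in>a_kernel X M f. g x = i (h x)} = card (mhom R M N)"
proof -
  note ext = is_extensionD[OF e]
  interpret M: lmodule R M by fact
  interpret N: lmodule R N by fact
  interpret X: lmodule R X by fact
  interpret E: lmodule R E using ext by blast
  let ?A = "{g \<in> hom_over R X f E p. \<forall>x\<in>a_kernel X M f. g x = i (h x)}"
  let ?T = "\<lambda>\<phi>. restrict (\<lambda>x. g0 x \<oplus>\<^bsub>E\<^esub> i (\<phi> (f x))) (carrier X)"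
  note fX = lmod_homD(1)[OF f(1)] and iN = lmod_homD(1)[OF ext(2)] and gX = lmod_homD(1)[OF g0(1)]
  have i0: "i \<zero>\<^bsub>N\<^esub> = \<zero>\<^bsub>E\<^esub>" using lmod_hom_zero[OF N ext(1,2)] .
  have "bij_betw ?T (mhom R M N) ?A"
    unfolding bij_betw_def
  proof (intro conjI subset_antisym subsetI)
    show "inj_on ?T (mhom R M N)"
    proof (rule inj_onI)
      fix \<phi> \<psi> assume *: "\<phi> \<in> mhom R M N" "\<psi> \<in> mhom R M N" "?T \<phi> = ?T \<psi>"
      then have \<phi>: "\<phi> \<in> lmod_hom R M N" "\<psi> \<in> lmod_hom R M N" by (auto simp: mhom_def)
      show "\<phi> = \<psi>"
      proof (rule extensionalityI[of _ "carrier M"])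
        fix m assume "m \<in> carrier M"
        then have "m \<in> f ` carrier X" using f(2) by simp
        then obtain x where x: "x \<in> carrier X" "m = f x" by blast
        have c: "\<phi> m \<in> carrier N" "\<psi> m \<in> carrier N"
          using \<phi> x fX by (simp_all add: lmod_homD(1)[OF \<phi>(1)] lmod_homD(1)[OF \<phi>(2)])
        have "g0 x \<oplus>\<^bsub>E\<^esub> i (\<phi> m) = g0 x \<oplus>\<^bsub>E\<^esub> i (\<psi> m)"
          using fun_cong[OF *(3), of x] x by simp
        then have "i (\<phi> m) = i (\<psi> m)" using gX[OF x(1)] iN c by simp
        then show "\<phi> m = \<psi> m" using inj_onD[OF ext(3)] c by blast
      qed (use * in \<open>auto simp: mhom_def\<close>)
    qed
  next
    fix g assume "g \<in> ?T ` mhom R M N"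
    then obtain \<phi> where \<phi>: "\<phi> \<in> lmod_hom R M N" "g = ?T \<phi>" by (auto simp: mhom_def)
    have "(i \<circ> (\<phi> \<circ> f)) \<in> lmod_hom R X E"
      by (rule lmod_hom_comp[OF lmod_hom_comp[OF f(1) \<phi>(1)] ext(2)])
    from lmod_hom_add[OF ext(1) g0(1) this]
    have "g \<in> mhom R X E" unfolding \<phi>(2) by (intro restrict_mhom X) (simp add: comp_def)
    moreover have "p (g x) = f x" if x: "x \<in> carrier X" for x
    proof -
      have c: "\<phi> (f x) \<in> carrier N" using lmod_homD(1)[OF \<phi>(1)] fX x by simp
      have "p (g0 x \<oplus>\<^bsub>E\<^esub> i (\<phi> (f x))) = p (g0 x) \<oplus>\<^bsub>M\<^esub> p (i (\<phi> (f x)))"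
        using lmod_homD(2)[OF ext(4) gX[OF x] iN[OF c]] .
      then show ?thesis using x fX[OF x] by (simp add: \<phi>(2) g0(2) ext(7) c)
    qed
    moreover have "g x = i (h x)" if x: "x \<in> a_kernel X M f" for x
    proof -
      have "x \<in> carrier X" "f x = \<zero>\<^bsub>M\<^esub>" using x by (auto simp: mem_a_kernel)
      then show ?thesis
        using g0(3)[OF x] lmod_hom_zero[OF M N \<phi>(1)] gX[of x] by (simp add: \<phi>(2) i0)
    qed
    ultimately show "g \<in> ?A" by (auto simp: hom_over_def)
  next
    fix g assume g: "g \<in> ?A"
    then have gh: "g \<in> lmod_hom R X E" and gp: "\<And>x. x \<in> carrier X \<Longrightarrow> p (g x) = f x"
      and gk: "\<And>x. x \<in> a_kernel X M f \<Longrightarrow> g x = i (h x)" and ge: "g \<in> extensional (carrier X)"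
      by (auto simp: hom_over_def mhom_def)
    note gX' = lmod_homD(1)[OF gh]
    \<comment> \<open>The preimage of \<open>g\<close> under \<open>?T\<close> is found from
      \<open>d\<close>: it descends along \<open>f\<close> because it vanishes on the kernel, and
      then lifts along \<open>i\<close> because \<open>p\<close> kills it.\<close>
    define d where "d = (\<lambda>x. g x \<ominus>\<^bsub>E\<^esub> g0 x)"
    have d: "d \<in> lmod_hom R X E" unfolding d_def by (rule lmod_hom_diff[OF ext(1) gh g0(1)])
    have "d x = \<zero>\<^bsub>E\<^esub>" if "x \<in> a_kernel X M f" for x
      using that gk[OF that] g0(3)[OF that] gX'[of x] gX[of x]
      by (simp add: d_def E.minus_eq_zero_iff mem_a_kernel)
    then have "a_kernel X M f \<subseteq> a_kernel X E d" by (auto simp: mem_a_kernel)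
    from lmod_hom_factor[OF X M ext(1) f d this]
    obtain \<psi> where \<psi>: "\<psi> \<in> lmod_hom R M E" "\<And>x. x \<in> carrier X \<Longrightarrow> \<psi> (f x) = d x" by blast
    have dk: "d x \<in> i ` carrier N" if x: "x \<in> carrier X" for x
    proof -
      have "p (d x) = \<zero>\<^bsub>M\<^esub>"
        using lmod_hom_minus[OF ext(1) M ext(4) gX'[OF x] gX[OF x]] gp[OF x] g0(2)[OF x] fX[OF x]
        by (simp add: d_def M.minus_eq_zero_iff)
      then show ?thesis using lmod_homD(1)[OF d x] by (simp add: ext(6) mem_a_kernel)
    qed
    have "\<psi> ` carrier M \<subseteq> i ` carrier N" unfolding f(2)[symmetric] using \<psi>(2) dk by auto
    note l = lmod_hom_lift[OF M N ext(2,3) \<psi>(1) this]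
    let ?\<phi> = "restrict (inv_into (carrier N) i \<circ> \<psi>) (carrier M)"
    have "?T ?\<phi> x = g x" if x: "x \<in> carrier X" for x
    proof -
      have "i (?\<phi> (f x)) = d x" using l(2)[OF fX[OF x]] \<psi>(2)[OF x] fX[OF x] by simp
      then have "g0 x \<oplus>\<^bsub>E\<^esub> i (?\<phi> (f x)) = d x \<oplus>\<^bsub>E\<^esub> g0 x"
        using E.M.a_comm[OF gX[OF x] lmod_homD(1)[OF d x]] by simp
      also have "\<dots> = g x" unfolding d_def by (rule E.minus_add_cancel[OF gX'[OF x] gX[OF x]])
      finally show ?thesis using x by simp
    qed
    then have "g = ?T ?\<phi>" using ge by (intro extensionalityI[OF ge restrict_extensional]) auto
    moreover have "?\<phi> \<in> mhom R M N" using restrict_mhom[OF M l(1)] .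
    ultimately show "g \<in> ?T ` mhom R M N" by blast
  qed
  then show ?thesis by (simp add: bij_betw_same_card)
qed

text \<open>Each fibre of \<open>p\<close> is a translate of the image of \<open>i\<close>. This
  gives the finiteness of middle terms and the size of fibre products.\<close>

lemma card_extension_fiber:
  assumes M: "lmodule R M" and N: "lmodule R N" and e: "is_extension R M N (E, i, p)"
    and m: "m \<in> carrier M"
  shows "bij_betw (\<lambda>s. inv_into (carrier E) p m \<oplus>\<^bsub>E\<^esub> i s) (carrier N) {y \<in> carrier E. p y = m}"
proof -
  note ext = is_extensionD[OF e]
  interpret M: lmodule R M by fact
  interpret N: lmodule R N by fact
  interpret E: lmodule R E using ext by blast
  define y0 where "y0 = inv_into (carrier E) p m"
  have y0: "y0 \<in> carrier E" "p y0 = m"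
    using m ext(5) by (auto simp: y0_def inv_into_into f_inv_into_f)
  note iN = lmod_homD(1)[OF ext(2)]
  show ?thesis
    unfolding y0_def[symmetric] bij_betw_def
  proof (intro conjI subset_antisym subsetI)
    show "inj_on (\<lambda>s. y0 \<oplus>\<^bsub>E\<^esub> i s) (carrier N)"
      using ext(3) iN y0 by (auto simp: inj_on_def)
  next
    fix y assume "y \<in> (\<lambda>s. y0 \<oplus>\<^bsub>E\<^esub> i s) ` carrier N"
    then show "y \<in> {y \<in> carrier E. p y = m}"
      using y0 iN m ext(7) lmod_homD(2)[OF ext(4)] by auto
  next
    fix y assume "y \<in> {y \<in> carrier E. p y = m}"
    then have y: "y \<in> carrier E" "p y = m" by auto
    then have "p (y \<ominus>\<^bsub>E\<^esub> y0) = \<zero>\<^bsub>M\<^esub>"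
      using lmod_hom_minus[OF ext(1) M ext(4) y(1) y0(1)] y0 m by (simp add: M.minus_eq_zero_iff)
    then have "y \<ominus>\<^bsub>E\<^esub> y0 \<in> i ` carrier N" using y y0 by (simp add: ext(6) mem_a_kernel)
    then obtain s where s: "s \<in> carrier N" "y \<ominus>\<^bsub>E\<^esub> y0 = i s" by auto
    then have "y = y0 \<oplus>\<^bsub>E\<^esub> i s"
      using E.minus_add_cancel[OF y(1) y0(1)] E.M.a_comm[OF y0(1) iN[OF s(1)]] by simp
    then show "y \<in> (\<lambda>s. y0 \<oplus>\<^bsub>E\<^esub> i s) ` carrier N" using s by auto
  qed
qed

lemma finite_extension:
  assumes "lmodule R M" "lmodule R N" "is_extension R M N (E, i, p)" "finite (carrier M)" "finite (carrier N)"
  shows "finite (carrier E)"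
proof -
  have "carrier E \<subseteq> (\<Union>m\<in>carrier M. {y \<in> carrier E. p y = m})"
    using is_extensionD(5)[OF assms(3)] by auto
  moreover have "finite {y \<in> carrier E. p y = m}" if "m \<in> carrier M" for m
    using bij_betw_finite[OF card_extension_fiber[OF assms(1-3) that]] assms(5) by blast
  ultimately show ?thesis using assms(4) finite_subset by blast
qed

text \<open>The pushout of \<open>0 \<rightarrow> ker f \<rightarrow> X \<rightarrow> M \<rightarrow> 0\<close> along \<open>h: ker f \<rightarrow> N\<close> is the only extension to which \<open>h\<close>
  lifts as a map over \<open>M\<close>, and the lifts form a torsor under \<open>Hom(M, N)\<close>.\<close>

lemma sum_card_hom_over:
  fixes M :: "('r, 'a) module" and N :: "('r, 'b) module" and X :: "('r, 'c) module"
    and E :: "'j \<Rightarrow> ('r, 'd) module"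
  assumes M: "lmodule R M" and N: "lmodule R N" and X: "lmodule R X"
    and fin: "finite (carrier M)" "finite (carrier N)" "finite (carrier X)"
    and f: "f \<in> lmod_hom R X M" "f ` carrier X = carrier M"
    and J: "finite J" "\<And>j. j \<in> J \<Longrightarrow> is_extension R M N (E j, i j, p j)"
    and ex: "\<And>e :: ('r, 'a, 'b, 'b \<times> 'c) ext. is_extension R M N e \<Longrightarrow> \<exists>j\<in>J. ext_equiv R M N e (E j, i j, p j)"
    and uniq: "\<And>j k. j \<in> J \<Longrightarrow> k \<in> J \<Longrightarrow> ext_equiv R M N (E j, i j, p j) (E k, i k, p k) \<Longrightarrow> j = k"
  shows "(\<Sum>j\<in>J. card (hom_over R X f (E j) (p j))) = card (mhom R M N) * card (mhom R (kmod X M f) N)"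
proof -
  interpret M: lmodule R M by fact
  interpret N: lmodule R N by fact
  interpret X: lmodule R X by fact
  define K where "K = kmod X M f"
  have cK [simp]: "carrier K = a_kernel X M f" by (simp add: K_def)
  interpret K: lmodule R K unfolding K_def using kmod_lmodule[OF X M f(1)] .
  have finK: "finite (carrier K)" using fin(3) by (auto simp: a_kernel_def kernel_def)
  \<comment> \<open>Lifts are counted in two ways, by the extension \<open>j\<close> that receives
    them and by their restriction \<open>h\<close> to the kernel.\<close>
  define fib where "fib j h = {g \<in> hom_over R X f (E j) (p j). \<forall>x\<in>a_kernel X M f. g x = i j (h x)}" for j h
  have incl: "g \<in> lmod_hom R K (E j)" if "g \<in> lmod_hom R X (E j)" for g j
    using that by (intro lmod_homI) (auto simp: K_def mem_a_kernel lmod_homD)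
  have 1: "card (hom_over R X f (E j) (p j)) = (\<Sum>h\<in>mhom R K N. card (fib j h))" if j: "j \<in> J" for j
  proof -
    note ext = is_extensionD[OF J(2)[OF j]]
    define \<rho> where "\<rho> g = restrict (inv_into (carrier N) (i j) \<circ> g) (carrier K)" for g
    have *: "\<rho> g \<in> mhom R K N" "\<And>x. x \<in> a_kernel X M f \<Longrightarrow> i j (\<rho> g x) = g x"
      if "g \<in> hom_over R X f (E j) (p j)" for g
    proof -
      have gh: "g \<in> lmod_hom R X (E j)" "\<And>x. x \<in> carrier X \<Longrightarrow> p j (g x) = f x"
        using that by (auto simp: hom_over_def mhom_def)
      have "g ` carrier K \<subseteq> i j ` carrier N"
        using gh lmod_homD(1)[OF gh(1)] by (auto simp: ext(6) mem_a_kernel)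
      note l = lmod_hom_lift[OF K.lmodule_axioms N ext(2,3) incl[OF gh(1)] this]
      show "\<rho> g \<in> mhom R K N" unfolding \<rho>_def by (rule restrict_mhom[OF K.lmodule_axioms l(1)])
      show "i j (\<rho> g x) = g x" if "x \<in> a_kernel X M f" for x
        using l(2)[of x] that by (simp add: \<rho>_def)
    qed
    have "{g \<in> hom_over R X f (E j) (p j). \<rho> g = h} = fib j h" if h: "h \<in> mhom R K N" for h
    proof -
      have "\<rho> g = h \<longleftrightarrow> (\<forall>x\<in>a_kernel X M f. g x = i j (h x))" if g: "g \<in> hom_over R X f (E j) (p j)" for g
      proof
        show "\<rho> g = h \<Longrightarrow> \<forall>x\<in>a_kernel X M f. g x = i j (h x)" using *(2)[OF g] by auto
        assume a: "\<forall>x\<in>a_kernel X M f. g x = i j (h x)"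
        show "\<rho> g = h"
        proof (rule extensionalityI[of _ "carrier K"])
          fix x assume x: "x \<in> carrier K"
          then have "i j (\<rho> g x) = i j (h x)" using a *(2)[OF g] by simp
          moreover have "\<rho> g x \<in> carrier N" "h x \<in> carrier N"
            using *(1)[OF g] h x unfolding mhom_def by (blast dest: lmod_homD(1))+
          ultimately show "\<rho> g x = h x" using ext(3) by (simp add: inj_on_eq_iff)
        qed (use h in \<open>auto simp: mhom_def \<rho>_def\<close>)
      qed
      then show ?thesis by (auto simp: fib_def)
    qed
    moreover have "finite (hom_over R X f (E j) (p j))"
      using finite_hom_over[OF fin(3) finite_extension[OF M N J(2)[OF j] fin(1,2)]] .
    moreover have "finite (mhom R K N)" using finK fin(2) by (rule finite_mhom)
    ultimately show ?thesis
      using card_eq_sum_fibers[of "hom_over R X f (E j) (p j)" "mhom R K N" \<rho>] *(1)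
      by (simp add: image_subset_iff)
  qed
  have 2: "(\<Sum>j\<in>J. card (fib j h)) = card (mhom R M N)" if h: "h \<in> mhom R K N" for h
  proof -
    have hh: "h \<in> lmod_hom R K N" using h by (simp add: mhom_def)
    \<comment> \<open>The pushout has its middle term on \<open>'b \<times> 'c\<close>, which is why
      \<open>ex\<close> speaks of extensions of that type.\<close>
    obtain E0 :: "('r, 'b \<times> 'c) module" and i0 p0 g0 where
      e0: "is_extension R M N (E0, i0, p0)" and g0: "g0 \<in> lmod_hom R X E0"
      "\<And>x. x \<in> carrier X \<Longrightarrow> p0 (g0 x) = f x" "\<And>x. x \<in> a_kernel X M f \<Longrightarrow> g0 x = i0 (h x)"
      using pushout_extension[OF M N X f hh[unfolded K_def]] by blast
    obtain k where k: "k \<in> J" "ext_equiv R M N (E0, i0, p0) (E k, i k, p k)" using ex[OF e0] by blast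
    then obtain \<theta> where \<theta>: "\<theta> \<in> lmod_iso R E0 (E k)" "\<forall>y\<in>carrier N. \<theta> (i0 y) = i k y"
      "\<forall>y\<in>carrier E0. p k (\<theta> y) = p0 y" by (auto simp: ext_equiv_def)
    have hc: "h x \<in> carrier N" if "x \<in> a_kernel X M f" for x using lmod_homD(1)[OF hh] that by simp
    have g: "\<theta> \<circ> g0 \<in> lmod_hom R X (E k)" "\<And>x. x \<in> carrier X \<Longrightarrow> p k ((\<theta> \<circ> g0) x) = f x"
      "\<And>x. x \<in> a_kernel X M f \<Longrightarrow> (\<theta> \<circ> g0) x = i k (h x)"
      using \<theta> g0 lmod_homD(1)[OF g0(1)] hc by (auto simp: lmod_iso_def intro: lmod_hom_comp)
    have "fib j h = {}" if j: "j \<in> J" "j \<noteq> k" for j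
    proof (rule ccontr)
      assume "fib j h \<noteq> {}"
      then obtain g' where g': "g' \<in> lmod_hom R X (E j)" "\<And>x. x \<in> carrier X \<Longrightarrow> p j (g' x) = f x"
        "\<And>x. x \<in> a_kernel X M f \<Longrightarrow> g' x = i j (h x)"
        by (auto simp: fib_def hom_over_def mhom_def)
      have "ext_equiv R M N (E j, i j, p j) (E k, i k, p k)"
        by (rule ext_equiv_if_same_restriction[OF M N X J(2)[OF j(1)] J(2)[OF k(1)] f g'(1,2) _ g(1,2), where h = h])
          (use g'(3) g(3) hc in auto)
      then show False using uniq j k(1) by blast
    qed
    then have "(\<Sum>j\<in>J. card (fib j h)) = (\<Sum>j\<in>{k}. card (fib j h))"
      by (intro sum.mono_neutral_right) (use J(1) k(1) in auto)
    also have "\<dots> = card (mhom R M N)"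
      using card_hom_over_restriction[OF M N X J(2)[OF k(1)] f g] by (simp add: fib_def)
    finally show ?thesis .
  qed
  have "(\<Sum>j\<in>J. card (hom_over R X f (E j) (p j))) = (\<Sum>j\<in>J. \<Sum>h\<in>mhom R K N. card (fib j h))"
    using 1 by simp
  also have "\<dots> = (\<Sum>h\<in>mhom R K N. \<Sum>j\<in>J. card (fib j h))" by (rule sum.swap)
  also have "\<dots> = card (mhom R M N) * card (mhom R K N)" using 2 by simp
  finally show ?thesis by (simp add: K_def)
qed

text \<open>The analogue of \<open>extension_representative\<close> for a given injection of the
  middle term; it is used with values in \<open>nat\<close>.\<close>

lemma extension_transport:
  fixes E :: "('r, 'e) module" and \<phi> :: "'e \<Rightarrow> 'f"
  assumes e: "is_extension R M N (E, i, p)" and "inj_on \<phi> (carrier E)"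
  obtains F :: "('r, 'f) module" and i' p'
  where "is_extension R M N (F, i', p')" "ext_equiv R M N (E, i, p) (F, i', p')"
proof -
  note ext = is_extensionD[OF e]
  obtain F :: "('r, 'f) module"
    where F: "lmodule R F" "carrier F = \<phi> ` carrier E" "\<phi> \<in> lmod_iso R E F"
    using lmodule_transport[OF ext(1) assms(2)] by blast
  let ?g = "inv_into (carrier E) \<phi>"
  have fh: "\<phi> \<in> lmod_hom R E F" using F(3) by (simp add: lmod_iso_def)
  have gh: "?g \<in> lmod_hom R F E" using lmod_iso_inv[OF F(3) ext(1)] by (simp add: lmod_iso_def)
  have gf: "?g (\<phi> x) = x" if "x \<in> carrier E" for x using assms(2) that by simp
  have "inj_on (\<phi> \<circ> i) (carrier N)"
    using ext(3) assms(2) lmod_homD(1)[OF ext(2)] by (auto intro!: comp_inj_on inj_on_subset[OF assms(2)])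
  moreover have "(p \<circ> ?g) ` carrier F = carrier M"
    using ext(5) by (auto simp: F(2) gf image_image)
  moreover have "(\<phi> \<circ> i) ` carrier N = a_kernel F M (p \<circ> ?g)"
    unfolding image_comp[symmetric] ext(6) by (auto simp: a_kernel_def kernel_def F(2) gf)
  ultimately have "is_extension R M N (F, \<phi> \<circ> i, p \<circ> ?g)"
    using F(1) lmod_hom_comp[OF ext(2) fh] lmod_hom_comp[OF gh ext(4)]
    by (simp add: is_extension_def)
  moreover have "ext_equiv R M N (E, i, p) (F, \<phi> \<circ> i, p \<circ> ?g)"
    using F(3) gf by (auto simp: ext_equiv_def intro!: bexI[of _ \<phi>])
  ultimately show ?thesis by (rule that)
qed

text \<open>With every type equal to \<open>nat\<close>, the pushouts built on
  \<open>N \<times> X\<close> have the type \<open>nat \<times> nat\<close> of the extensions that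
  form \<open>Ext1 R M N\<close>, so one representative per class is a complete system for
  \<open>sum_card_hom_over\<close>. The representatives are moved to \<open>nat\<close> so that
  fibre products can be iterated within one type.\<close>

lemma Ext1_representatives:
  fixes M N :: "('r, nat) module"
  assumes M: "lmodule R M" and N: "lmodule R N" and fin: "finite (carrier M)" "finite (carrier N)"
    and Ext: "finite (Ext1 R M N)"
  obtains es :: "(('r, nat) module \<times> (nat \<Rightarrow> nat) \<times> (nat \<Rightarrow> nat)) list"
  where "length es = card (Ext1 R M N)" "\<And>E i p. (E, i, p) \<in> set es \<Longrightarrow> is_extension R M N (E, i, p)"
    "\<And>(X :: ('r, nat) module) f. \<lbrakk>lmodule R X; finite (carrier X); f \<in> lmod_hom R X M; f ` carrier X = carrier M\<rbrakk>
      \<Longrightarrow> (\<Sum>(E, i, p)\<leftarrow>es. card (hom_over R X f E p)) = card (mhom R M N) * card (mhom R (kmod X M f) N)"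
proof -
  let ?J = "Ext1 R M N"
  let ?A = "{e :: ('r, nat, nat, nat \<times> nat) ext. is_extension R M N e}"
  have "\<exists>e' :: ('r, nat, nat, nat) ext. is_extension R M N e' \<and> (\<exists>e\<in>c. is_extension R M N e \<and> ext_equiv R M N e e')" if c: "c \<in> ?J" for c
  proof -
    obtain E i p where e: "(E, i, p) \<in> c" "is_extension R M N (E, i, p)"
      using c by (auto simp: Ext1_def ext_rel_def elim!: quotientE intro: ext_equiv_refl)
    have "finite (carrier E)" using finite_extension[OF M N e(2) fin] .
    then obtain \<phi> :: "nat \<times> nat \<Rightarrow> nat" where "inj_on \<phi> (carrier E)"
      using finite_imp_inj_to_nat_seg by blast
    from extension_transport[OF e(2) this] obtain F :: "('r, nat) module" and i' p'
      where "is_extension R M N (F, i', p')" "ext_equiv R M N (E, i, p) (F, i', p')" .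
    with e show ?thesis by blast
  qed
  then obtain \<epsilon> :: "_ \<Rightarrow> ('r, nat, nat, nat) ext" where \<epsilon>: "\<And>c. c \<in> ?J \<Longrightarrow> is_extension R M N (\<epsilon> c)"
    "\<And>c. c \<in> ?J \<Longrightarrow> \<exists>e\<in>c. is_extension R M N e \<and> ext_equiv R M N e (\<epsilon> c)" by metis
  note eqv = equiv_ext_rel[of R M N]
  have ex: "\<exists>c\<in>?J. ext_equiv R M N e (\<epsilon> c)" if e: "is_extension R M N e" for e :: "('r, nat, nat, nat \<times> nat) ext"
  proof -
    let ?c = "ext_rel R M N `` {e}"
    have c: "?c \<in> ?J" using e by (auto simp: Ext1_def intro: quotientI)
    then obtain e' where "e' \<in> ?c" "ext_equiv R M N e' (\<epsilon> ?c)" using \<epsilon>(2) by blast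
    then have "ext_equiv R M N e (\<epsilon> ?c)" by (auto simp: ext_rel_def intro: ext_equiv_trans)
    with c show ?thesis by blast
  qed
  \<comment> \<open>Moving to \<open>nat\<close> keeps distinct classes inequivalent: an equivalence
    of \<open>\<epsilon> c\<close> and \<open>\<epsilon> d\<close> transfers back to members of
    \<open>c\<close> and \<open>d\<close>.\<close>
  have uniq: "c = d" if cd: "c \<in> ?J" "d \<in> ?J" "ext_equiv R M N (\<epsilon> c) (\<epsilon> d)" for c d
  proof -
    obtain x y where xy: "x \<in> c" "is_extension R M N x" "ext_equiv R M N x (\<epsilon> c)"
      "y \<in> d" "is_extension R M N y" "ext_equiv R M N y (\<epsilon> d)" using \<epsilon>(2) cd by meson
    have "ext_equiv R M N x y"
      using xy cd(3) ext_equiv_sym[OF xy(5,6)] ext_equiv_trans by meson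
    then have "(x, y) \<in> ext_rel R M N" using xy by (simp add: ext_rel_def)
    then show ?thesis
      using quotient_eqI[OF eqv, of c d x y] cd xy by (simp add: Ext1_def)
  qed
  define E where "E c = fst (\<epsilon> c)" for c
  define i where "i c = fst (snd (\<epsilon> c))" for c
  define p where "p c = snd (snd (\<epsilon> c))" for c
  have \<epsilon>eq: "\<epsilon> c = (E c, i c, p c)" for c by (simp add: E_def i_def p_def)
  obtain cs where cs: "set cs = ?J" "distinct cs" using finite_distinct_list[OF Ext] by blast
  show ?thesis
  proof (rule that[of "map \<epsilon> cs"])
    show "length (map \<epsilon> cs) = card ?J" using distinct_card[OF cs(2)] cs(1) by simp
    show "is_extension R M N (E', i', p')" if "(E', i', p') \<in> set (map \<epsilon> cs)" for E' i' p'
      using that \<epsilon>(1) cs(1) by (auto simp: image_iff)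
    fix X :: "('r, nat) module" and f
    assume X: "lmodule R X" "finite (carrier X)" and f: "f \<in> lmod_hom R X M" "f ` carrier X = carrier M"
    have "(\<Sum>(E, i, p)\<leftarrow>map \<epsilon> cs. card (hom_over R X f E p)) = (\<Sum>c\<in>?J. card (hom_over R X f (E c) (p c)))"
      using cs by (simp add: comp_def \<epsilon>eq sum_list_distinct_conv_sum_set)
    also have "\<dots> = card (mhom R M N) * card (mhom R (kmod X M f) N)"
      by (rule sum_card_hom_over[OF M N X(1) fin X(2) f Ext, where i = i])
        (use \<epsilon>(1) ex uniq in \<open>auto simp: \<epsilon>eq\<close>)
    finally show "(\<Sum>(E, i, p)\<leftarrow>map \<epsilon> cs. card (hom_over R X f E p)) = card (mhom R M N) * card (mhom R (kmod X M f) N)" .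
  qed
qed

section \<open>Fibre products over a common quotient\<close>

definition Sur_over ::
  "('r, 'k) ring_scheme \<Rightarrow> ('r, 'a) module \<Rightarrow> ('a \<Rightarrow> 'c) \<Rightarrow> ('r, 'b) module \<Rightarrow> ('b \<Rightarrow> 'c) \<Rightarrow> ('a \<Rightarrow> 'b) set" where
  "Sur_over R X f G P = {u \<in> Sur R X G. \<forall>x\<in>carrier X. P (u x) = f x}"

lemma SurD:
  assumes "u \<in> Sur R X G"
  shows "u \<in> lmod_hom R X G" "u ` carrier X = carrier G" "u \<in> extensional (carrier X)"
  using assms by (auto simp: Sur_def)

lemma finite_Sur: "finite (carrier X) \<Longrightarrow> finite (carrier Y) \<Longrightarrow> finite (Sur R X Y)"
  using finite_mhom[of X Y R] by (rule finite_subset[rotated]) (auto simp: Sur_def mhom_def)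

lemma finite_Sur_over: "finite (carrier X) \<Longrightarrow> finite (carrier Y) \<Longrightarrow> finite (Sur_over R X f Y p)"
  using finite_Sur[of X Y R] by (simp add: Sur_over_def)

lemma card_mhom_iso:
  assumes A: "lmodule R A" and B: "lmodule R B" and \<theta>: "\<theta> \<in> lmod_iso R A B"
  shows "card (mhom R A S) = card (mhom R B S)"
proof -
  let ?\<theta>' = "inv_into (carrier A) \<theta>"
  have \<theta>': "?\<theta>' \<in> lmod_iso R B A" using lmod_iso_inv[OF \<theta> A] .
  have h: "\<theta> \<in> lmod_hom R A B" "?\<theta>' \<in> lmod_hom R B A" using \<theta> \<theta>' by (auto simp: lmod_iso_def)
  have b: "bij_betw \<theta> (carrier A) (carrier B)" using \<theta> by (simp add: lmod_iso_def)
  have inv: "\<And>y. y \<in> carrier B \<Longrightarrow> \<theta> (?\<theta>' y) = y" "\<And>x. x \<in> carrier A \<Longrightarrow> ?\<theta>' (\<theta> x) = x"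
    using b by (auto simp: bij_betw_inv_into_right bij_betw_inv_into_left)
  have "bij_betw (\<lambda>u. restrict (u \<circ> ?\<theta>') (carrier B)) (mhom R A S) (mhom R B S)"
  proof (rule bij_betw_byWitness[where f' = "\<lambda>v. restrict (v \<circ> \<theta>) (carrier A)"]; safe?)
    fix u assume u: "u \<in> mhom R A S"
    then show "restrict (u \<circ> ?\<theta>') (carrier B) \<in> mhom R B S"
      using h(2) by (intro restrict_mhom B lmod_hom_comp) (auto simp: mhom_def)
    show "restrict (restrict (u \<circ> ?\<theta>') (carrier B) \<circ> \<theta>) (carrier A) = u"
      using u b h inv by (intro extensionalityI[of _ "carrier A"]) (auto simp: mhom_def lmod_homD(1)[OF h(1)])
  next
    fix u assume u: "u \<in> mhom R B S"
    then show "restrict (u \<circ> \<theta>) (carrier A) \<in> mhom R A S"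
      using h(1) by (intro restrict_mhom A lmod_hom_comp) (auto simp: mhom_def)
    show "restrict (restrict (u \<circ> \<theta>) (carrier A) \<circ> ?\<theta>') (carrier B) = u"
      using u b h inv by (intro extensionalityI[of _ "carrier B"]) (auto simp: mhom_def lmod_homD(1)[OF h(2)])
  qed
  then show ?thesis by (rule bij_betw_same_card)
qed

lemma card_Sur_over_iso:
  assumes X: "lmodule R X" and A: "lmodule R A" and B: "lmodule R B" and \<theta>: "\<theta> \<in> lmod_iso R A B"
    and PQ: "\<And>a. a \<in> carrier A \<Longrightarrow> Q (\<theta> a) = P a"
  shows "card (Sur_over R X f A P) = card (Sur_over R X f B Q)"
proof -
  let ?\<theta>' = "inv_into (carrier A) \<theta>"
  have \<theta>': "?\<theta>' \<in> lmod_iso R B A" using lmod_iso_inv[OF \<theta> A] .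
  have h: "\<theta> \<in> lmod_hom R A B" "?\<theta>' \<in> lmod_hom R B A" using \<theta> \<theta>' by (auto simp: lmod_iso_def)
  have b: "bij_betw \<theta> (carrier A) (carrier B)" "bij_betw ?\<theta>' (carrier B) (carrier A)"
    using \<theta> \<theta>' by (auto simp: lmod_iso_def)
  have im: "\<theta> ` carrier A = carrier B" "?\<theta>' ` carrier B = carrier A"
    using b by (auto simp: bij_betw_def)
  have "bij_betw (\<lambda>u. restrict (\<theta> \<circ> u) (carrier X)) (Sur_over R X f A P) (Sur_over R X f B Q)"
  proof (rule bij_betw_byWitness[where f' = "\<lambda>v. restrict (?\<theta>' \<circ> v) (carrier X)"]; safe?)
    fix u assume "u \<in> Sur_over R X f A P"
    then have u: "u \<in> Sur R X A" and uP: "\<forall>x\<in>carrier X. P (u x) = f x" by (auto simp: Sur_over_def)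
    note uD = SurD[OF u]
    have "restrict (\<theta> \<circ> u) (carrier X) \<in> mhom R X B"
      using restrict_mhom[OF X lmod_hom_comp[OF uD(1) h(1)]] .
    moreover have "restrict (\<theta> \<circ> u) (carrier X) ` carrier X = carrier B"
      using im(1) uD(2) image_image[of \<theta> u "carrier X"] by simp
    ultimately show "restrict (\<theta> \<circ> u) (carrier X) \<in> Sur_over R X f B Q"
      using uP PQ lmod_homD(1)[OF uD(1)] by (auto simp: Sur_over_def Sur_def mhom_def)
    show "restrict (?\<theta>' \<circ> restrict (\<theta> \<circ> u) (carrier X)) (carrier X) = u"
      using uD lmod_homD(1)[OF uD(1)] b by (intro extensionalityI[of _ "carrier X"])
        (auto simp: bij_betw_inv_into_left)
  next
    fix u assume "u \<in> Sur_over R X f B Q"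
    then have u: "u \<in> Sur R X B" and uQ: "\<forall>x\<in>carrier X. Q (u x) = f x" by (auto simp: Sur_over_def)
    note uD = SurD[OF u]
    have r: "\<theta> (?\<theta>' (u x)) = u x" "?\<theta>' (u x) \<in> carrier A" if "x \<in> carrier X" for x
      using that lmod_homD(1)[OF uD(1)] lmod_homD(1)[OF h(2)] b(1) by (auto simp: bij_betw_inv_into_right)
    have "restrict (?\<theta>' \<circ> u) (carrier X) \<in> mhom R X A"
      using restrict_mhom[OF X lmod_hom_comp[OF uD(1) h(2)]] .
    moreover have "restrict (?\<theta>' \<circ> u) (carrier X) ` carrier X = carrier A"
      using im(2) uD(2) image_image[of ?\<theta>' u "carrier X"] by simp
    moreover have "P (?\<theta>' (u x)) = f x" if "x \<in> carrier X" for x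
      using PQ[OF r(2)[OF that]] r(1)[OF that] uQ that by simp
    ultimately show "restrict (?\<theta>' \<circ> u) (carrier X) \<in> Sur_over R X f A P"
      by (auto simp: Sur_over_def Sur_def mhom_def)
    show "restrict (\<theta> \<circ> restrict (?\<theta>' \<circ> u) (carrier X)) (carrier X) = u"
      using uD r by (intro extensionalityI[of _ "carrier X"]) auto
  qed
  then show ?thesis by (rule bij_betw_same_card)
qed

lemma card_mhom_dprod:
  fixes A :: "('r, 'a) module" and B :: "('r, 'b) module" and C :: "('r, 'c) module"
  assumes A: "lmodule R A" and B: "lmodule R B" and C: "lmodule R C"
  shows "card (mhom R (dprod A B) C) = card (mhom R A C) * card (mhom R B C)"
proof -
  interpret A: lmodule R A by fact
  interpret B: lmodule R B by fact
  interpret C: lmodule R C by fact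
  note P = lmodule_dprod[OF A B]
  define T where "T u = (restrict (\<lambda>a. u (a, \<zero>\<^bsub>B\<^esub>)) (carrier A), restrict (\<lambda>b. u (\<zero>\<^bsub>A\<^esub>, b)) (carrier B))" for u :: "'a \<times> 'b \<Rightarrow> 'c"
  define T' :: "('a \<Rightarrow> 'c) \<times> ('b \<Rightarrow> 'c) \<Rightarrow> 'a \<times> 'b \<Rightarrow> 'c" where "T' = (\<lambda>(v, w). restrict (\<lambda>(a, b). v a \<oplus>\<^bsub>C\<^esub> w b) (carrier (dprod A B)))"
  have 1: "(\<lambda>a. (a, \<zero>\<^bsub>B\<^esub>)) \<in> lmod_hom R A (dprod A B)" by (intro lmod_homI) (auto simp: B.smult_zero)
  have 2: "(\<lambda>b. (\<zero>\<^bsub>A\<^esub>, b)) \<in> lmod_hom R B (dprod A B)" by (intro lmod_homI) (auto simp: A.smult_zero)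
  have "bij_betw T (mhom R (dprod A B) C) (mhom R A C \<times> mhom R B C)"
  proof (rule bij_betw_byWitness[where f' = T']; safe?)
    fix u assume "u \<in> mhom R (dprod A B) C"
    then have u: "u \<in> lmod_hom R (dprod A B) C" "u \<in> extensional (carrier (dprod A B))" by (auto simp: mhom_def)
    have "T u \<in> mhom R A C \<times> mhom R B C"
      using restrict_mhom[OF A lmod_hom_comp[OF 1 u(1)]] restrict_mhom[OF B lmod_hom_comp[OF 2 u(1)]]
      by (simp add: T_def comp_def)
    then show "(x, y) = T u \<Longrightarrow> x \<in> mhom R A C" "(x, y) = T u \<Longrightarrow> y \<in> mhom R B C" for x y
      by (metis mem_Sigma_iff)+
    show "T' (T u) = u"
    proof (rule extensionalityI[of _ "carrier (dprod A B)"])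
      fix z assume z: "z \<in> carrier (dprod A B)"
      obtain a b where ab: "z = (a, b)" by (cases z)
      have "u (a, \<zero>\<^bsub>B\<^esub>) \<oplus>\<^bsub>C\<^esub> u (\<zero>\<^bsub>A\<^esub>, b) = u ((a, \<zero>\<^bsub>B\<^esub>) \<oplus>\<^bsub>dprod A B\<^esub> (\<zero>\<^bsub>A\<^esub>, b))"
        using z ab by (intro lmod_homD(2)[OF u(1), symmetric]) auto
      then show "T' (T u) z = u z" using z ab by (simp add: T_def T'_def)
    qed (use u in \<open>auto simp: T'_def T_def\<close>)
  next
    fix v w assume "v \<in> mhom R A C" "w \<in> mhom R B C"
    then have v: "v \<in> lmod_hom R A C" "v \<in> extensional (carrier A)"
      and w: "w \<in> lmod_hom R B C" "w \<in> extensional (carrier B)" by (auto simp: mhom_def)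
    have "v \<circ> fst \<in> lmod_hom R (dprod A B) C" "w \<circ> snd \<in> lmod_hom R (dprod A B) C"
      using v w by (auto intro!: lmod_homI simp: lmod_homD)
    from restrict_mhom[OF P lmod_hom_add[OF C this]]
    show "T' (v, w) \<in> mhom R (dprod A B) C" by (simp add: T'_def case_prod_unfold)
    have "restrict (\<lambda>a. T' (v, w) (a, \<zero>\<^bsub>B\<^esub>)) (carrier A) = v"
      using v lmod_homD(1)[OF v(1)] lmod_hom_zero[OF B C w(1)]
      by (intro extensionalityI[of _ "carrier A"]) (auto simp: T'_def)
    moreover have "restrict (\<lambda>b. T' (v, w) (\<zero>\<^bsub>A\<^esub>, b)) (carrier B) = w"
      using w lmod_homD(1)[OF w(1)] lmod_hom_zero[OF A C v(1)]
      by (intro extensionalityI[of _ "carrier B"]) (auto simp: T'_def)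
    ultimately show "T (T' (v, w)) = (v, w)" by (simp add: T_def)
  qed
  then show ?thesis by (simp add: bij_betw_same_card card_cartesian_product)
qed

section \<open>Fibre products with an extension, and surjections onto them\<close>

definition fiber_prod ::
  "('r, 'a) module \<Rightarrow> ('a \<Rightarrow> 'c) \<Rightarrow> ('r, 'b) module \<Rightarrow> ('b \<Rightarrow> 'c) \<Rightarrow> ('r, 'a \<times> 'b) module" where
  "fiber_prod G P E p = (dprod G E)\<lparr>carrier := {(a, b). a \<in> carrier G \<and> b \<in> carrier E \<and> P a = p b}\<rparr>"

lemma fiber_prod_simps [simp]:
  "carrier (fiber_prod G P E p) = {(a, b). a \<in> carrier G \<and> b \<in> carrier E \<and> P a = p b}"
  "\<zero>\<^bsub>fiber_prod G P E p\<^esub> = (\<zero>\<^bsub>G\<^esub>, \<zero>\<^bsub>E\<^esub>)"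
  "(a, b) \<oplus>\<^bsub>fiber_prod G P E p\<^esub> (a', b') = (a \<oplus>\<^bsub>G\<^esub> a', b \<oplus>\<^bsub>E\<^esub> b')"
  "r \<odot>\<^bsub>fiber_prod G P E p\<^esub> (a, b) = (r \<odot>\<^bsub>G\<^esub> a, r \<odot>\<^bsub>E\<^esub> b)"
  by (simp_all add: fiber_prod_def)

locale fiber_product =
  fixes R :: "('r, 'k) ring_scheme" and M :: "('r, 'm) module" and S :: "('r, 's) module"
    and G :: "('r, 'g) module" and P and E :: "('r, 'e) module" and i p
  assumes M: "lmodule R M" and S: "lmodule R S" and G: "lmodule R G"
    and P: "P \<in> lmod_hom R G M" "P ` carrier G = carrier M"
    and e: "is_extension R M S (E, i, p)"
begin

lemmas ext = is_extensionD[OF e]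

sublocale M: lmodule R M by (rule M)
sublocale S: lmodule R S by (rule S)
sublocale G: lmodule R G by (rule G)
sublocale E: lmodule R E by (rule ext)

abbreviation "F \<equiv> fiber_prod G P E p"

lemma F_lmodule: "lmodule R F"
proof -
  interpret D: lmodule R "dprod G E" using lmodule_dprod[OF G ext(1)] .
  have "submodule {(a, b). a \<in> carrier G \<and> b \<in> carrier E \<and> P a = p b} R (dprod G E)"
    unfolding D.submodule_iff
    by (auto simp: dprod_minus[OF G ext(1)] lmod_hom_zero[OF G M P(1)] lmod_hom_zero[OF ext(1) M ext(4)]
        lmod_hom_minus[OF G M P(1)] lmod_hom_minus[OF ext(1) M ext(4)] lmod_homD(3)[OF P(1)]
        lmod_homD(3)[OF ext(4)] G.smult_closed E.smult_closed)
  then show ?thesis unfolding fiber_prod_def by (rule D.submodule_lmodule)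
qed

lemma fst_hom: "fst \<in> lmod_hom R F G" and snd_hom: "snd \<in> lmod_hom R F E"
  by (auto intro!: lmod_homI)

lemma proj_hom: "P \<circ> fst \<in> lmod_hom R F M"
  using lmod_hom_comp[OF fst_hom P(1)] .

lemma fst_surj: "fst ` carrier F = carrier G"
proof
  show "carrier G \<subseteq> fst ` carrier F"
  proof
    fix a assume a: "a \<in> carrier G"
    then have "P a \<in> p ` carrier E" using ext(5) lmod_homD(1)[OF P(1)] by simp
    then obtain b where "b \<in> carrier E" "P a = p b" by blast
    with a show "a \<in> fst ` carrier F" by force
  qed
qed auto

lemma proj_surj: "(P \<circ> fst) ` carrier F = carrier M"
  using fst_surj P(2) by (metis image_comp)

text \<open>\<open>F\<close> is the disjoint union, over \<open>a\<close> in \<open>G\<close>, of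
  the fibres of \<open>p\<close> over \<open>P a\<close>, and each fibre is in bijection with
  \<open>S\<close>.\<close>

lemma card_F:
  assumes "finite (carrier G)" "finite (carrier S)" "finite (carrier M)"
  shows "finite (carrier F)" "card (carrier F) = card (carrier G) * card (carrier S)"
proof -
  have eq: "carrier F = (SIGMA a:carrier G. {b \<in> carrier E. p b = P a})" by auto
  have b: "bij_betw (\<lambda>s. inv_into (carrier E) p (P a) \<oplus>\<^bsub>E\<^esub> i s) (carrier S) {b \<in> carrier E. p b = P a}"
    if "a \<in> carrier G" for a
    using card_extension_fiber[OF M S e lmod_homD(1)[OF P(1) that]] .
  then have f: "finite {b \<in> carrier E. p b = P a}" if "a \<in> carrier G" for a
    using bij_betw_finite[OF b[OF that]] assms(2) by simp
  show "finite (carrier F)" unfolding eq using assms(1) f by (intro finite_SigmaI)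
  show "card (carrier F) = card (carrier G) * card (carrier S)"
  proof -
    have "(\<Sum>a\<in>carrier G. card {b \<in> carrier E. p b = P a}) = (\<Sum>a\<in>carrier G. card (carrier S))"
      by (intro sum.cong refl) (simp add: bij_betw_same_card[OF b])
    then show ?thesis unfolding eq using assms(1) f by (subst card_SigmaI) auto
  qed
qed

text \<open>In a pair over zero both entries lie over zero independently, so the kernel splits as
  \<open>ker P\<close> times the image of \<open>i\<close>. Iterated, and combined with Schur's
  lemma, this makes the count for the kernel of a tower a power of \<open>q i\<close>.\<close>

lemma card_mhom_kernel:
  assumes S': "lmodule R S'"
  shows "card (mhom R (kmod F M (P \<circ> fst)) S') = card (mhom R (kmod G M P) S') * card (mhom R S S')"
proof -
  note K = kmod_lmodule[OF F_lmodule M proj_hom] and KG = kmod_lmodule[OF G M P(1)]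
  note iS = lmod_homD(1)[OF ext(2)]
  let ?\<theta> = "\<lambda>(a, s). (a, i s)"
  have "?\<theta> \<in> lmod_iso R (dprod (kmod G M P) S) (kmod F M (P \<circ> fst))"
    unfolding lmod_iso_def
  proof (intro CollectI conjI)
    show "?\<theta> \<in> lmod_hom R (dprod (kmod G M P) S) (kmod F M (P \<circ> fst))"
      by (intro lmod_homI)
        (auto simp: mem_a_kernel iS ext(7) lmod_homD(2)[OF ext(2)] lmod_homD(3)[OF ext(2)])
    show "bij_betw ?\<theta> (carrier (dprod (kmod G M P) S)) (carrier (kmod F M (P \<circ> fst)))"
      unfolding bij_betw_def
    proof (intro conjI subset_antisym subsetI)
      show "inj_on ?\<theta> (carrier (dprod (kmod G M P) S))"
        using ext(3) by (auto simp: inj_on_def)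
    next
      fix z assume "z \<in> carrier (kmod F M (P \<circ> fst))"
      then obtain a b where ab: "z = (a, b)" "a \<in> carrier G" "P a = \<zero>\<^bsub>M\<^esub>" "b \<in> carrier E" "p b = \<zero>\<^bsub>M\<^esub>"
        by (cases z) (auto simp: mem_a_kernel)
      then have "b \<in> i ` carrier S" by (simp add: ext(6) mem_a_kernel)
      with ab show "z \<in> ?\<theta> ` carrier (dprod (kmod G M P) S)" by (auto simp: mem_a_kernel)
    qed (auto simp: mem_a_kernel iS ext(7))
  qed
  from card_mhom_iso[OF lmodule_dprod[OF KG S] K this, of S'] show ?thesis
    using card_mhom_dprod[OF KG S S'] by simp
qed

text \<open>On \<open>ker g\<close> the map \<open>g'\<close> takes values in a copy of the simple
  module \<open>S\<close>, so its image there is zero or the whole copy. In the second case the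
  second coordinate can be corrected by elements of \<open>ker g\<close> without moving the first.
  In the first case \<open>(\<zero>, i s)\<close> with nonzero \<open>s\<close> is never
  reached.\<close>

lemma lift_surj_iff:
  assumes simple: "lmod_simple R S" and X: "lmodule R X"
    and g: "g \<in> Sur_over R X f G P" and g': "g' \<in> hom_over R X f E p"
  shows "(\<lambda>x. (g x, g' x)) ` carrier X = carrier F \<longleftrightarrow> \<not> (\<forall>x\<in>a_kernel X G g. g' x = \<zero>\<^bsub>E\<^esub>)"
proof -
  interpret X: lmodule R X by fact
  have gh: "g \<in> lmod_hom R X G" "g ` carrier X = carrier G" "\<And>x. x \<in> carrier X \<Longrightarrow> P (g x) = f x"
    using g by (auto simp: Sur_over_def Sur_def)
  have gh': "g' \<in> lmod_hom R X E" "\<And>x. x \<in> carrier X \<Longrightarrow> p (g' x) = f x"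
    using g' by (auto simp: hom_over_def mhom_def)
  note gX = lmod_homD(1)[OF gh(1)] and gX' = lmod_homD(1)[OF gh'(1)]
  show ?thesis
  proof
    assume surj: "(\<lambda>x. (g x, g' x)) ` carrier X = carrier F"
    obtain s where s: "s \<in> carrier S" "s \<noteq> \<zero>\<^bsub>S\<^esub>" using simple by (auto simp: lmod_simple_def)
    have "(\<zero>\<^bsub>G\<^esub>, i s) \<in> carrier F"
      using s lmod_homD(1)[OF ext(2)] ext(7) lmod_hom_zero[OF G M P(1)] by simp
    then obtain x where "x \<in> carrier X" "\<zero>\<^bsub>G\<^esub> = g x" "i s = g' x" unfolding surj[symmetric] by blast
    moreover have "i s \<noteq> \<zero>\<^bsub>E\<^esub>"
      using s inj_on_eq_iff[OF ext(3), of s "\<zero>\<^bsub>S\<^esub>"] lmod_hom_zero[OF S ext(1,2)] by simp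
    ultimately show "\<not> (\<forall>x\<in>a_kernel X G g. g' x = \<zero>\<^bsub>E\<^esub>)" by (auto simp: mem_a_kernel)
  next
    assume nz: "\<not> (\<forall>x\<in>a_kernel X G g. g' x = \<zero>\<^bsub>E\<^esub>)"
    define K where "K = kmod X G g"
    have K: "lmodule R K" unfolding K_def using kmod_lmodule[OF X G gh(1)] .
    interpret K: lmodule R K by fact
    have cK [simp]: "carrier K = a_kernel X G g" by (simp add: K_def)
    have g'K: "g' \<in> lmod_hom R K E"
      using gh'(1) by (intro lmod_homI) (auto simp: K_def mem_a_kernel lmod_homD)
    have sub: "g' ` carrier K \<subseteq> i ` carrier S"
    proof
      fix y assume "y \<in> g' ` carrier K"
      then obtain x where x: "x \<in> carrier X" "g x = \<zero>\<^bsub>G\<^esub>" "y = g' x" by (auto simp: mem_a_kernel)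
      then have "p y = \<zero>\<^bsub>M\<^esub>" using gh(3)[of x] gh'(2)[of x] lmod_hom_zero[OF G M P(1)] by simp
      then show "y \<in> i ` carrier S" using x gX' by (simp add: ext(6) mem_a_kernel)
    qed
    note l = lmod_hom_lift[OF K S ext(2,3) g'K sub]
    define w where "w = inv_into (carrier S) i \<circ> g'"
    have w: "w \<in> lmod_hom R K S" "\<And>x. x \<in> carrier K \<Longrightarrow> i (w x) = g' x"
      using l by (simp_all add: w_def)
    have "submodule (carrier K) R K"
      by (simp add: K.submodule_iff K.smult_closed[simplified] K.M.minus_closed[simplified] K.M.zero_closed[simplified])
    from image_submodule[OF K S w(1) this] have "submodule (w ` carrier K) R S" .
    moreover have "w ` carrier K \<noteq> {\<zero>\<^bsub>S\<^esub>}"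
    proof
      assume *: "w ` carrier K = {\<zero>\<^bsub>S\<^esub>}"
      have "g' x = \<zero>\<^bsub>E\<^esub>" if x: "x \<in> carrier K" for x
      proof -
        have "w x = \<zero>\<^bsub>S\<^esub>" using * x by blast
        then show ?thesis using w(2)[OF x] lmod_hom_zero[OF S ext(1,2)] by simp
      qed
      with nz show False by simp
    qed
    ultimately have wS: "w ` carrier K = carrier S" using simple by (auto simp: lmod_simple_def)
    show "(\<lambda>x. (g x, g' x)) ` carrier X = carrier F"
    proof (intro subset_antisym subsetI)
      fix z assume "z \<in> carrier F"
      then obtain a b where ab: "z = (a, b)" "a \<in> carrier G" "b \<in> carrier E" "P a = p b" by auto
      then have "a \<in> g ` carrier X" using gh(2) by simp
      then obtain x where x: "x \<in> carrier X" "a = g x" by blast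
      have "p (b \<ominus>\<^bsub>E\<^esub> g' x) = \<zero>\<^bsub>M\<^esub>"
        using lmod_hom_minus[OF ext(1) M ext(4) ab(3) gX'[OF x(1)]] gh(3)[OF x(1)] gh'(2)[OF x(1)] ab(4) x
          lmod_homD(1)[OF ext(4) ab(3)] by (simp add: M.minus_eq_zero_iff)
      then have "b \<ominus>\<^bsub>E\<^esub> g' x \<in> i ` carrier S" using ab gX'[OF x(1)] by (simp add: ext(6) mem_a_kernel)
      then obtain k where k: "k \<in> carrier K" "b \<ominus>\<^bsub>E\<^esub> g' x = g' k"
        unfolding wS[symmetric] using w(2) by auto
      then have k': "k \<in> carrier X" "g k = \<zero>\<^bsub>G\<^esub>" by (auto simp: mem_a_kernel)
      have "b = g' k \<oplus>\<^bsub>E\<^esub> g' x" using E.minus_add_cancel[OF ab(3) gX'[OF x(1)]] k(2) by simp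
      then have "z = (g (k \<oplus>\<^bsub>X\<^esub> x), g' (k \<oplus>\<^bsub>X\<^esub> x))"
        using ab x k' lmod_homD(2)[OF gh(1)] lmod_homD(2)[OF gh'(1)] by simp
      then show "z \<in> (\<lambda>x. (g x, g' x)) ` carrier X" using x k' by blast
    qed (use gX gX' gh(3) gh'(2) in auto)
  qed
qed

text \<open>A map into a fibre product is a pair of lifts. The first component of a surjection is
  again surjective, and \<open>lift_surj_iff\<close> decides which second components are
  admissible.\<close>

lemma card_Sur_over_F:
  assumes simple: "lmod_simple R S" and X: "lmodule R X"
    and fin: "finite (carrier X)" "finite (carrier G)" "finite (carrier E)"
  shows "card (Sur_over R X f F (P \<circ> fst)) =
    (\<Sum>g\<in>Sur_over R X f G P. card {g' \<in> hom_over R X f E p. \<not> (\<forall>x\<in>a_kernel X G g. g' x = \<zero>\<^bsub>E\<^esub>)})"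
proof -
  interpret X: lmodule R X by fact
  let ?B = "\<lambda>g. {g' \<in> hom_over R X f E p. \<not> (\<forall>x\<in>a_kernel X G g. g' x = \<zero>\<^bsub>E\<^esub>)}"
  let ?T = "\<lambda>u. (restrict (fst \<circ> u) (carrier X), restrict (snd \<circ> u) (carrier X))"
  let ?T' = "\<lambda>(g, g'). restrict (\<lambda>x. (g x, g' x)) (carrier X)"
  have "bij_betw ?T (Sur_over R X f F (P \<circ> fst)) (SIGMA g:Sur_over R X f G P. ?B g)"
  proof (rule bij_betw_byWitness[where f' = ?T']; (intro ballI subsetI)?)
    fix u assume "u \<in> Sur_over R X f F (P \<circ> fst)"
    then have u: "u \<in> lmod_hom R X F" "u ` carrier X = carrier F" "u \<in> extensional (carrier X)"
      "\<And>x. x \<in> carrier X \<Longrightarrow> P (fst (u x)) = f x" by (auto simp: Sur_over_def Sur_def)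
    show "?T' (?T u) = u"
      by (rule extensionalityI[of _ "carrier X"]) (use u(3) in auto)
  next
    fix z assume "z \<in> ?T ` Sur_over R X f F (P \<circ> fst)"
    then obtain u where z: "z = ?T u" and "u \<in> Sur_over R X f F (P \<circ> fst)" by blast
    then have u: "u \<in> lmod_hom R X F" "u ` carrier X = carrier F" "u \<in> extensional (carrier X)"
      "\<And>x. x \<in> carrier X \<Longrightarrow> P (fst (u x)) = f x" by (auto simp: Sur_over_def Sur_def)
    have uX: "u x \<in> carrier F" if "x \<in> carrier X" for x using lmod_homD(1)[OF u(1) that] .
    have "restrict (fst \<circ> u) (carrier X) \<in> mhom R X G" "restrict (snd \<circ> u) (carrier X) \<in> mhom R X E"
      using restrict_mhom[OF X lmod_hom_comp[OF u(1) fst_hom]] restrict_mhom[OF X lmod_hom_comp[OF u(1) snd_hom]] .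
    moreover have "restrict (fst \<circ> u) (carrier X) ` carrier X = carrier G"
      using fst_surj u(2) image_image[of fst u "carrier X"] by simp
    moreover have "p (snd (u x)) = f x" if "x \<in> carrier X" for x
      using uX[OF that] u(4)[OF that] by auto
    ultimately have 1: "restrict (fst \<circ> u) (carrier X) \<in> Sur_over R X f G P"
      and 2: "restrict (snd \<circ> u) (carrier X) \<in> hom_over R X f E p"
      using u(4) by (auto simp: Sur_over_def Sur_def mhom_def hom_over_def)
    have "(\<lambda>x. (restrict (fst \<circ> u) (carrier X) x, restrict (snd \<circ> u) (carrier X) x)) ` carrier X = carrier F"
      unfolding u(2)[symmetric] by (intro image_cong) auto
    with lift_surj_iff[OF simple X 1 2] 1 2 show "z \<in> (SIGMA g:Sur_over R X f G P. ?B g)"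
      unfolding z by simp
  next
    fix z assume "z \<in> (SIGMA g:Sur_over R X f G P. ?B g)"
    then obtain g g' where z: "z = (g, g')" and g: "g \<in> Sur_over R X f G P" and g': "g' \<in> ?B g" by blast
    show "?T (?T' z) = z"
      using g g' unfolding z by (auto simp: Sur_over_def Sur_def hom_over_def mhom_def
          intro!: extensionalityI[of _ "carrier X"])
  next
    fix u assume "u \<in> ?T' ` (SIGMA g:Sur_over R X f G P. ?B g)"
    then obtain g g' where u: "u = ?T' (g, g')" and g: "g \<in> Sur_over R X f G P" and g': "g' \<in> ?B g" by blast
    have gh: "g \<in> lmod_hom R X G" "\<And>x. x \<in> carrier X \<Longrightarrow> P (g x) = f x"
      using g by (auto simp: Sur_over_def Sur_def)
    have gh': "g' \<in> lmod_hom R X E" "\<And>x. x \<in> carrier X \<Longrightarrow> p (g' x) = f x"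
      using g' by (auto simp: hom_over_def mhom_def)
    have "(\<lambda>x. (g x, g' x)) \<in> lmod_hom R X F"
      using gh gh' by (intro lmod_homI) (auto simp: lmod_homD)
    then have "u \<in> mhom R X F" unfolding u by (auto intro: restrict_mhom X)
    moreover have "u ` carrier X = carrier F"
      using lift_surj_iff[OF simple X g, of g'] g' unfolding u by simp
    ultimately show "u \<in> Sur_over R X f F (P \<circ> fst)"
      using gh(2) unfolding Sur_over_def Sur_def mhom_def u by auto
  qed
  then have "card (Sur_over R X f F (P \<circ> fst)) = card (SIGMA g:Sur_over R X f G P. ?B g)"
    by (rule bij_betw_same_card)
  also have "\<dots> = (\<Sum>g\<in>Sur_over R X f G P. card (?B g))"
    by (intro card_SigmaI ballI finite_Sur_over finite_subset[OF _ finite_hom_over]) (use fin in auto)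
  finally show ?thesis .
qed

text \<open>Such lifts factor uniquely through \<open>g\<close>. Their number depends on neither
  \<open>g\<close> nor \<open>X\<close>, which later turns the sum over \<open>g\<close> into a
  product.\<close>

lemma card_hom_over_vanishing:
  assumes X: "lmodule R X" and g: "g \<in> Sur_over R X f G P"
  shows "card {g' \<in> hom_over R X f E p. \<forall>x\<in>a_kernel X G g. g' x = \<zero>\<^bsub>E\<^esub>} = card (hom_over R G P E p)"
proof -
  interpret X: lmodule R X by fact
  let ?B = "{g' \<in> hom_over R X f E p. \<forall>x\<in>a_kernel X G g. g' x = \<zero>\<^bsub>E\<^esub>}"
  have gh: "g \<in> lmod_hom R X G" "g ` carrier X = carrier G" "\<And>x. x \<in> carrier X \<Longrightarrow> P (g x) = f x"
    using g by (auto simp: Sur_over_def Sur_def)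
  note gX = lmod_homD(1)[OF gh(1)]
  let ?T = "\<lambda>\<phi>. restrict (\<phi> \<circ> g) (carrier X)"
  have "bij_betw ?T (hom_over R G P E p) ?B"
    unfolding bij_betw_def
  proof (intro conjI subset_antisym subsetI)
    show "inj_on ?T (hom_over R G P E p)"
    proof (rule inj_onI)
      fix \<phi> \<psi> assume *: "\<phi> \<in> hom_over R G P E p" "\<psi> \<in> hom_over R G P E p" "?T \<phi> = ?T \<psi>"
      show "\<phi> = \<psi>"
      proof (rule extensionalityI[of _ "carrier G"])
        fix a assume "a \<in> carrier G"
        then have "a \<in> g ` carrier X" using gh(2) by simp
        then obtain x where x: "x \<in> carrier X" "a = g x" by blast
        then show "\<phi> a = \<psi> a" using fun_cong[OF *(3), of x] by simp
      qed (use * in \<open>auto simp: hom_over_def mhom_def\<close>)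
    qed
  next
    fix g' assume "g' \<in> ?T ` hom_over R G P E p"
    then obtain \<phi> where g': "g' = ?T \<phi>" and \<phi>: "\<phi> \<in> lmod_hom R G E" "\<And>a. a \<in> carrier G \<Longrightarrow> p (\<phi> a) = P a"
      by (auto simp: hom_over_def mhom_def)
    have "g' \<in> mhom R X E" unfolding g' by (rule restrict_mhom[OF X lmod_hom_comp[OF gh(1) \<phi>(1)]])
    moreover have "g' x = \<zero>\<^bsub>E\<^esub>" if "x \<in> a_kernel X G g" for x
      using that lmod_hom_zero[OF G ext(1) \<phi>(1)] by (simp add: g' mem_a_kernel)
    ultimately show "g' \<in> ?B" using \<phi>(2) gX gh(3) by (simp add: hom_over_def g')
  next
    fix g' assume "g' \<in> ?B"
    then have g': "g' \<in> lmod_hom R X E" "\<And>x. x \<in> carrier X \<Longrightarrow> p (g' x) = f x"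
      "g' \<in> extensional (carrier X)" "a_kernel X G g \<subseteq> a_kernel X E g'"
      by (auto simp: hom_over_def mhom_def mem_a_kernel)
    obtain \<phi> where \<phi>: "\<phi> \<in> lmod_hom R G E" "\<And>x. x \<in> carrier X \<Longrightarrow> \<phi> (g x) = g' x"
      using lmod_hom_factor[OF X G ext(1) gh(1,2) g'(1,4)] by blast
    let ?\<phi> = "restrict \<phi> (carrier G)"
    have "g' = ?T ?\<phi>"
      by (rule extensionalityI[OF g'(3) restrict_extensional]) (use \<phi>(2) gX in auto)
    moreover have "p (\<phi> a) = P a" if "a \<in> carrier G" for a
    proof -
      have "a \<in> g ` carrier X" using gh(2) that by simp
      then show ?thesis using \<phi>(2) g'(2) gh(3) by auto
    qed
    then have "?\<phi> \<in> hom_over R G P E p" using restrict_mhom[OF G \<phi>(1)] by (simp add: hom_over_def)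
    ultimately show "g' \<in> ?T ` hom_over R G P E p" by blast
  qed
  then show ?thesis by (simp add: bij_betw_same_card)
qed

end

section \<open>Towers of extensions by simple modules\<close>

lemma zero_hom: "lmodule R Y \<Longrightarrow> (\<lambda>_. \<zero>\<^bsub>Y\<^esub>) \<in> lmod_hom R X Y"
proof -
  assume "lmodule R Y"
  then interpret lmodule R Y .
  show ?thesis by (intro lmod_homI) (auto simp: smult_zero)
qed

lemma card_mhom_pos:
  assumes "lmodule R X" "lmodule R Y" "finite (carrier X)" "finite (carrier Y)"
  shows "card (mhom R X Y) \<ge> 1"
  using restrict_mhom[OF assms(1) zero_hom[OF assms(2)]] finite_mhom[OF assms(3,4)]
  by (metis One_nat_def Suc_leI card_gt_0_iff empty_iff)

lemma card_mhom_ge_2: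
  assumes X: "lmodule R X" and Y: "lmodule R Y" "finite (carrier X)" "finite (carrier Y)"
    and u: "u \<in> lmod_hom R X Y" "x \<in> carrier X" "u x \<noteq> \<zero>\<^bsub>Y\<^esub>"
  shows "card (mhom R X Y) \<ge> 2"
proof -
  let ?z = "restrict (\<lambda>_. \<zero>\<^bsub>Y\<^esub>) (carrier X)" and ?u = "restrict u (carrier X)"
  have "{?z, ?u} \<subseteq> mhom R X Y" using restrict_mhom[OF X] zero_hom[OF Y(1)] u(1) by auto
  moreover have "?z \<noteq> ?u"
  proof
    assume "?z = ?u"
    from fun_cong[OF this, of x] show False using u(2,3) by simp
  qed
  moreover have "finite (mhom R X Y)" using Y(2,3) by (rule finite_mhom)
  ultimately show ?thesis using card_mono[of "mhom R X Y" "{?z, ?u}"] by simp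
qed

lemma card_mhom_1:
  assumes "lmodule R X" "lmodule R Y" "\<And>u x. u \<in> lmod_hom R X Y \<Longrightarrow> x \<in> carrier X \<Longrightarrow> u x = \<zero>\<^bsub>Y\<^esub>"
  shows "card (mhom R X Y) = 1"
proof -
  have "u = restrict (\<lambda>_. \<zero>\<^bsub>Y\<^esub>) (carrier X)" if "u \<in> mhom R X Y" for u
  proof (rule extensionalityI[of _ "carrier X"])
    have u: "u \<in> lmod_hom R X Y" "u \<in> extensional (carrier X)" using that by (auto simp: mhom_def)
    then show "u \<in> extensional (carrier X)" by simp
    show "u x = restrict (\<lambda>_. \<zero>\<^bsub>Y\<^esub>) (carrier X) x" if "x \<in> carrier X" for x
      using assms(3)[OF u(1) that] that by simp
  qed simp
  moreover have "restrict (\<lambda>_. \<zero>\<^bsub>Y\<^esub>) (carrier X) \<in> mhom R X Y"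
    by (rule restrict_mhom[OF assms(1) zero_hom[OF assms(2)]])
  ultimately have "mhom R X Y = {restrict (\<lambda>_. \<zero>\<^bsub>Y\<^esub>) (carrier X)}" by blast
  then show ?thesis by simp
qed

text \<open>Kernel and image are submodules, so a nonzero homomorphism would be bijective. A count
  of 1 means that a new factor \<open>S\<close> in a kernel leaves the homomorphisms to the other
  simple modules unchanged in number.\<close>

lemma Schur:
  assumes S: "lmod_simple R S" and T: "lmod_simple R T" and "\<not> lmod_isomorphic R S T"
  shows "card (mhom R S T) = 1"
proof (rule card_mhom_1)
  show S': "lmodule R S" and T': "lmodule R T" using S T by (auto simp: lmod_simple_def)
  interpret S: lmodule R S by fact
  fix u x assume u: "u \<in> lmod_hom R S T" and x: "x \<in> carrier S"
  have "a_kernel S T u = {\<zero>\<^bsub>S\<^esub>} \<or> a_kernel S T u = carrier S"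
    using S a_kernel_submodule[OF S' T' u] by (auto simp: lmod_simple_def)
  then show "u x = \<zero>\<^bsub>T\<^esub>"
  proof
    assume "a_kernel S T u = {\<zero>\<^bsub>S\<^esub>}"
    then have inj: "inj_on u (carrier S)" using lmod_hom_inj_iff[OF S' T' u] by simp
    have "submodule (carrier S) R S"
      by (simp add: S.submodule_iff S.smult_closed)
    then have "submodule (u ` carrier S) R T" by (rule image_submodule[OF S' T' u])
    moreover have "u ` carrier S \<noteq> carrier T"
      using inj u assms(3) by (auto simp: lmod_isomorphic_def lmod_iso_def bij_betw_def)
    ultimately have "u ` carrier S = {\<zero>\<^bsub>T\<^esub>}" using T by (auto simp: lmod_simple_def)
    then show ?thesis using x by blast
  next
    assume "a_kernel S T u = carrier S"
    then show ?thesis using x by (metis mem_a_kernel)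
  qed
qed

text \<open>The quotient by a maximal proper submodule \<open>L\<close>, which exists by finiteness.
  The preimage of a submodule of \<open>T\<close> contains \<open>L\<close>, so by maximality it is
  \<open>L\<close> or everything.\<close>

lemma exists_simple_quotient:
  fixes K :: "('r, 'a) module"
  assumes K: "lmodule R K" and fin: "finite (carrier K)" and nz: "carrier K \<noteq> {\<zero>\<^bsub>K\<^esub>}"
  obtains T :: "('r, 'a) module" and u
  where "lmod_simple R T" "finite (carrier T)" "u \<in> lmod_hom R K T" "u ` carrier K = carrier T"
proof -
  interpret K: lmodule R K by fact
  let ?P = "{L. submodule L R K \<and> L \<noteq> carrier K}"
  have "{\<zero>\<^bsub>K\<^esub>} \<in> ?P"
    using nz by (auto simp: K.submodule_iff K.smult_zero K.minus_zero)
  moreover have "?P \<subseteq> Pow (carrier K)" by (auto simp: K.submodule_iff)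
  then have finP: "finite ?P" using fin finite_subset by blast
  ultimately obtain L where L: "L \<in> ?P" and max: "\<And>L'. L' \<in> ?P \<Longrightarrow> L \<subseteq> L' \<Longrightarrow> L' = L"
    using finite_has_maximal[of ?P] by (metis (no_types, lifting) empty_iff)
  then have Ls: "submodule L R K" "L \<noteq> carrier K" by auto
  obtain T :: "('r, 'a) module" and u where T: "lmodule R T" and u: "u \<in> lmod_hom R K T"
    "u ` carrier K = carrier T" "a_kernel K T u = L" using lmodule_quotient[OF K Ls(1)] .
  interpret T: lmodule R T by fact
  have "carrier T \<noteq> {\<zero>\<^bsub>T\<^esub>}"
  proof
    assume *: "carrier T = {\<zero>\<^bsub>T\<^esub>}"
    have "a_kernel K T u = carrier K" using lmod_homD(1)[OF u(1)] unfolding * by (auto simp: mem_a_kernel)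
    then show False using u(3) Ls(2) by simp
  qed
  moreover have "H = {\<zero>\<^bsub>T\<^esub>} \<or> H = carrier T" if H: "submodule H R T" for H
  proof -
    note H' = H[unfolded T.submodule_iff]
    let ?L' = "{x \<in> carrier K. u x \<in> H}"
    have sub: "submodule ?L' R K"
      using H' lmod_hom_zero[OF K T u(1)]
      by (auto simp: K.submodule_iff lmod_hom_minus[OF K T u(1)] lmod_homD(3)[OF u(1)] K.smult_closed)
    have "L \<subseteq> ?L'" using H' by (auto simp: u(3)[symmetric] mem_a_kernel)
    have im: "u ` ?L' = H"
    proof (intro subset_antisym subsetI)
      fix y assume y: "y \<in> H"
      then have "y \<in> u ` carrier K" using H' u(2) by auto
      then show "y \<in> u ` ?L'" using y by auto
    qed auto
    show ?thesis
    proof (cases "?L' = carrier K")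
      case True then show ?thesis using im u(2) by simp
    next
      case False
      then have "?L' = L" using max sub \<open>L \<subseteq> ?L'\<close> by blast
      then have "u ` L = H" using im by simp
      moreover have "u ` L = {\<zero>\<^bsub>T\<^esub>}"
      proof -
        have "\<zero>\<^bsub>K\<^esub> \<in> L" using Ls(1) by (simp add: K.submodule_iff)
        moreover have "u ` L \<subseteq> {\<zero>\<^bsub>T\<^esub>}" unfolding u(3)[symmetric] by (auto simp: mem_a_kernel)
        ultimately show ?thesis by (metis empty_iff imageI subset_singletonD)
      qed
      ultimately show ?thesis by simp
    qed
  qed
  ultimately have "lmod_simple R T" using T by (auto simp: lmod_simple_def)
  moreover have "finite (carrier T)" unfolding u(2)[symmetric] using fin by simp
  ultimately show ?thesis using that u by blast
qed

section \<open>Preparations for iterating fibre products on \<open>nat\<close>\<close>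

lemma sum_sum_list_swap:
  fixes F :: "'a \<Rightarrow> 'b \<Rightarrow> 'c :: comm_monoid_add"
  shows "(\<Sum>g\<in>A. \<Sum>x\<leftarrow>xs. F g x) = (\<Sum>x\<leftarrow>xs. \<Sum>g\<in>A. F g x)"
  by (induction xs) (auto simp: sum.distrib)

text \<open>Every numerical invariant of a tower is a product over \<open>I\<close> of functions of
  the exponents, so one more factor at \<open>k\<close> multiplies it by a single
  \<open>r\<close>.\<close>

lemma prod_fun_upd_Suc:
  fixes h :: "'i \<Rightarrow> nat \<Rightarrow> 'c :: comm_monoid_mult"
  assumes "finite I" "k \<in> I" "h k (Suc (e k)) = h k (e k) * r"
  shows "(\<Prod>i\<in>I. h i ((e(k := Suc (e k))) i)) = (\<Prod>i\<in>I. h i (e i)) * r"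
proof -
  have "(\<Prod>i\<in>I - {k}. h i ((e(k := Suc (e k))) i)) = (\<Prod>i\<in>I - {k}. h i (e i))"
    by (intro prod.cong) auto
  then show ?thesis
    using prod.remove[OF assms(1,2), of "\<lambda>i. h i (e i)"]
      prod.remove[OF assms(1,2), of "\<lambda>i. h i ((e(k := Suc (e k))) i)"] assms(3)
    by (simp add: ac_simps)
qed

text \<open>In the last clause the lifts not vanishing on \<open>ker g\<close> are counted as all
  lifts minus the vanishing ones. Summed over extension classes, both parts have the form evaluated
  by \<open>Ext1_representatives\<close>.\<close>

lemma fiber_product_nat:
  fixes G M S E :: "('r, nat) module"
  assumes Mh: "lmodule R M" "finite (carrier M)" and Sh: "lmod_simple R S" "finite (carrier S)"
    and Gh: "lmodule R G" "finite (carrier G)" "P \<in> lmod_hom R G M" "P ` carrier G = carrier M"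
    and e: "is_extension R M S (E, i, p)"
  obtains F :: "('r, nat) module" and Q
  where "lmodule R F" "finite (carrier F)" "Q \<in> lmod_hom R F M" "Q ` carrier F = carrier M"
    "card (carrier F) = card (carrier G) * card (carrier S)"
    "\<And>S' :: ('r, nat) module. lmodule R S' \<Longrightarrow>
      card (mhom R (kmod F M Q) S') = card (mhom R (kmod G M P) S') * card (mhom R S S')"
    "\<And>(X :: ('r, nat) module) f. lmodule R X \<Longrightarrow> finite (carrier X) \<Longrightarrow>
      real (card (Sur_over R X f F Q)) =
        (\<Sum>g\<in>Sur_over R X f G P. real (card (hom_over R X f E p)) - real (card (hom_over R G P E p)))"
proof -
  have S': "lmodule R S" using Sh by (simp add: lmod_simple_def)
  interpret fiber_product R M S G P E i p
    using assms S' by (intro fiber_product.intro)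
  note cF = card_F[OF Gh(2) Sh(2) Mh(2)]
  have finE: "finite (carrier E)" using finite_extension[OF M S' e Mh(2) Sh(2)] .
  obtain \<theta> :: "nat \<times> nat \<Rightarrow> nat" where "inj_on \<theta> (carrier F)"
    using finite_imp_inj_to_nat_seg[OF cF(1)] by blast
  then obtain F' :: "('r, nat) module" where F': "lmodule R F'" "carrier F' = \<theta> ` carrier F"
    and \<theta>: "\<theta> \<in> lmod_iso R F F'"
    using lmodule_transport[OF F_lmodule] by blast
  let ?\<theta>' = "inv_into (carrier F) \<theta>"
  define Q where "Q = (P \<circ> fst) \<circ> ?\<theta>'"
  have b: "bij_betw \<theta> (carrier F) (carrier F')" using \<theta> by (simp add: lmod_iso_def)
  have \<theta>': "?\<theta>' \<in> lmod_iso R F' F" using lmod_iso_inv[OF \<theta> F_lmodule] .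
  then have \<theta>'h: "?\<theta>' \<in> lmod_hom R F' F" "bij_betw ?\<theta>' (carrier F') (carrier F)" by (auto simp: lmod_iso_def)
  have Q: "Q \<in> lmod_hom R F' M" unfolding Q_def by (rule lmod_hom_comp[OF \<theta>'h(1) proj_hom])
  have Q\<theta>: "Q (\<theta> z) = P (fst z)" if "z \<in> carrier F" for z
    using bij_betw_inv_into_left[OF b that] by (simp add: Q_def)
  have \<theta>h: "\<theta> \<in> lmod_hom R F F'" using \<theta> by (simp add: lmod_iso_def)
  have \<theta>K: "\<theta> \<in> lmod_iso R (kmod F M (P \<circ> fst)) (kmod F' M Q)"
    unfolding lmod_iso_def
  proof (intro CollectI conjI)
    show "\<theta> \<in> lmod_hom R (kmod F M (P \<circ> fst)) (kmod F' M Q)"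
      by (intro lmod_homI)
        (auto simp: mem_a_kernel lmod_homD[OF \<theta>h] Q\<theta> simp del: fiber_prod_simps)
    show "bij_betw \<theta> (carrier (kmod F M (P \<circ> fst))) (carrier (kmod F' M Q))"
      unfolding bij_betw_def
    proof
      show "inj_on \<theta> (carrier (kmod F M (P \<circ> fst)))"
        using b by (auto simp: bij_betw_def mem_a_kernel intro: inj_on_subset)
      show "\<theta> ` carrier (kmod F M (P \<circ> fst)) = carrier (kmod F' M Q)"
        using Q\<theta> unfolding F'(2) by (auto simp: mem_a_kernel F'(2) simp del: fiber_prod_simps)
    qed
  qed
  show ?thesis
  proof (rule that[of F' Q])
    show "finite (carrier F')" using F'(2) cF(1) by simp
    show "card (carrier F') = card (carrier G) * card (carrier S)"
      using bij_betw_same_card[OF b] cF(2) by simp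
    have "Q ` carrier F' = (P \<circ> fst) ` ?\<theta>' ` carrier F'" by (simp add: Q_def image_comp)
    then show "Q ` carrier F' = carrier M" using \<theta>'h(2) proj_surj by (simp add: bij_betw_def)
    show "card (mhom R (kmod F' M Q) S') = card (mhom R (kmod G M P) S') * card (mhom R S S')"
      if "lmodule R S'" for S' :: "('r, nat) module"
      using card_mhom_iso[OF kmod_lmodule[OF F_lmodule M proj_hom] kmod_lmodule[OF F'(1) M Q] \<theta>K, of S']
        card_mhom_kernel[OF that] by simp
    fix X :: "('r, nat) module" and f
    assume X: "lmodule R X" "finite (carrier X)"
    have "card (Sur_over R X f F' Q) = card (Sur_over R X f F (P \<circ> fst))"
      using card_Sur_over_iso[OF X(1) F_lmodule F'(1) \<theta>, of Q "P \<circ> fst" f] Q\<theta> by simp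
    also have "\<dots> = (\<Sum>g\<in>Sur_over R X f G P. card {g' \<in> hom_over R X f E p. \<not> (\<forall>x\<in>a_kernel X G g. g' x = \<zero>\<^bsub>E\<^esub>)})"
      by (rule card_Sur_over_F[OF Sh(1) X(1) X(2) Gh(2) finE])
    also have "real \<dots> = (\<Sum>g\<in>Sur_over R X f G P. real (card (hom_over R X f E p)) - real (card (hom_over R G P E p)))"
      unfolding of_nat_sum
    proof (rule sum.cong[OF refl])
      fix g assume g: "g \<in> Sur_over R X f G P"
      let ?H = "hom_over R X f E p"
      let ?A = "{g' \<in> ?H. \<forall>x\<in>a_kernel X G g. g' x = \<zero>\<^bsub>E\<^esub>}"
      have fin: "finite ?H" using finite_hom_over[OF X(2) finE] .
      have "{g' \<in> ?H. \<not> (\<forall>x\<in>a_kernel X G g. g' x = \<zero>\<^bsub>E\<^esub>)} = ?H - ?A" by auto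
      then have "card {g' \<in> ?H. \<not> (\<forall>x\<in>a_kernel X G g. g' x = \<zero>\<^bsub>E\<^esub>)} = card ?H - card ?A"
        using fin by (simp add: card_Diff_subset)
      moreover have "card ?A \<le> card ?H" using fin by (intro card_mono) auto
      ultimately show "real (card {g' \<in> ?H. \<not> (\<forall>x\<in>a_kernel X G g. g' x = \<zero>\<^bsub>E\<^esub>)}) =
          real (card ?H) - real (card (hom_over R G P E p))"
        using card_hom_over_vanishing[OF X(1) g] by simp
    qed
    finally show "real (card (Sur_over R X f F' Q)) =
      (\<Sum>g\<in>Sur_over R X f G P. real (card (hom_over R X f E p)) - real (card (hom_over R G P E p)))" .
  qed (use F' Q in auto)
qed

section \<open>Counting over a fixed \<open>M\<close> with a complete family of finite simple
  modules\<close>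

locale simple_family =
  fixes R :: "('r, 'k) ring_scheme" and I :: "'i set" and S :: "'i \<Rightarrow> ('r, nat) module"
    and M :: "('r, nat) module"
  assumes finI: "finite I"
    and S_fin: "\<And>i. i \<in> I \<Longrightarrow> finite (carrier (S i))"
    and S_simple: "\<And>i. i \<in> I \<Longrightarrow> lmod_simple R (S i)"
    and S_noniso: "\<And>i j. i \<in> I \<Longrightarrow> j \<in> I \<Longrightarrow> i \<noteq> j \<Longrightarrow> \<not> lmod_isomorphic R (S i) (S j)"
    and S_complete: "\<And>T :: ('r, nat) module. lmod_simple R T \<Longrightarrow> finite (carrier T) \<Longrightarrow> \<exists>i\<in>I. lmod_isomorphic R T (S i)"
    and M: "lmodule R M" "finite (carrier M)"
    and Ext: "\<And>i. i \<in> I \<Longrightarrow> finite (Ext1 R M (S i))"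
begin

definition q where "q i = card (mhom R (S i) (S i))"
text \<open>The overcounting factor: in total over the extension classes, each homomorphism from the
  kernel to \<open>S i\<close> comes from \<open>m i\<close> lifts.\<close>

definition m where "m i = card (mhom R M (S i))"
definition ker_homs :: "('r, nat) module \<Rightarrow> (nat \<Rightarrow> nat) \<Rightarrow> 'i \<Rightarrow> nat" where
  "ker_homs X f i = card (mhom R (kmod X M f) (S i))"

lemma S_lmodule: "i \<in> I \<Longrightarrow> lmodule R (S i)"
  using S_simple by (simp add: lmod_simple_def)

lemma m_pos: "i \<in> I \<Longrightarrow> m i \<ge> 1"
  unfolding m_def using card_mhom_pos[OF M(1) S_lmodule M(2) S_fin] .

lemma q_ge_2:
  assumes "i \<in> I"
  shows "q i \<ge> 2"
proof -
  interpret S: lmodule R "S i" by (rule S_lmodule[OF assms])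
  obtain s where "s \<in> carrier (S i)" "s \<noteq> \<zero>\<^bsub>S i\<^esub>"
    using S_simple[OF assms] by (auto simp: lmod_simple_def)
  then show ?thesis
    unfolding q_def using lmod_iso_id[of R "S i"] S_lmodule[OF assms] S_fin[OF assms]
    by (intro card_mhom_ge_2[of R "S i" "S i" id s]) (auto simp: lmod_iso_def)
qed

lemma card_mhom_S: "i \<in> I \<Longrightarrow> j \<in> I \<Longrightarrow> card (mhom R (S i) (S j)) = (if i = j then q i else 1)"
  using Schur[OF S_simple S_simple S_noniso] by (auto simp: q_def)

text \<open>\<open>tower e gs\<close>: the list \<open>gs\<close> consists of the fibre products over \<open>M\<close> of \<open>e i\<close> extensions of \<open>M\<close> by
  each \<open>S i\<close>, one entry for each choice of extension classes. A further factor turns a lift \<open>g\<close> of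
  \<open>f\<close> into a pair \<open>(g, g')\<close>, surjective iff \<open>g'\<close> does not vanish on \<open>ker g\<close>; the \<open>g'\<close> that do vanish are
  the maps factoring through \<open>g\<close>. This explains the factors \<open>ker_homs X f i - q i ^ l\<close>.\<close>

definition tower :: "('i \<Rightarrow> nat) \<Rightarrow> (('r, nat) module \<times> (nat \<Rightarrow> nat)) list \<Rightarrow> bool" where
  "tower e gs \<longleftrightarrow> length gs = (\<Prod>i\<in>I. card (Ext1 R M (S i)) ^ e i) \<and>
    (\<forall>G P. (G, P) \<in> set gs \<longrightarrow> lmodule R G \<and> finite (carrier G) \<and> P \<in> lmod_hom R G M \<and> P ` carrier G = carrier M \<and>
      card (carrier G) = card (carrier M) * (\<Prod>i\<in>I. card (carrier (S i)) ^ e i) \<and>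
      (\<forall>i\<in>I. card (mhom R (kmod G M P) (S i)) = q i ^ e i)) \<and>
    (\<forall>X f. lmodule R X \<longrightarrow> finite (carrier X) \<longrightarrow> f \<in> lmod_hom R X M \<longrightarrow> f ` carrier X = carrier M \<longrightarrow>
      (\<Sum>(G, P)\<leftarrow>gs. real (card (Sur_over R X f G P))) =
      (\<Prod>i\<in>I. real (m i) ^ e i * (\<Prod>l<e i. real (ker_homs X f i) - real (q i) ^ l)))"

lemma tower_cong:
  assumes "\<And>i. i \<in> I \<Longrightarrow> e i = e' i" "tower e gs"
  shows "tower e' gs"
proof -
  have "(\<Prod>i\<in>I. h i (e i)) = (\<Prod>i\<in>I. h i (e' i))" for h :: "'i \<Rightarrow> nat \<Rightarrow> 'c :: comm_monoid_mult"
    using assms(1) by (intro prod.cong) auto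
  note * = this[of "\<lambda>i j. card (Ext1 R M (S i)) ^ j"] this[of "\<lambda>i j. card (carrier (S i)) ^ j"]
    this[of "\<lambda>i j. real (m i) ^ j * (\<Prod>l<j. real (ker_homs X f i) - real (q i) ^ l)" for X f]
  have "(\<forall>i\<in>I. c i = q i ^ e i) \<longleftrightarrow> (\<forall>i\<in>I. c i = q i ^ e' i)" for c using assms(1) by auto
  with * assms(2) show ?thesis unfolding tower_def by simp
qed

lemma tower_0: "tower (\<lambda>_. 0) [(M, id)]"
proof -
  interpret M: lmodule R M by (rule M)
  have id: "id \<in> lmod_hom R M M" using lmod_iso_id[of R M] by (simp add: lmod_iso_def)
  have "card (mhom R (kmod M M id) (S i)) = 1" if "i \<in> I" for i
  proof (rule card_mhom_1[OF kmod_lmodule[OF M(1) M(1) id] S_lmodule[OF that]])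
    fix u x assume "u \<in> lmod_hom R (kmod M M id) (S i)" "x \<in> carrier (kmod M M id)"
    then show "u x = \<zero>\<^bsub>S i\<^esub>"
      using lmod_hom_zero[OF kmod_lmodule[OF M(1) M(1) id] S_lmodule[OF that]] by (simp add: mem_a_kernel)
  qed
  moreover have "card (Sur_over R X f M id) = 1"
    if X: "lmodule R X" and f: "f \<in> lmod_hom R X M" "f ` carrier X = carrier M" for X :: "('r, nat) module" and f
  proof -
    have "restrict f (carrier X) \<in> Sur_over R X f M id"
      using restrict_mhom[OF X f(1)] f(2) by (simp add: Sur_over_def Sur_def mhom_def)
    moreover have "u = restrict f (carrier X)" if "u \<in> Sur_over R X f M id" for u
      using that by (intro extensionalityI[of _ "carrier X"]) (auto simp: Sur_over_def Sur_def)
    ultimately have "Sur_over R X f M id = {restrict f (carrier X)}" by blast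
    then show ?thesis by simp
  qed
  ultimately show ?thesis using M id by (simp add: tower_def)
qed

text \<open>Every entry \<open>G\<close> is replaced by its fibre products with all extensions of
  \<open>M\<close> by \<open>S k\<close>. Over all classes, the lifts of \<open>f\<close> number
  \<open>m k * ker_homs X f k\<close>. Those to be discarded number \<open>m k * q k ^ e k\<close>,
  since they correspond to the lifts of \<open>P\<close> itself. The difference is the new
  factor.\<close>

lemma tower_Suc:
  assumes gs: "tower e gs" and k: "k \<in> I"
  shows "\<exists>gs'. tower (e(k := Suc (e k))) gs'"
proof -
  obtain es :: "(('r, nat) module \<times> (nat \<Rightarrow> nat) \<times> (nat \<Rightarrow> nat)) list"
    where es: "length es = card (Ext1 R M (S k))"
    "\<And>E i p. (E, i, p) \<in> set es \<Longrightarrow> is_extension R M (S k) (E, i, p)"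
    "\<And>(X :: ('r, nat) module) f. \<lbrakk>lmodule R X; finite (carrier X); f \<in> lmod_hom R X M; f ` carrier X = carrier M\<rbrakk>
      \<Longrightarrow> (\<Sum>(E, i, p)\<leftarrow>es. card (hom_over R X f E p)) = card (mhom R M (S k)) * card (mhom R (kmod X M f) (S k))"
    using Ext1_representatives[OF M(1) S_lmodule[OF k] M(2) S_fin[OF k] Ext[OF k]] by blast
  have gsD: "lmodule R G" "finite (carrier G)" "P \<in> lmod_hom R G M" "P ` carrier G = carrier M"
      "card (carrier G) = card (carrier M) * (\<Prod>i\<in>I. card (carrier (S i)) ^ e i)"
      "\<And>i. i \<in> I \<Longrightarrow> card (mhom R (kmod G M P) (S i)) = q i ^ e i"
    if "(G, P) \<in> set gs" for G P
    using gs that by (auto simp: tower_def)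
  \<comment> \<open>Collects what \<open>fiber_product_nat\<close> delivers, so that one fibre
    product can be chosen for each entry and each extension.\<close>
  define spec where "spec G P E p F Q \<longleftrightarrow> lmodule R F \<and> finite (carrier F) \<and> Q \<in> lmod_hom R F M \<and>
      Q ` carrier F = carrier M \<and> card (carrier F) = card (carrier G) * card (carrier (S k)) \<and>
      (\<forall>S' :: ('r, nat) module. lmodule R S' \<longrightarrow>
        card (mhom R (kmod F M Q) S') = card (mhom R (kmod G M P) S') * card (mhom R (S k) S')) \<and>
      (\<forall>(X :: ('r, nat) module) f. lmodule R X \<longrightarrow> finite (carrier X) \<longrightarrow>
        real (card (Sur_over R X f F Q)) =
        (\<Sum>g\<in>Sur_over R X f G P. real (card (hom_over R X f E p)) - real (card (hom_over R G P E p))))"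
    for G E F :: "('r, nat) module" and P p Q :: "nat \<Rightarrow> nat"
  define fp where "fp G P E p = (SOME (FQ :: ('r, nat) module \<times> (nat \<Rightarrow> nat)). spec G P E p (fst FQ) (snd FQ))"
    for G E :: "('r, nat) module" and P p :: "nat \<Rightarrow> nat"
  have fp: "spec G P E p (fst (fp G P E p)) (snd (fp G P E p))"
    if GP: "(G, P) \<in> set gs" and E: "(E, i, p) \<in> set es" for G P E i p
  proof -
    have "\<exists>F Q. spec G P E p F Q"
      unfolding spec_def
      by (rule fiber_product_nat[OF M S_simple[OF k] S_fin[OF k] gsD(1-4)[OF GP] es(2)[OF E]])
        (intro exI conjI allI impI; simp)
    then obtain F Q where "spec G P E p F Q" by blast
    then have "spec G P E p (fst (F, Q)) (snd (F, Q))" by simp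
    then show ?thesis unfolding fp_def by (rule someI)
  qed
  define gs' where "gs' = concat (map (\<lambda>(G, P). map (\<lambda>(E, i, p). fp G P E p) es) gs)"
  have upd: "(\<Prod>i\<in>I. h i ((e(k := Suc (e k))) i)) = (\<Prod>i\<in>I. h i (e i)) * r"
    if "h k (Suc (e k)) = h k (e k) * r" for h :: "'i \<Rightarrow> nat \<Rightarrow> 'c :: comm_monoid_mult" and r
    using prod_fun_upd_Suc[OF finI k, of h e r] that by blast
  have len: "length gs' = (\<Prod>i\<in>I. card (Ext1 R M (S i)) ^ (e(k := Suc (e k))) i)"
  proof -
    have "length gs' = (\<Sum>_\<leftarrow>gs. length es)"
      unfolding gs'_def by (simp add: length_concat comp_def case_prod_unfold)
    also have "\<dots> = length gs * length es" by (simp add: sum_list_triv)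
    also have "length gs = (\<Prod>i\<in>I. card (Ext1 R M (S i)) ^ e i)" using gs by (simp add: tower_def)
    finally show ?thesis
      using upd[of "\<lambda>i j. card (Ext1 R M (S i)) ^ j" "card (Ext1 R M (S k))"] es(1) by simp
  qed
  have mem: "lmodule R F \<and> finite (carrier F) \<and> Q \<in> lmod_hom R F M \<and> Q ` carrier F = carrier M \<and>
      card (carrier F) = card (carrier M) * (\<Prod>i\<in>I. card (carrier (S i)) ^ (e(k := Suc (e k))) i) \<and>
      (\<forall>i\<in>I. card (mhom R (kmod F M Q) (S i)) = q i ^ (e(k := Suc (e k))) i)"
    if FQ: "(F, Q) \<in> set gs'" for F Q
  proof -
    obtain G P E i p where GP: "(G, P) \<in> set gs" and E: "(E, i, p) \<in> set es" and "(F, Q) = fp G P E p"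
      using FQ by (auto simp: gs'_def)
    then have "spec G P E p F Q" using fp[OF GP E] by (metis fst_conv snd_conv)
    then have sp: "lmodule R F" "finite (carrier F)" "Q \<in> lmod_hom R F M"
      "Q ` carrier F = carrier M" "card (carrier F) = card (carrier G) * card (carrier (S k))"
      "\<And>S' :: ('r, nat) module. lmodule R S' \<Longrightarrow>
        card (mhom R (kmod F M Q) S') = card (mhom R (kmod G M P) S') * card (mhom R (S k) S')"
      by (auto simp: spec_def)
    have "card (carrier F) = card (carrier M) * (\<Prod>i\<in>I. card (carrier (S i)) ^ (e(k := Suc (e k))) i)"
      using upd[of "\<lambda>i j. card (carrier (S i)) ^ j" "card (carrier (S k))"] sp(5) gsD(5)[OF GP] by simp
    moreover have "card (mhom R (kmod F M Q) (S j)) = q j ^ (e(k := Suc (e k))) j" if j: "j \<in> I" for j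
      using sp(6)[OF S_lmodule[OF j]] gsD(6)[OF GP j] card_mhom_S[OF k j] by (cases "j = k") auto
    ultimately show ?thesis using sp by blast
  qed
  have cnt: "(\<Sum>(F, Q)\<leftarrow>gs'. real (card (Sur_over R X f F Q))) =
      (\<Prod>i\<in>I. real (m i) ^ (e(k := Suc (e k))) i *
        (\<Prod>l<(e(k := Suc (e k))) i. real (ker_homs X f i) - real (q i) ^ l))"
    if X: "lmodule R X" "finite (carrier X)" and f: "f \<in> lmod_hom R X M" "f ` carrier X = carrier M" for X f
  proof -
    let ?c = "real (m k) * (real (ker_homs X f k) - real (q k) ^ e k)"
    \<comment> \<open>Stated for any surjection \<open>h\<close> onto \<open>M\<close>, because it
      is applied both to \<open>f\<close> and to the structure map \<open>P\<close>.\<close>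
    have es_real: "(\<Sum>(E, i, p)\<leftarrow>es. real (card (hom_over R Y h E p))) = real (m k) * real (card (mhom R (kmod Y M h) (S k)))"
      if "lmodule R Y" "finite (carrier Y)" "h \<in> lmod_hom R Y M" "h ` carrier Y = carrier M"
      for Y :: "('r, nat) module" and h
    proof -
      have "(\<Sum>(E, i, p)\<leftarrow>es. real (card (hom_over R Y h E p))) = real (\<Sum>(E, i, p)\<leftarrow>es. card (hom_over R Y h E p))"
        by (induction es) (auto simp: case_prod_unfold)
      then show ?thesis using es(3)[OF that] by (simp add: m_def)
    qed
    have inner: "(\<Sum>(E, i, p)\<leftarrow>es. real (card (Sur_over R X f (fst (fp G P E p)) (snd (fp G P E p))))) =
        real (card (Sur_over R X f G P)) * ?c" if GP: "(G, P) \<in> set gs" for G P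
    proof -
      have "(\<Sum>(E, i, p)\<leftarrow>es. real (card (Sur_over R X f (fst (fp G P E p)) (snd (fp G P E p))))) =
         (\<Sum>(E, i, p)\<leftarrow>es. \<Sum>g\<in>Sur_over R X f G P.
            real (card (hom_over R X f E p)) - real (card (hom_over R G P E p)))"
        using fp[OF GP] X by (intro arg_cong[where f = sum_list] map_cong refl) (auto simp: spec_def)
      also have "\<dots> = (\<Sum>g\<in>Sur_over R X f G P. \<Sum>(E, i, p)\<leftarrow>es.
            real (card (hom_over R X f E p)) - real (card (hom_over R G P E p)))"
        by (simp only: sum_sum_list_swap case_prod_unfold)
      also have "\<dots> = (\<Sum>g\<in>Sur_over R X f G P. (\<Sum>(E, i, p)\<leftarrow>es. real (card (hom_over R X f E p)))
            - (\<Sum>(E, i, p)\<leftarrow>es. real (card (hom_over R G P E p))))"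
        by (simp add: case_prod_unfold sum_list_subtractf)
      also have "\<dots> = (\<Sum>g\<in>Sur_over R X f G P. ?c)"
        using es_real[OF X f] es_real[OF gsD(1-4)[OF GP]] gsD(6)[OF GP k]
        by (simp add: ker_homs_def algebra_simps)
      finally show ?thesis by simp
    qed
    have "(\<Sum>(F, Q)\<leftarrow>gs'. real (card (Sur_over R X f F Q))) =
       (\<Sum>(G, P)\<leftarrow>gs. \<Sum>(E, i, p)\<leftarrow>es. real (card (Sur_over R X f (fst (fp G P E p)) (snd (fp G P E p)))))"
      unfolding gs'_def by (induction gs) (auto simp: case_prod_unfold comp_def)
    also have "\<dots> = (\<Sum>(G, P)\<leftarrow>gs. real (card (Sur_over R X f G P)) * ?c)"
      using inner by (intro arg_cong[where f = sum_list] map_cong refl) auto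
    also have "\<dots> = (\<Sum>(G, P)\<leftarrow>gs. real (card (Sur_over R X f G P))) * ?c"
      by (simp add: case_prod_unfold sum_list_mult_const)
    also have "(\<Sum>(G, P)\<leftarrow>gs. real (card (Sur_over R X f G P))) =
        (\<Prod>i\<in>I. real (m i) ^ e i * (\<Prod>l<e i. real (ker_homs X f i) - real (q i) ^ l))"
      using gs X f by (simp add: tower_def)
    finally show ?thesis
      using upd[of "\<lambda>i j. real (m i) ^ j * (\<Prod>l<j. real (ker_homs X f i) - real (q i) ^ l)" ?c] by simp
  qed
  have "tower (e(k := Suc (e k))) gs'"
    unfolding tower_def using len mem cnt by (auto simp del: fun_upd_apply)
  then show ?thesis by blast
qed

lemma tower_exists: "\<exists>gs. tower e gs"
proof (induction "\<Sum>i\<in>I. e i" arbitrary: e)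
  case 0
  \<comment> \<open>Here \<open>e\<close> vanishes on \<open>I\<close>, not necessarily everywhere;
    \<open>tower_cong\<close> compares it with the constant function.\<close>
  then have "e i = 0" if "i \<in> I" for i using finI that by simp
  then show ?case using tower_cong[OF _ tower_0] by metis
next
  case (Suc n)
  then obtain k where k: "k \<in> I" "e k \<noteq> 0" by (metis Zero_not_Suc sum.neutral)
  let ?e = "e(k := e k - 1)"
  have "(\<Sum>i\<in>I. e i) = e k + (\<Sum>i\<in>I - {k}. e i)" "(\<Sum>i\<in>I. ?e i) = ?e k + (\<Sum>i\<in>I - {k}. ?e i)"
    using sum.remove[OF finI k(1)] by blast+
  moreover have "(\<Sum>i\<in>I - {k}. ?e i) = (\<Sum>i\<in>I - {k}. e i)" by (intro sum.cong) auto
  ultimately have "n = (\<Sum>i\<in>I. ?e i)" using Suc(2) k(2) by simp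
  then obtain gs where "tower ?e gs" using Suc(1) by blast
  from tower_Suc[OF this k(1)] have "\<exists>gs'. tower (?e(k := Suc (?e k))) gs'" .
  moreover have "?e(k := Suc (?e k)) = e" using k(2) by auto
  ultimately show ?case by simp
qed

end

section \<open>Truncated Newton expansions at powers of q\<close>

text \<open>For \<open>x = q^a\<close> this is \<open>q^(j choose 2)\<close> times the Gaussian binomial coefficient of \<open>a\<close> and \<open>j\<close>.\<close>

definition qbin :: "real \<Rightarrow> nat \<Rightarrow> real \<Rightarrow> real" where
  "qbin q j x = (\<Prod>l<j. x - q ^ l) / (\<Prod>l<j. q ^ Suc l - 1)"

lemma qpow_gt_1: "(q :: real) \<ge> 2 \<Longrightarrow> q ^ Suc l - 1 > 0"
  using one_less_power[of q "Suc l"] by simp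

text \<open>The partial sum is the interpolation polynomial with value 1 at 1 and 0 at
  \<open>q\<close>, ..., \<open>q ^ r\<close>. In the induction the new term is the previous product
  times \<open>(1 - x) / (q ^ Suc r - 1)\<close>.\<close>

lemma alternating_qbin_sum:
  fixes q :: real
  assumes "q \<ge> 2"
  shows "(\<Sum>j\<le>r. (-1) ^ j * qbin q j x) = (\<Prod>l<r. (q ^ Suc l - x) / (q ^ Suc l - 1))"
proof (induction r)
  case 0
  show ?case by (simp add: qbin_def)
next
  case (Suc r)
  note nz = qpow_gt_1[OF assms, of r]
  have "(\<Prod>l<Suc r. q ^ l - x) = (\<Prod>l<Suc r. (-1) * (x - q ^ l))" by simp
  then have "(-1) ^ Suc r * (\<Prod>l<Suc r. x - q ^ l) = (\<Prod>l<Suc r. q ^ l - x)"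
    by (simp only: prod.distrib prod_constant card_lessThan)
  also have "\<dots> = (1 - x) * (\<Prod>l<r. q ^ Suc l - x)"
    by (subst prod.lessThan_Suc_shift) simp
  finally have "(-1) ^ Suc r * qbin q (Suc r) x =
      (1 - x) * (\<Prod>l<r. q ^ Suc l - x) / ((\<Prod>l<r. q ^ Suc l - 1) * (q ^ Suc r - 1))"
    by (simp add: qbin_def)
  also have "\<dots> = (\<Prod>l<r. (q ^ Suc l - x) / (q ^ Suc l - 1)) * ((1 - x) / (q ^ Suc r - 1))"
    by (simp add: prod_dividef)
  finally have "(\<Sum>j\<le>Suc r. (-1) ^ j * qbin q j x) =
      (\<Prod>l<r. (q ^ Suc l - x) / (q ^ Suc l - 1)) * (1 + (1 - x) / (q ^ Suc r - 1))"
    using Suc by (simp add: algebra_simps)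
  also have "1 + (1 - x) / (q ^ Suc r - 1) = (q ^ Suc r - x) / (q ^ Suc r - 1)"
    using nz by (simp add: field_simps)
  finally show ?case by simp
qed

text \<open>If \<open>a \<le> r\<close>, then \<open>x\<close> is an interpolation node and the sum
  is exact. Otherwise \<open>x \<ge> q ^ Suc r\<close>, and the next term is the absolute value of
  the partial sum times \<open>(x - 1) / (q ^ Suc r - 1)\<close>, a factor of at least 1.\<close>

lemma qbin_alternating_error:
  fixes q :: real
  assumes q: "q \<ge> 2" and x: "x = q ^ a"
  shows "\<bar>of_bool (x = 1) - (\<Sum>j\<le>r. (-1) ^ j * qbin q j x)\<bar> \<le> qbin q (Suc r) x"
proof (cases "a \<le> r")
  case True
  have "(\<Prod>l<Suc r. x - q ^ l) = 0"
    using True x by (intro prod_zero bexI[of _ a]) auto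
  then have z: "qbin q (Suc r) x = 0" by (simp add: qbin_def)
  show ?thesis
  proof (cases "a = 0")
    case True
    have "(\<Prod>l<r. (q ^ Suc l - x) / (q ^ Suc l - 1)) = (\<Prod>l<r. 1)"
      using qpow_gt_1[OF q] x True by (intro prod.cong) (auto simp: less_imp_neq[THEN not_sym])
    then show ?thesis using z True x alternating_qbin_sum[OF q, of x r] by simp
  next
    case False
    then have "1 < q ^ a" using q by (intro one_less_power) auto
    then have "x \<noteq> 1" using x by simp
    moreover have "(\<Prod>l<r. (q ^ Suc l - x) / (q ^ Suc l - 1)) = 0"
      using False \<open>a \<le> r\<close> x by (intro prod_zero bexI[of _ "a - 1"]) auto
    ultimately show ?thesis using z alternating_qbin_sum[OF q, of x r] by simp
  qed
next
  case False
  then have a: "Suc r \<le> a" by simp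
  have xr: "x \<ge> q ^ Suc r" unfolding x using a q by (intro power_increasing) auto
  have ge: "x \<ge> q ^ Suc l" if "l < r" for l
    by (rule order_trans[OF power_increasing xr]) (use q that in auto)
  have "1 < q ^ a" using a q by (intro one_less_power) auto
  then have "x \<noteq> 1" using x by simp
  define A where "A = (\<Prod>l<r. (x - q ^ Suc l) / (q ^ Suc l - 1))"
  have A: "A \<ge> 0"
    unfolding A_def using ge qpow_gt_1[OF q] by (intro prod_nonneg) (auto simp: less_imp_le)
  have "\<bar>\<Prod>l<r. (q ^ Suc l - x) / (q ^ Suc l - 1)\<bar> = A"
    unfolding A_def abs_prod using ge qpow_gt_1[OF q]
    by (intro prod.cong refl) (auto simp: abs_divide abs_of_nonpos abs_of_pos simp del: power_Suc)
  then have "\<bar>of_bool (x = 1) - (\<Sum>j\<le>r. (-1) ^ j * qbin q j x)\<bar> = A"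
    using \<open>x \<noteq> 1\<close> by (simp add: alternating_qbin_sum[OF q])
  also have "\<dots> \<le> A * ((x - 1) / (q ^ Suc r - 1))"
    using A xr qpow_gt_1[OF q, of r] mult_left_mono[of 1 "(x - 1) / (q ^ Suc r - 1)" A]
    by (simp add: field_simps)
  also have "\<dots> = qbin q (Suc r) x"
  proof -
    have "(\<Prod>l<Suc r. x - q ^ l) = (x - 1) * (\<Prod>l<r. x - q ^ Suc l)"
      by (subst prod.lessThan_Suc_shift) simp
    then show ?thesis by (simp add: qbin_def A_def prod_dividef)
  qed
  finally show ?thesis .
qed

text \<open>If \<open>x\<close> lay strictly between \<open>q ^ (a - 1)\<close> and
  \<open>q ^ a\<close>, the factors with \<open>l < a\<close> would be positive and the one with
  \<open>l = a\<close> negative. This stands in for linear algebra over the endomorphism ring of a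
  simple module: nonnegativity comes for free from counting.\<close>

lemma power_if_falling_nonneg:
  fixes x q :: nat
  assumes "q \<ge> 2" "x \<ge> 1" and nn: "\<And>j. 0 \<le> (\<Prod>l<j. real x - real q ^ l)"
  shows "\<exists>a. x = q ^ a"
proof -
  define a where "a = (LEAST a. x \<le> q ^ a)"
  have "x \<le> q ^ x" using assms(1) by (intro less_imp_le power_gt_expt) auto
  then have a: "x \<le> q ^ a" unfolding a_def by (rule LeastI)
  have "x > q ^ l" if "l < a" for l using not_less_Least[of l "\<lambda>a. x \<le> q ^ a"] that by (simp add: a_def)
  then have "real x - real q ^ l > 0" if "l < a" for l using that by (metis diff_gt_0_iff_gt of_nat_less_iff of_nat_power)
  then have pos: "(\<Prod>l<a. real x - real q ^ l) > 0" by (intro prod_pos) auto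
  have "0 \<le> (\<Prod>l<a. real x - real q ^ l) * (real x - real q ^ a)"
    using nn[of "Suc a"] by simp
  then have "real q ^ a \<le> real x" using pos by (simp add: zero_le_mult_iff)
  then have "q ^ a \<le> x" by (metis of_nat_le_iff of_nat_power)
  with a show ?thesis by auto
qed

text \<open>Telescoping over the factors. The bound is a difference of products so that, for
  truncated sums \<open>B\<close> and \<open>B'\<close> at successive levels, it expands into the
  terms that are new at the higher level.\<close>

lemma abs_prod_diff_le:
  fixes \<delta> P B B' :: "'i \<Rightarrow> real"
  assumes "finite I" "\<And>i. i \<in> I \<Longrightarrow> \<bar>P i\<bar> \<le> B i" "\<And>i. i \<in> I \<Longrightarrow> \<bar>\<delta> i\<bar> \<le> B' i"
    "\<And>i. i \<in> I \<Longrightarrow> \<bar>\<delta> i - P i\<bar> \<le> B' i - B i"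
  shows "\<bar>prod \<delta> I - prod P I\<bar> \<le> prod B' I - prod B I"
  using assms
proof (induction I rule: finite_induct)
  case (insert k I)
  have P: "\<bar>prod P I\<bar> \<le> prod B I"
    unfolding abs_prod using insert by (intro prod_mono) auto
  have "\<delta> k * prod \<delta> I - P k * prod P I = \<delta> k * (prod \<delta> I - prod P I) + (\<delta> k - P k) * prod P I"
    by (simp add: algebra_simps)
  then have "\<bar>\<delta> k * prod \<delta> I - P k * prod P I\<bar> \<le> \<bar>\<delta> k\<bar> * \<bar>prod \<delta> I - prod P I\<bar> + \<bar>\<delta> k - P k\<bar> * \<bar>prod P I\<bar>"
    by (metis abs_mult abs_triangle_ineq)
  also have "\<dots> \<le> B' k * (prod B' I - prod B I) + (B' k - B k) * prod B I"
  proof (intro add_mono mult_mono)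
    show "0 \<le> B' k" "0 \<le> B' k - B k"
      using insert.prems(2,3)[of k] by (auto intro: order_trans[OF abs_ge_zero])
  qed (use insert P in auto)
  finally show ?case using insert by (simp add: algebra_simps)
qed simp

text \<open>The logarithm of the denominator grows quadratically in \<open>j\<close>, that of the
  numerator at most linearly.\<close>

lemma summable_power_over_qfact:
  fixes q C :: real
  assumes q: "q \<ge> 2" and C: "C \<ge> 0"
  shows "summable (\<lambda>j. C ^ j / (\<Prod>l<j. q ^ Suc l - 1))"
proof -
  \<comment> \<open>From \<open>N\<close> on, the ratio \<open>C / (q ^ Suc n - 1)\<close> of
    consecutive terms is at most 1/2.\<close>
  obtain N where "2 * C + 1 < q ^ N" using real_arch_pow[of q "2 * C + 1"] q by auto
  then have N: "q ^ n \<ge> 2 * C + 1" if "n \<ge> N" for n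
    using power_increasing[OF that, of q] q by linarith
  show ?thesis
  proof (rule summable_ratio_test[of "1 / 2" N])
    fix n assume "n \<ge> N"
    let ?D = "\<Prod>l<n. q ^ Suc l - 1"
    have D: "?D > 0" using qpow_gt_1[OF q] by (intro prod_pos) auto
    have "q ^ Suc n - 1 \<ge> 2 * C" using N[of "Suc n"] \<open>n \<ge> N\<close> by simp
    then have "C / (q ^ Suc n - 1) \<le> 1 / 2"
      using qpow_gt_1[OF q, of n] by (simp add: field_simps)
    then have "C ^ n / ?D * (C / (q ^ Suc n - 1)) \<le> C ^ n / ?D * (1 / 2)"
      using C D by (intro mult_left_mono) auto
    moreover have "C ^ Suc n / (\<Prod>l<Suc n. q ^ Suc l - 1) = C ^ n / ?D * (C / (q ^ Suc n - 1))"
      by simp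
    moreover have "0 \<le> C ^ Suc n / (\<Prod>l<Suc n. q ^ Suc l - 1)"
      using C qpow_gt_1[OF q] by (intro divide_nonneg_nonneg prod_nonneg) (auto simp: less_imp_le)
    ultimately show "norm (C ^ Suc n / (\<Prod>l<Suc n. q ^ Suc l - 1)) \<le> 1 / 2 * norm (C ^ n / ?D)"
      using C D by (simp only: real_norm_def abs_of_nonneg divide_nonneg_pos zero_le_power mult.commute[of "1 / 2"])
  qed simp
qed

text \<open>First \<open>r\<close> is fixed so that the limiting error \<open>D r\<close> is small,
  then \<open>t\<close> grows. The stage in \<open>t\<close> from which the estimates hold may
  depend on \<open>r\<close>.\<close>

lemma tendsto_if_uniformly_approximable:
  fixes m :: "nat \<Rightarrow> real"
  assumes T: "\<And>r. (\<lambda>t. Tt t r) \<longlonglongrightarrow> T r" and D: "\<And>r. (\<lambda>t. Dt t r) \<longlonglongrightarrow> D r"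
    and D0: "D \<longlonglongrightarrow> 0"
    and bt: "\<And>r. eventually (\<lambda>t. \<bar>m t - Tt t r\<bar> \<le> Dt t r) sequentially"
    and b: "\<And>r. \<bar>m0 - T r\<bar> \<le> D r"
  shows "m \<longlonglongrightarrow> m0"
proof (rule tendstoI)
  fix \<epsilon> :: real assume \<epsilon>: "\<epsilon> > 0"
  then have "eventually (\<lambda>r. D r < \<epsilon> / 4) sequentially"
    using D0 by (intro order_tendstoD) auto
  then obtain r where r: "D r < \<epsilon> / 4" by (auto simp: eventually_sequentially)
  have "eventually (\<lambda>t. Dt t r < \<epsilon> / 4) sequentially" using D r by (rule order_tendstoD)
  moreover have "eventually (\<lambda>t. \<bar>Tt t r - T r\<bar> < \<epsilon> / 4) sequentially"
    using T[of r, THEN tendstoD, of "\<epsilon> / 4"] \<epsilon> by (simp add: dist_real_def)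
  ultimately show "eventually (\<lambda>t. dist (m t) m0 < \<epsilon>) sequentially"
    using bt[of r]
  proof eventually_elim
    case (elim t)
    then show ?case using b[of r] r unfolding dist_real_def by linarith
  qed
qed

section \<open>The sieve for isomorphisms\<close>

context simple_family
begin

lemma finite_kernel: "finite (carrier X) \<Longrightarrow> finite (carrier (kmod X Y f))"
  by (simp add: a_kernel_def kernel_def)

lemma ker_homs_pos:
  assumes "lmodule R X" "finite (carrier X)" "f \<in> lmod_hom R X M" "i \<in> I"
  shows "ker_homs X f i \<ge> 1"
  unfolding ker_homs_def
  using card_mhom_pos[OF kmod_lmodule[OF assms(1) M(1) assms(3)] S_lmodule[OF assms(4)]
      finite_kernel[OF assms(2)] S_fin[OF assms(4)]] .

text \<open>A nonzero finite kernel has a simple quotient, which is isomorphic to some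
  \<open>S i\<close> and so provides a nonzero homomorphism.\<close>

lemma ker_homs_eq_1_iff:
  assumes X: "lmodule R X" "finite (carrier X)" and f: "f \<in> lmod_hom R X M"
  shows "(\<forall>i\<in>I. ker_homs X f i = 1) \<longleftrightarrow> a_kernel X M f = {\<zero>\<^bsub>X\<^esub>}"
proof -
  let ?K = "kmod X M f"
  note K = kmod_lmodule[OF X(1) M(1) f] and finK = finite_kernel[OF X(2), of M f]
  show ?thesis
  proof
    assume k: "a_kernel X M f = {\<zero>\<^bsub>X\<^esub>}"
    show "\<forall>i\<in>I. ker_homs X f i = 1"
      unfolding ker_homs_def
    proof
      fix i assume i: "i \<in> I"
      show "card (mhom R ?K (S i)) = 1"
      proof (rule card_mhom_1[OF K S_lmodule[OF i]])
        fix u x assume "u \<in> lmod_hom R ?K (S i)" "x \<in> carrier ?K"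
        then show "u x = \<zero>\<^bsub>S i\<^esub>"
          using k lmod_hom_zero[OF K S_lmodule[OF i]] by simp
      qed
    qed
  next
    assume 1: "\<forall>i\<in>I. ker_homs X f i = 1"
    show "a_kernel X M f = {\<zero>\<^bsub>X\<^esub>}"
    proof (rule ccontr)
      assume "a_kernel X M f \<noteq> {\<zero>\<^bsub>X\<^esub>}"
      then have "carrier ?K \<noteq> {\<zero>\<^bsub>?K\<^esub>}" by simp
      from exists_simple_quotient[OF K finK this] obtain T :: "('r, nat) module" and u
        where T: "lmod_simple R T" "finite (carrier T)"
          and u: "u \<in> lmod_hom R ?K T" "u ` carrier ?K = carrier T" .
      then obtain i \<theta> where i: "i \<in> I" and \<theta>: "\<theta> \<in> lmod_iso R T (S i)"
        using S_complete[OF T] by (auto simp: lmod_isomorphic_def)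
      have \<theta>': "\<theta> \<in> lmod_hom R T (S i)" "\<theta> ` carrier T = carrier (S i)"
        using \<theta> by (auto simp: lmod_iso_def bij_betw_def)
      have \<theta>u: "\<theta> \<circ> u \<in> lmod_hom R ?K (S i)" by (rule lmod_hom_comp[OF u(1) \<theta>'(1)])
      interpret Si: lmodule R "S i" by (rule S_lmodule[OF i])
      obtain s where s: "s \<in> carrier (S i)" "s \<noteq> \<zero>\<^bsub>S i\<^esub>"
        using S_simple[OF i] by (auto simp: lmod_simple_def)
      have "s \<in> \<theta> ` u ` carrier ?K" unfolding u(2) \<theta>'(2) by (rule s(1))
      then obtain x where x: "x \<in> carrier ?K" "(\<theta> \<circ> u) x = s" unfolding comp_def by blast
      have "(\<theta> \<circ> u) x \<noteq> \<zero>\<^bsub>S i\<^esub>" unfolding x(2) by (rule s(2))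
      from card_mhom_ge_2[OF K S_lmodule[OF i] finK S_fin[OF i] \<theta>u x(1) this] 1 i show False
        by (auto simp: ker_homs_def)
    qed
  qed
qed

text \<open>Up to the positive factor \<open>m i ^ j\<close>, the product is a number of surjections
  over \<open>M\<close> onto the entries of a tower whose exponents vanish except at
  \<open>i\<close>.\<close>

lemma falling_nonneg:
  assumes "lmodule R X" "finite (carrier X)" "f \<in> lmod_hom R X M" "f ` carrier X = carrier M" "i \<in> I"
  shows "0 \<le> (\<Prod>l<j. real (ker_homs X f i) - real (q i) ^ l)"
proof -
  define e where "e = (\<lambda>_ :: 'i. 0 :: nat)(i := j)"
  obtain gs where gs: "tower e gs" using tower_exists by blast
  let ?h = "\<lambda>i. real (m i) ^ e i * (\<Prod>l<e i. real (ker_homs X f i) - real (q i) ^ l)"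
  have "(\<Prod>i\<in>I. ?h i) = (\<Sum>(G, P)\<leftarrow>gs. real (card (Sur_over R X f G P)))"
    using gs assms by (simp add: tower_def)
  also have "\<dots> \<ge> 0" by (intro sum_list_nonneg) auto
  finally have "0 \<le> (\<Prod>i\<in>I. ?h i)" .
  moreover have "(\<Prod>i\<in>I. ?h i) = ?h i * (\<Prod>i\<in>I - {i}. ?h i)" by (rule prod.remove[OF finI assms(5)])
  moreover have "(\<Prod>i\<in>I - {i}. ?h i) = 1" by (intro prod.neutral) (auto simp: e_def)
  ultimately have "0 \<le> real (m i) ^ j * (\<Prod>l<j. real (ker_homs X f i) - real (q i) ^ l)" by (simp add: e_def)
  moreover have "real (m i) ^ j > 0" using m_pos[OF assms(5)] by simp
  ultimately show ?thesis by (simp add: zero_le_mult_iff)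
qed

lemma ker_homs_power:
  assumes "lmodule R X" "finite (carrier X)" "f \<in> lmod_hom R X M" "f ` carrier X = carrier M" "i \<in> I"
  shows "\<exists>a. real (ker_homs X f i) = real (q i) ^ a"
  using power_if_falling_nonneg[OF q_ge_2[OF assms(5)] ker_homs_pos[OF assms(1-3,5)] falling_nonneg[OF assms]]
  by auto

text \<open>Surjections onto \<open>G\<close> are sorted by their composite with \<open>P\<close>.
  Moments see \<open>Sur R X G\<close>, whereas the sieve runs over the surjections \<open>f\<close>
  onto \<open>M\<close>; this links the two.\<close>

lemma card_Sur_eq_sum:
  assumes X: "lmodule R X" "finite (carrier X)" and G: "finite (carrier G)" "P \<in> lmod_hom R G M" "P ` carrier G = carrier M"
  shows "card (Sur R X G) = (\<Sum>f\<in>Sur R X M. card (Sur_over R X f G P))"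
proof -
  let ?\<rho> = "\<lambda>u. restrict (P \<circ> u) (carrier X)"
  have "?\<rho> u \<in> Sur R X M" if "u \<in> Sur R X G" for u
  proof -
    note u = SurD[OF that]
    have "?\<rho> u \<in> mhom R X M" by (rule restrict_mhom[OF X(1) lmod_hom_comp[OF u(1) G(2)]])
    moreover have "?\<rho> u ` carrier X = carrier M"
      using u(2) G(3) image_image[of P u "carrier X"] by simp
    ultimately show ?thesis by (simp add: Sur_def mhom_def)
  qed
  then have "card (Sur R X G) = (\<Sum>f\<in>Sur R X M. card {u \<in> Sur R X G. ?\<rho> u = f})"
    using finite_Sur[OF X(2) G(1), of R] finite_Sur[OF X(2) M(2), of R]
    by (intro card_eq_sum_fibers) auto
  also have "\<dots> = (\<Sum>f\<in>Sur R X M. card (Sur_over R X f G P))"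
  proof (intro sum.cong refl arg_cong[where f = card])
    fix f assume f: "f \<in> Sur R X M"
    have "?\<rho> u = f \<longleftrightarrow> (\<forall>x\<in>carrier X. P (u x) = f x)" for u
      using SurD(3)[OF f] by (auto intro!: extensionalityI[of _ "carrier X"])
    then show "{u \<in> Sur R X G. ?\<rho> u = f} = Sur_over R X f G P" by (simp add: Sur_over_def)
  qed
  finally show ?thesis .
qed

definition some_tower :: "('i \<Rightarrow> nat) \<Rightarrow> (('r, nat) module \<times> (nat \<Rightarrow> nat)) list" where
  "some_tower e = (SOME gs. tower e gs)"

lemma some_tower: "tower e (some_tower e)"
  unfolding some_tower_def using tower_exists by (rule someI_ex)

text \<open>The factor, independent of \<open>f\<close>, that converts tower counts into products of
  \<open>qbin\<close> values.\<close>

definition qfact :: "('i \<Rightarrow> nat) \<Rightarrow> real" where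
  "qfact e = (\<Prod>i\<in>I. real (m i) ^ e i * (\<Prod>l<e i. real (q i) ^ Suc l - 1))"

text \<open>One term of the Newton expansion in several variables, added up over all
  \<open>f\<close>.\<close>

definition Z :: "('i \<Rightarrow> nat) \<Rightarrow> ('r, nat) module \<Rightarrow> real" where
  "Z e X = (\<Sum>f\<in>Sur R X M. \<Prod>i\<in>I. qbin (q i) (e i) (ker_homs X f i))"

lemma qfact_factor_pos:
  assumes "i \<in> I"
  shows "(\<Prod>l<j. real (q i) ^ Suc l - 1) > 0"
  using q_ge_2[OF assms] qpow_gt_1[of "real (q i)"] by (intro prod_pos) auto

lemma qfact_pos: "qfact e > 0"
  unfolding qfact_def using qfact_factor_pos m_pos
  by (intro prod_pos) (auto simp: Suc_le_eq intro!: mult_pos_pos)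

text \<open>Shows that \<open>Z e\<close> is a nonnegative combination of finitely many surjection
  counts, so that its integral is determined by moments.\<close>

lemma Z_eq_moment_sum:
  assumes X: "lmodule R X" "finite (carrier X)"
  shows "Z e X = (\<Sum>(G, P)\<leftarrow>some_tower e. real (card (Sur R X G))) / qfact e"
proof -
  have aux: "a * b = a * d * (b / d)" if "d > 0" for a b d :: real using that by simp
  have "(\<Sum>(G, P)\<leftarrow>some_tower e. real (card (Sur R X G))) =
      (\<Sum>(G, P)\<leftarrow>some_tower e. \<Sum>f\<in>Sur R X M. real (card (Sur_over R X f G P)))"
  proof (intro arg_cong[where f = sum_list] map_cong refl)
    fix GP assume "GP \<in> set (some_tower e)"
    moreover obtain G P where "GP = (G, P)" by (cases GP)
    ultimately show "(case GP of (G, P) \<Rightarrow> real (card (Sur R X G))) =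
        (case GP of (G, P) \<Rightarrow> \<Sum>f\<in>Sur R X M. real (card (Sur_over R X f G P)))"
      using some_tower[of e] card_Sur_eq_sum[OF X, of G P] by (auto simp: tower_def)
  qed
  also have "\<dots> = (\<Sum>f\<in>Sur R X M. \<Sum>(G, P)\<leftarrow>some_tower e. real (card (Sur_over R X f G P)))"
    by (simp only: sum_sum_list_swap case_prod_unfold)
  also have "\<dots> = (\<Sum>f\<in>Sur R X M. \<Prod>i\<in>I. real (m i) ^ e i * (\<Prod>l<e i. real (ker_homs X f i) - real (q i) ^ l))"
  proof (intro sum.cong refl)
    fix f assume f: "f \<in> Sur R X M"
    show "(\<Sum>(G, P)\<leftarrow>some_tower e. real (card (Sur_over R X f G P))) =
        (\<Prod>i\<in>I. real (m i) ^ e i * (\<Prod>l<e i. real (ker_homs X f i) - real (q i) ^ l))"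
      using some_tower[of e] X SurD(1,2)[OF f] unfolding tower_def by blast
  qed
  also have "\<dots> = (\<Sum>f\<in>Sur R X M. qfact e * (\<Prod>i\<in>I. qbin (q i) (e i) (ker_homs X f i)))"
  proof (intro sum.cong refl)
    fix f
    show "(\<Prod>i\<in>I. real (m i) ^ e i * (\<Prod>l<e i. real (ker_homs X f i) - real (q i) ^ l)) =
        qfact e * (\<Prod>i\<in>I. qbin (q i) (e i) (ker_homs X f i))"
      unfolding qfact_def qbin_def prod.distrib[symmetric]
    proof (intro prod.cong refl)
      fix i assume i: "i \<in> I"
      show "real (m i) ^ e i * (\<Prod>l<e i. real (ker_homs X f i) - real (q i) ^ l) =
         real (m i) ^ e i * (\<Prod>l<e i. real (q i) ^ Suc l - 1) *
         ((\<Prod>l<e i. real (ker_homs X f i) - real (q i) ^ l) / (\<Prod>l<e i. real (q i) ^ Suc l - 1))"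
        by (rule aux) (rule qfact_factor_pos[OF i])
    qed
  qed
  also have "\<dots> = qfact e * Z e X" by (simp add: Z_def sum_distrib_left)
  finally show ?thesis
    using qfact_pos[of e] by simp
qed

text \<open>For \<open>X\<close> isomorphic to \<open>M\<close> this is the order of the
  automorphism group of \<open>M\<close>.\<close>

definition inj_count :: "('r, nat) module \<Rightarrow> nat" where
  "inj_count X = card {f \<in> Sur R X M. inj_on f (carrier X)}"

text \<open>\<open>PiE\<close> fixes the values outside \<open>I\<close>, so the set is finite and a
  product of sums over \<open>j \<le> r\<close> expands over it.\<close>

definition exponents :: "nat \<Rightarrow> ('i \<Rightarrow> nat) set" where "exponents r = PiE I (\<lambda>_. {..r})"

definition alt_sign :: "('i \<Rightarrow> nat) \<Rightarrow> real" where "alt_sign e = (\<Prod>i\<in>I. (-1) ^ e i)"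

lemma finite_exponents: "finite (exponents r)"
  unfolding exponents_def using finI by (intro finite_PiE) auto

lemma prod_sum_exponents: "(\<Prod>i\<in>I. \<Sum>j\<le>r. h i j) = (\<Sum>e\<in>exponents r. \<Prod>i\<in>I. h i (e i))" for h :: "'i \<Rightarrow> nat \<Rightarrow> real"
  unfolding exponents_def using finI by (intro prod_sum_PiE) auto

text \<open>For each \<open>f\<close> the truncations in one variable are multiplied over
  \<open>i\<close>. The error is the sum of \<open>Z e\<close> over those exponents with some entry
  equal to \<open>Suc r\<close>. Being again a combination of surjection counts, it can be
  integrated against \<open>\<mu>t t\<close> as well.\<close>

lemma inj_count_sieve:
  assumes X: "lmodule R X" "finite (carrier X)"
  shows "\<bar>real (inj_count X) - (\<Sum>e\<in>exponents r. alt_sign e * Z e X)\<bar> \<le> (\<Sum>e\<in>exponents (Suc r). Z e X) - (\<Sum>e\<in>exponents r. Z e X)"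
proof -
  define \<beta> where "\<beta> f i j = qbin (q i) j (ker_homs X f i)" for f i j
  have \<beta>nn: "\<beta> f i j \<ge> 0" if "f \<in> Sur R X M" "i \<in> I" for f i j
    unfolding \<beta>_def qbin_def
    using falling_nonneg[OF X SurD(1,2)[OF that(1)] that(2)] qfact_factor_pos[OF that(2), of j]
    by (intro divide_nonneg_nonneg) auto
  let ?inj = "\<lambda>f. of_bool (inj_on f (carrier X)) :: real"
  have pt: "\<bar>?inj f - (\<Sum>e\<in>exponents r. alt_sign e * (\<Prod>i\<in>I. \<beta> f i (e i)))\<bar> \<le>
      (\<Sum>e\<in>exponents (Suc r). \<Prod>i\<in>I. \<beta> f i (e i)) - (\<Sum>e\<in>exponents r. \<Prod>i\<in>I. \<beta> f i (e i))"
    if f: "f \<in> Sur R X M" for f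
  proof -
    note fD = SurD(1,2)[OF f]
    have "?inj f = (\<Prod>i\<in>I. of_bool (real (ker_homs X f i) = 1))"
    proof -
      have "inj_on f (carrier X) \<longleftrightarrow> (\<forall>i\<in>I. ker_homs X f i = 1)"
        using ker_homs_eq_1_iff[OF X fD(1)] lmod_hom_inj_iff[OF X(1) M(1) fD(1)] by simp
      moreover have "(\<Prod>i\<in>I. of_bool (real (ker_homs X f i) = 1)) = (of_bool (\<forall>i\<in>I. ker_homs X f i = 1) :: real)"
        using finI by (induction I rule: finite_induct) auto
      ultimately show ?thesis by simp
    qed
    moreover have "(\<Sum>e\<in>exponents r. alt_sign e * (\<Prod>i\<in>I. \<beta> f i (e i))) = (\<Prod>i\<in>I. \<Sum>j\<le>r. (-1) ^ j * \<beta> f i j)"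
      unfolding prod_sum_exponents by (simp add: alt_sign_def prod.distrib)
    moreover have "\<bar>(\<Prod>i\<in>I. of_bool (real (ker_homs X f i) = 1)) - (\<Prod>i\<in>I. \<Sum>j\<le>r. (-1) ^ j * \<beta> f i j)\<bar> \<le>
       (\<Prod>i\<in>I. \<Sum>j\<le>Suc r. \<beta> f i j) - (\<Prod>i\<in>I. \<Sum>j\<le>r. \<beta> f i j)"
    \<comment> \<open>\<open>B\<close> and \<open>B'\<close> are the unsigned truncations at
      \<open>r\<close> and \<open>Suc r\<close>; in one variable they differ by the first omitted
      term alone.\<close>
    proof (rule abs_prod_diff_le[OF finI])
      fix i assume i: "i \<in> I"
      show "\<bar>\<Sum>j\<le>r. (-1) ^ j * \<beta> f i j\<bar> \<le> (\<Sum>j\<le>r. \<beta> f i j)"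
        by (rule order_trans[OF sum_abs]) (simp add: abs_mult power_abs \<beta>nn[OF f i])
      \<comment> \<open>The term with \<open>j = 0\<close> equals 1, which bounds the
        indicator.\<close>
      have "\<beta> f i 0 \<le> (\<Sum>j\<le>Suc r. \<beta> f i j)"
        by (rule member_le_sum) (auto simp: \<beta>nn[OF f i])
      then show "\<bar>of_bool (real (ker_homs X f i) = 1)\<bar> \<le> (\<Sum>j\<le>Suc r. \<beta> f i j)"
        by (auto simp: \<beta>_def qbin_def)
      obtain a where a: "real (ker_homs X f i) = real (q i) ^ a" using ker_homs_power[OF X fD i] by blast
      show "\<bar>of_bool (real (ker_homs X f i) = 1) - (\<Sum>j\<le>r. (-1) ^ j * \<beta> f i j)\<bar> \<le>
          (\<Sum>j\<le>Suc r. \<beta> f i j) - (\<Sum>j\<le>r. \<beta> f i j)"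
        using qbin_alternating_error[OF _ a, of r] q_ge_2[OF i] by (simp add: \<beta>_def)
    qed
    ultimately show ?thesis by (simp only: prod_sum_exponents)
  qed
  have fin: "finite (Sur R X M)" by (rule finite_Sur[OF X(2) M(2)])
  have Zsum: "(\<Sum>e\<in>exponents s. c e * Z e X) = (\<Sum>f\<in>Sur R X M. \<Sum>e\<in>exponents s. c e * (\<Prod>i\<in>I. \<beta> f i (e i)))" for c s
    unfolding Z_def \<beta>_def by (subst sum.swap) (simp add: sum_distrib_left)
  have "real (inj_count X) = (\<Sum>f\<in>Sur R X M. ?inj f)"
    unfolding inj_count_def using fin by (simp add: sum.If_cases of_bool_def Int_def)
  then have "\<bar>real (inj_count X) - (\<Sum>e\<in>exponents r. alt_sign e * Z e X)\<bar> =
      \<bar>\<Sum>f\<in>Sur R X M. ?inj f - (\<Sum>e\<in>exponents r. alt_sign e * (\<Prod>i\<in>I. \<beta> f i (e i)))\<bar>"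
    by (simp add: Zsum sum_subtractf)
  also have "\<dots> \<le> (\<Sum>f\<in>Sur R X M. (\<Sum>e\<in>exponents (Suc r). \<Prod>i\<in>I. \<beta> f i (e i)) - (\<Sum>e\<in>exponents r. \<Prod>i\<in>I. \<beta> f i (e i)))"
    by (rule order_trans[OF sum_abs sum_mono]) (rule pt)
  also have "\<dots> = (\<Sum>e\<in>exponents (Suc r). Z e X) - (\<Sum>e\<in>exponents r. Z e X)"
    using Zsum[of "\<lambda>_. 1"] by (simp add: sum_subtractf)
  finally show ?thesis .
qed

end

section \<open>Passing to the limit\<close>

lemma measurable_discrete:
  assumes "sets \<nu> = Pow A"
  shows "f \<in> borel_measurable \<nu>" "space \<nu> = A"
proof -
  have s: "sets \<nu> = sets (count_space A)" using assms by simp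
  show "f \<in> borel_measurable \<nu>" by (subst measurable_cong_sets[OF s refl]) simp
  show "space \<nu> = A" using sets_eq_imp_space_eq[OF s] by simp
qed

lemma integrable_sum_list:
  fixes F :: "'x \<Rightarrow> 'a \<Rightarrow> real"
  assumes "\<And>x. x \<in> set xs \<Longrightarrow> integrable \<nu> (F x)"
  shows "integrable \<nu> (\<lambda>c. \<Sum>x\<leftarrow>xs. F x c) \<and> (\<integral>c. (\<Sum>x\<leftarrow>xs. F x c) \<partial>\<nu>) = (\<Sum>x\<leftarrow>xs. \<integral>c. F x c \<partial>\<nu>)"
  using assms by (induction xs) auto

context simple_family
begin

text \<open>The very choice made inside \<open>sur_count\<close>, so that the counts for a class are
  those for \<open>rep C\<close>.\<close>

definition rep :: "('r, nat) module set \<Rightarrow> ('r, nat) module" where "rep C = (SOME X. X \<in> C)"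

lemma rep_mem:
  assumes "C \<in> iso_classes R"
  shows "rep C \<in> C" "lmodule R (rep C)" "finite (carrier (rep C))"
proof -
  show "rep C \<in> C"
    unfolding rep_def using in_quotient_imp_non_empty[OF equiv_iso_rel assms[unfolded iso_classes_def]]
    by (simp add: some_in_eq)
  then have "rep C \<in> fin_modules R"
    using in_quotient_imp_subset[OF equiv_iso_rel assms[unfolded iso_classes_def]] by blast
  then show "lmodule R (rep C)" "finite (carrier (rep C))" by (auto simp: fin_modules_def)
qed

lemma sur_count_rep: "sur_count R C G = card (Sur R (rep C) G)"
  by (simp add: sur_count_def rep_def)

text \<open>Members of distinct classes are not isomorphic. Hence the sieved quantity is a multiple
  of the indicator of the class of \<open>M\<close>, and its integral is that multiple of the
  measure of the class.\<close>

lemma inj_count_rep: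
  assumes C: "C \<in> iso_classes R"
  shows "inj_count (rep C) = inj_count (rep (iso_class R M)) * of_bool (C = iso_class R M)"
proof (cases "C = iso_class R M")
  case False
  note X = rep_mem[OF C]
  interpret X: lmodule R "rep C" by (rule X)
  have "{f \<in> Sur R (rep C) M. inj_on f (carrier (rep C))} = {}"
  proof (rule ccontr)
    assume "{f \<in> Sur R (rep C) M. inj_on f (carrier (rep C))} \<noteq> {}"
    then have "lmod_isomorphic R (rep C) M"
      by (auto simp: Sur_def lmod_isomorphic_def lmod_iso_def bij_betw_def)
    then have "lmod_isomorphic R M (rep C)" by (rule lmod_isomorphic_sym[OF _ X(2)])
    then have "rep C \<in> iso_class R M" using X by (simp add: iso_class_def fin_modules_def)
    moreover have "iso_class R M \<in> iso_classes R" using iso_class_in_iso_classes[OF M] .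
    ultimately show False
      using quotient_disj[OF equiv_iso_rel, of C R "iso_class R M"] C X(1) False
      by (auto simp: iso_classes_def)
  qed
  then show ?thesis using False by (simp only: inj_count_def) simp
qed simp

lemma inj_count_class_pos: "inj_count (rep (iso_class R M)) \<ge> 1"
proof -
  let ?X = "rep (iso_class R M)"
  note X = rep_mem[OF iso_class_in_iso_classes[OF M]]
  have "lmod_isomorphic R M ?X" using X(1) by (simp add: iso_class_def)
  then have "lmod_isomorphic R ?X M" by (rule lmod_isomorphic_sym[OF _ M(1)])
  then obtain f where f: "f \<in> lmod_hom R ?X M" "bij_betw f (carrier ?X) (carrier M)"
    by (auto simp: lmod_isomorphic_def lmod_iso_def)
  let ?f = "restrict f (carrier ?X)"
  have "bij_betw ?f (carrier ?X) (carrier M)" using f(2) by (simp cong: bij_betw_cong)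
  then have "?f \<in> {f \<in> Sur R ?X M. inj_on f (carrier ?X)}"
    using restrict_mhom[OF X(2) f(1)] by (simp add: Sur_def mhom_def bij_betw_def)
  moreover have "finite {f \<in> Sur R ?X M. inj_on f (carrier ?X)}"
    using finite_Sur[OF X(3) M(2), of R] by simp
  ultimately have "inj_count ?X > 0" unfolding inj_count_def card_gt_0_iff by blast
  then show ?thesis by simp
qed

text \<open>Defined from moments so that convergence in \<open>t\<close> is immediate. Equality with
  the integral of \<open>Z e\<close> is claimed only for finite moments, since
  \<open>enn2real\<close> sends infinity to 0.\<close>

definition Z_mean :: "('r, nat) module set measure \<Rightarrow> ('i \<Rightarrow> nat) \<Rightarrow> real" where
  "Z_mean \<nu> e = (\<Sum>(G, P)\<leftarrow>some_tower e. enn2real (moment R \<nu> G)) / qfact e"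

lemma integral_sur_count:
  assumes \<nu>: "sets \<nu> = Pow (iso_classes R)" and fin: "moment R \<nu> G < \<infinity>"
  shows "integrable \<nu> (\<lambda>C. real (sur_count R C G))" "(\<integral>C. real (sur_count R C G) \<partial>\<nu>) = enn2real (moment R \<nu> G)"
proof -
  have nn: "(\<integral>\<^sup>+ C. ennreal (real (sur_count R C G)) \<partial>\<nu>) = moment R \<nu> G"
    by (simp add: moment_def ennreal_of_nat_eq_real_of_nat)
  then show "integrable \<nu> (\<lambda>C. real (sur_count R C G))"
    using fin measurable_discrete(1)[OF \<nu>] by (intro integrableI_nonneg) auto
  show "(\<integral>C. real (sur_count R C G) \<partial>\<nu>) = enn2real (moment R \<nu> G)"
    using measurable_discrete(1)[OF \<nu>] nn by (subst integral_eq_nn_integral) auto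
qed

lemma integral_Z:
  assumes \<nu>: "sets \<nu> = Pow (iso_classes R)" and fin: "\<And>G P. (G, P) \<in> set (some_tower e) \<Longrightarrow> moment R \<nu> G < \<infinity>"
  shows "integrable \<nu> (\<lambda>C. Z e (rep C))" "(\<integral>C. Z e (rep C) \<partial>\<nu>) = Z_mean \<nu> e"
proof -
  have eq: "Z e (rep C) = (\<Sum>x\<leftarrow>some_tower e. real (sur_count R C (fst x))) / qfact e" if "C \<in> space \<nu>" for C
    using Z_eq_moment_sum[OF rep_mem(2,3), of C e] that
    by (simp add: measurable_discrete(2)[OF \<nu>] sur_count_rep case_prod_unfold)
  have *: "integrable \<nu> (\<lambda>C. real (sur_count R C (fst x)))" "(\<integral>C. real (sur_count R C (fst x)) \<partial>\<nu>) = enn2real (moment R \<nu> (fst x))"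
    if "x \<in> set (some_tower e)" for x
    using that fin[of "fst x" "snd x"] integral_sur_count[OF \<nu>, of "fst x"] by auto
  note l = integrable_sum_list[of "some_tower e" \<nu> "\<lambda>x C. real (sur_count R C (fst x))", OF *(1)]
  have "(\<Sum>x\<leftarrow>some_tower e. \<integral>C. real (sur_count R C (fst x)) \<partial>\<nu>) = (\<Sum>x\<leftarrow>some_tower e. enn2real (moment R \<nu> (fst x)))"
    by (intro arg_cong[where f = sum_list] map_cong refl *(2))
  then have "integrable \<nu> (\<lambda>C. (\<Sum>x\<leftarrow>some_tower e. real (sur_count R C (fst x))) / qfact e) \<and>
    (\<integral>C. (\<Sum>x\<leftarrow>some_tower e. real (sur_count R C (fst x))) / qfact e \<partial>\<nu>) = Z_mean \<nu> e"
    using l by (simp add: Z_mean_def case_prod_unfold)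
  then show "integrable \<nu> (\<lambda>C. Z e (rep C))" "(\<integral>C. Z e (rep C) \<partial>\<nu>) = Z_mean \<nu> e"
    using eq by (simp_all cong: Bochner_Integration.integrable_cong Bochner_Integration.integral_cong)
qed

text \<open>The count is at least 1 on the class of \<open>M\<close>, so the integrand of the moment
  dominates its indicator. The measures need not be finite, hence the appeal to a moment.\<close>

lemma emeasure_class_finite:
  assumes \<nu>: "sets \<nu> = Pow (iso_classes R)" and fin: "moment R \<nu> M < \<infinity>"
  shows "emeasure \<nu> {iso_class R M} < \<infinity>"
proof -
  let ?c = "iso_class R M"
  have c: "?c \<in> iso_classes R" using iso_class_in_iso_classes[OF M] .
  have "inj_count (rep ?c) \<le> card (Sur R (rep ?c) M)"
    unfolding inj_count_def using finite_Sur[OF rep_mem(3)[OF c] M(2), of R] by (intro card_mono) auto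
  then have "1 \<le> sur_count R ?c M" using inj_count_class_pos by (simp add: sur_count_rep)
  then have "indicator {?c} C \<le> (of_nat (sur_count R C M) :: ennreal)" for C
    by (auto simp: indicator_def)
  then have "(\<integral>\<^sup>+C. indicator {?c} C \<partial>\<nu>) \<le> moment R \<nu> M"
    unfolding moment_def by (intro nn_integral_mono)
  also have "(\<integral>\<^sup>+C. indicator {?c} C \<partial>\<nu>) = emeasure \<nu> {?c}" using c \<nu> by simp
  finally show ?thesis using fin by (rule le_less_trans)
qed

text \<open>The integrated sieve. Finiteness is asked of finitely many moments, those up to level
  \<open>Suc r\<close>, so that it can be met by \<open>\<mu>t t\<close> for all \<open>t\<close>
  beyond a bound depending on \<open>r\<close>.\<close>

lemma measure_sieve:
  assumes \<nu>: "sets \<nu> = Pow (iso_classes R)" and finM: "moment R \<nu> M < \<infinity>"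
    and fin: "\<And>e G P. e \<in> exponents (Suc r) \<Longrightarrow> (G, P) \<in> set (some_tower e) \<Longrightarrow> moment R \<nu> G < \<infinity>"
  shows "\<bar>real (inj_count (rep (iso_class R M))) * measure \<nu> {iso_class R M} - (\<Sum>e\<in>exponents r. alt_sign e * Z_mean \<nu> e)\<bar>
    \<le> (\<Sum>e\<in>exponents (Suc r). Z_mean \<nu> e) - (\<Sum>e\<in>exponents r. Z_mean \<nu> e)"
proof -
  let ?c = "iso_class R M"
  let ?a = "real (inj_count (rep ?c))"
  have c: "?c \<in> iso_classes R" using iso_class_in_iso_classes[OF M] .
  have sp: "space \<nu> = iso_classes R" by (rule measurable_discrete(2)[OF \<nu>])
  have exponents: "exponents r \<subseteq> exponents (Suc r)" unfolding exponents_def by (intro PiE_mono) auto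
  have Z: "integrable \<nu> (\<lambda>C. Z e (rep C))" "(\<integral>C. Z e (rep C) \<partial>\<nu>) = Z_mean \<nu> e" if "e \<in> exponents (Suc r)" for e
    using integral_Z[OF \<nu> fin[OF that]] by auto
  note Z' = Z[OF subsetD[OF exponents]]
  have ind: "integrable \<nu> (indicator {?c} :: _ \<Rightarrow> real)"
    using emeasure_class_finite[OF \<nu> finM] c \<nu> by (intro integrable_real_indicator) auto
  have icint: "integrable \<nu> (\<lambda>C. ?a * indicator {?c} C)" using ind by simp
  let ?F = "\<lambda>C. ?a * indicator {?c} C - (\<Sum>e\<in>exponents r. alt_sign e * Z e (rep C))"
  let ?H = "\<lambda>C. (\<Sum>e\<in>exponents (Suc r). Z e (rep C)) - (\<Sum>e\<in>exponents r. Z e (rep C))"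
  have iF: "integrable \<nu> ?F" using icint Z'(1) by (intro Bochner_Integration.integrable_diff Bochner_Integration.integrable_sum) auto
  have iH: "integrable \<nu> ?H" using Z(1) Z'(1) by (intro Bochner_Integration.integrable_diff Bochner_Integration.integrable_sum) auto
  have "\<bar>?F C\<bar> \<le> ?H C" if "C \<in> space \<nu>" for C
  proof -
    have C: "C \<in> iso_classes R" using that sp by simp
    have "?a * indicator {?c} C = real (inj_count (rep C))"
      using inj_count_rep[OF C] by (auto simp: indicator_def)
    then show ?thesis using inj_count_sieve[OF rep_mem(2,3)[OF C], of r] by simp
  qed
  then have "(\<integral>C. \<bar>?F C\<bar> \<partial>\<nu>) \<le> (\<integral>C. ?H C \<partial>\<nu>)"
    using iF iH by (intro integral_mono) auto
  then have "\<bar>\<integral>C. ?F C \<partial>\<nu>\<bar> \<le> (\<integral>C. ?H C \<partial>\<nu>)"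
    using integral_abs_bound[of \<nu> ?F] by linarith
  moreover have "(\<integral>C. ?F C \<partial>\<nu>) = ?a * measure \<nu> {?c} - (\<Sum>e\<in>exponents r. alt_sign e * Z_mean \<nu> e)"
  proof -
    have "(\<integral>C. ?F C \<partial>\<nu>) = (\<integral>C. ?a * indicator {?c} C \<partial>\<nu>) - (\<integral>C. (\<Sum>e\<in>exponents r. alt_sign e * Z e (rep C)) \<partial>\<nu>)"
      using icint Z'(1) by (intro Bochner_Integration.integral_diff Bochner_Integration.integrable_sum) auto
    moreover have "(\<integral>C. (\<Sum>e\<in>exponents r. alt_sign e * Z e (rep C)) \<partial>\<nu>) = (\<Sum>e\<in>exponents r. alt_sign e * Z_mean \<nu> e)"
      using Z' by (subst Bochner_Integration.integral_sum) auto
    ultimately show ?thesis using c sp by simp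
  qed
  moreover have "(\<integral>C. ?H C \<partial>\<nu>) = (\<Sum>e\<in>exponents (Suc r). Z_mean \<nu> e) - (\<Sum>e\<in>exponents r. Z_mean \<nu> e)"
  proof -
    have "(\<integral>C. ?H C \<partial>\<nu>) = (\<integral>C. (\<Sum>e\<in>exponents (Suc r). Z e (rep C)) \<partial>\<nu>) - (\<integral>C. (\<Sum>e\<in>exponents r. Z e (rep C)) \<partial>\<nu>)"
      using Z(1) Z'(1) by (intro Bochner_Integration.integral_diff Bochner_Integration.integrable_sum) auto
    moreover have "(\<integral>C. (\<Sum>e\<in>exponents (Suc r). Z e (rep C)) \<partial>\<nu>) = (\<Sum>e\<in>exponents (Suc r). Z_mean \<nu> e)"
      using Z by (subst Bochner_Integration.integral_sum) auto
    moreover have "(\<integral>C. (\<Sum>e\<in>exponents r. Z e (rep C)) \<partial>\<nu>) = (\<Sum>e\<in>exponents r. Z_mean \<nu> e)"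
      using Z' by (subst Bochner_Integration.integral_sum) auto
    ultimately show ?thesis by simp
  qed
  ultimately show ?thesis by simp
qed

lemma some_tower_fin_modules: "(G, P) \<in> set (some_tower e) \<Longrightarrow> G \<in> fin_modules R"
  using some_tower[of e] by (auto simp: tower_def fin_modules_def)

lemma Z_mean_nonneg: "Z_mean \<nu> e \<ge> 0"
  unfolding Z_mean_def using qfact_pos[of e] by (intro divide_nonneg_pos sum_list_nonneg) auto

text \<open>\<open>Z_mean \<mu> e\<close> is at most a constant times a product of terms
  \<open>\<gamma> i (e i)\<close> of convergent series. The shell sum is then bounded by a multiple
  of the increment of a convergent sequence.\<close>

lemma shell_tendsto_0:
  assumes bound: "\<And>K. K \<in> fin_modules R \<Longrightarrow> moment R \<mu> K \<le> ennreal (A * real (card (carrier K)) powr B)"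
  shows "(\<lambda>r. (\<Sum>e\<in>exponents (Suc r). Z_mean \<mu> e) - (\<Sum>e\<in>exponents r. Z_mean \<mu> e)) \<longlonglongrightarrow> 0"
proof -
  \<comment> \<open>A natural exponent not below \<open>B\<close>, so that powers distribute over
    products of cardinalities.\<close>
  define b where "b = nat \<lceil>\<bar>B\<bar>\<rceil>"
  \<comment> \<open>Raising \<open>e i\<close> by one multiplies the number of tower entries by
    \<open>|Ext1 R M (S i)|\<close> and the bound for their moments by
    \<open>|S i| ^ b\<close>.\<close>
  define \<gamma> where "\<gamma> i j = (real (card (Ext1 R M (S i))) * real (card (carrier (S i))) ^ b) ^ j / (\<Prod>l<j. real (q i) ^ Suc l - 1)"
    for i j
  define K where "K = \<bar>A\<bar> * real (card (carrier M)) ^ b"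
  have mom: "enn2real (moment R \<mu> G) \<le> \<bar>A\<bar> * real (card (carrier G)) ^ b" if G: "G \<in> fin_modules R" for G
  proof -
    interpret G: lmodule R G using G by (simp add: fin_modules_def)
    have "card (carrier G) \<ge> 1"
      using G G.M.zero_closed unfolding fin_modules_def One_nat_def Suc_le_eq card_gt_0_iff by blast
    moreover have "B \<le> real b" unfolding b_def by linarith
    ultimately have "real (card (carrier G)) powr B \<le> real (card (carrier G)) powr real b"
      by (intro powr_mono) auto
    also have "\<dots> = real (card (carrier G)) ^ b" using \<open>card (carrier G) \<ge> 1\<close> by (simp add: powr_realpow)
    finally have "A * real (card (carrier G)) powr B \<le> \<bar>A\<bar> * real (card (carrier G)) ^ b"
      by (intro mult_mono) auto
    then have "moment R \<mu> G \<le> ennreal (\<bar>A\<bar> * real (card (carrier G)) ^ b)"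
      using bound[OF G] ennreal_leI order_trans by blast
    then show ?thesis by (intro enn2real_leI) auto
  qed
  have ub: "Z_mean \<mu> e \<le> K * (\<Prod>i\<in>I. \<gamma> i (e i))" for e
  proof -
    let ?E = "\<Prod>i\<in>I. real (card (Ext1 R M (S i))) ^ e i"
    let ?S = "\<Prod>i\<in>I. real (card (carrier (S i))) ^ e i"
    let ?Q = "\<Prod>i\<in>I. \<Prod>l<e i. real (q i) ^ Suc l - 1"
    have Q: "?Q > 0" by (rule prod_pos) (rule qfact_factor_pos)
    have card: "enn2real (moment R \<mu> G) \<le> K * ?S ^ b" if "(G, P) \<in> set (some_tower e)" for G P
    proof -
      have "card (carrier G) = card (carrier M) * (\<Prod>i\<in>I. card (carrier (S i)) ^ e i)"
        using some_tower[of e] that by (auto simp: tower_def)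
      then have "real (card (carrier G)) = real (card (carrier M)) * ?S" by simp
      then show ?thesis using mom[OF some_tower_fin_modules[OF that]] by (simp add: K_def power_mult_distrib)
    qed
    have "(\<Sum>(G, P)\<leftarrow>some_tower e. enn2real (moment R \<mu> G)) \<le> (\<Sum>_\<leftarrow>some_tower e. K * ?S ^ b)"
      using card by (intro sum_list_mono) auto
    also have "\<dots> = ?E * (K * ?S ^ b)"
      using some_tower[of e] by (simp add: tower_def sum_list_triv)
    finally have num: "(\<Sum>(G, P)\<leftarrow>some_tower e. enn2real (moment R \<mu> G)) \<le> ?E * (K * ?S ^ b)" .
    \<comment> \<open>The factors \<open>m i ^ e i \<ge> 1\<close> are dropped from the
      denominator.\<close>
    have "?Q \<le> qfact e"
      unfolding qfact_def
    proof (intro prod_mono conjI)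
      fix i assume i: "i \<in> I"
      note p = qfact_factor_pos[OF i, of "e i"]
      then show "0 \<le> (\<Prod>l<e i. real (q i) ^ Suc l - 1)" by simp
      have "1 \<le> real (m i) ^ e i" using m_pos[OF i] by simp
      then show "(\<Prod>l<e i. real (q i) ^ Suc l - 1) \<le> real (m i) ^ e i * (\<Prod>l<e i. real (q i) ^ Suc l - 1)"
        using mult_right_mono[of 1 "real (m i) ^ e i"] p by (simp only: mult_1_left less_imp_le)
    qed
    moreover have "0 \<le> ?E * (K * ?S ^ b)"
      by (intro mult_nonneg_nonneg prod_nonneg zero_le_power) (auto simp: K_def prod_nonneg)
    ultimately have "Z_mean \<mu> e \<le> ?E * (K * ?S ^ b) / ?Q"
      unfolding Z_mean_def using num Q by (intro frac_le) auto
    also have "\<dots> = K * (\<Prod>i\<in>I. \<gamma> i (e i))"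
      by (simp add: \<gamma>_def prod_dividef prod.distrib power_mult_distrib prod_power_distrib power_mult[symmetric] mult.commute)
    finally show ?thesis .
  qed
  have exponents: "exponents r \<subseteq> exponents (Suc r)" for r unfolding exponents_def by (intro PiE_mono) auto
  \<comment> \<open>As a sum over a difference set the shell can be bounded term by term; upper
    bounds for the two sums separately would not control their difference.\<close>
  have shell: "(\<Sum>e\<in>exponents (Suc r). h e) - (\<Sum>e\<in>exponents r. h e) = (\<Sum>e\<in>exponents (Suc r) - exponents r. h e)" for h :: "_ \<Rightarrow> real" and r
    using sum.subset_diff[OF exponents finite_exponents, of h r] by simp
  let ?T = "\<lambda>r. \<Prod>i\<in>I. \<Sum>j\<le>r. \<gamma> i j"
  have "\<exists>L. ?T \<longlonglongrightarrow> L"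
  proof -
    have "(\<lambda>r. \<Sum>j\<le>r. \<gamma> i j) \<longlonglongrightarrow> (\<Sum>j. \<gamma> i j)" if "i \<in> I" for i
      unfolding \<gamma>_def using q_ge_2[OF that] by (intro summable_LIMSEQ' summable_power_over_qfact) auto
    then have "?T \<longlonglongrightarrow> (\<Prod>i\<in>I. \<Sum>j. \<gamma> i j)" by (intro tendsto_prod)
    then show ?thesis by blast
  qed
  then obtain L where L: "?T \<longlonglongrightarrow> L" by blast
  have "(\<lambda>r. K * (?T (Suc r) - ?T r)) \<longlonglongrightarrow> K * (L - L)"
    by (intro tendsto_intros LIMSEQ_Suc L)
  then have lim: "(\<lambda>r. K * (?T (Suc r) - ?T r)) \<longlonglongrightarrow> 0" by simp
  show ?thesis
  proof (rule tendsto_sandwich[OF _ _ tendsto_const lim])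
    show "\<forall>\<^sub>F r in sequentially. 0 \<le> (\<Sum>e\<in>exponents (Suc r). Z_mean \<mu> e) - (\<Sum>e\<in>exponents r. Z_mean \<mu> e)"
      unfolding shell by (intro always_eventually allI sum_nonneg Z_mean_nonneg)
    have "(\<Sum>e\<in>exponents (Suc r). Z_mean \<mu> e) - (\<Sum>e\<in>exponents r. Z_mean \<mu> e) \<le> K * (?T (Suc r) - ?T r)" for r
      unfolding shell prod_sum_exponents sum_distrib_left by (intro sum_mono ub)
    then show "\<forall>\<^sub>F r in sequentially. (\<Sum>e\<in>exponents (Suc r). Z_mean \<mu> e) - (\<Sum>e\<in>exponents r. Z_mean \<mu> e) \<le> K * (?T (Suc r) - ?T r)"
      by (intro always_eventually allI)
  qed
qed

text \<open>\<open>tendsto_if_uniformly_approximable\<close> is applied to the measure of the class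
  times the number of automorphisms of \<open>M\<close>, with the truncated sieve as approximation
  and the shell sum as error.\<close>

lemma emeasure_class_tendsto:
  assumes \<mu>: "sets \<mu> = Pow (iso_classes R)" and \<mu>t: "\<And>t. sets (\<mu>t t) = Pow (iso_classes R)"
    and lim: "\<And>K. K \<in> fin_modules R \<Longrightarrow> (\<lambda>t. moment R (\<mu>t t) K) \<longlonglongrightarrow> moment R \<mu> K"
    and bound: "\<And>K. K \<in> fin_modules R \<Longrightarrow> moment R \<mu> K \<le> ennreal (A * real (card (carrier K)) powr B)"
  shows "(\<lambda>t. emeasure (\<mu>t t) {iso_class R M}) \<longlonglongrightarrow> emeasure \<mu> {iso_class R M}"
proof -
  let ?c = "iso_class R M"
  let ?a = "real (inj_count (rep ?c))"
  have Mf: "M \<in> fin_modules R" using M by (simp add: fin_modules_def)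
  have fin: "moment R \<mu> K < \<infinity>" if "K \<in> fin_modules R" for K
    using bound[OF that] by (rule le_less_trans) simp
  \<comment> \<open>Some \<open>\<mu>t t\<close> may have infinite moments, but each single moment
    is eventually finite because its limit is.\<close>
  have fint: "\<forall>\<^sub>F t in sequentially. moment R (\<mu>t t) K < \<infinity>" if "K \<in> fin_modules R" for K
    using lim[OF that] fin[OF that] by (rule order_tendstoD)
  have momr: "(\<lambda>t. enn2real (moment R (\<mu>t t) K)) \<longlonglongrightarrow> enn2real (moment R \<mu> K)" if "K \<in> fin_modules R" for K
    using lim[OF that] fin[OF that] by (intro tendsto_enn2real) (auto simp: ennreal_enn2real_if)
  have ulim: "(\<lambda>t. Z_mean (\<mu>t t) e) \<longlonglongrightarrow> Z_mean \<mu> e" for e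
  proof -
    have "(\<lambda>t. \<Sum>x\<leftarrow>xs. enn2real (moment R (\<mu>t t) (fst x))) \<longlonglongrightarrow> (\<Sum>x\<leftarrow>xs. enn2real (moment R \<mu> (fst x)))"
      if "set xs \<subseteq> set (some_tower e)" for xs
      using that by (induction xs) (auto intro!: tendsto_add momr dest: some_tower_fin_modules)
    then show ?thesis
      unfolding Z_mean_def case_prod_unfold using qfact_pos[of e] by (intro tendsto_divide tendsto_const) auto
  qed
  have am: "(\<lambda>t. ?a * measure (\<mu>t t) {?c}) \<longlonglongrightarrow> ?a * measure \<mu> {?c}"
  proof (rule tendsto_if_uniformly_approximable)
    show "(\<lambda>t. \<Sum>e\<in>exponents r. alt_sign e * Z_mean (\<mu>t t) e) \<longlonglongrightarrow> (\<Sum>e\<in>exponents r. alt_sign e * Z_mean \<mu> e)" for r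
      by (intro tendsto_intros ulim)
    show "(\<lambda>t. (\<Sum>e\<in>exponents (Suc r). Z_mean (\<mu>t t) e) - (\<Sum>e\<in>exponents r. Z_mean (\<mu>t t) e)) \<longlonglongrightarrow>
        (\<Sum>e\<in>exponents (Suc r). Z_mean \<mu> e) - (\<Sum>e\<in>exponents r. Z_mean \<mu> e)" for r
      by (intro tendsto_intros ulim)
    show "(\<lambda>r. (\<Sum>e\<in>exponents (Suc r). Z_mean \<mu> e) - (\<Sum>e\<in>exponents r. Z_mean \<mu> e)) \<longlonglongrightarrow> 0"
      by (rule shell_tendsto_0[OF bound])
    show "\<bar>?a * measure \<mu> {?c} - (\<Sum>e\<in>exponents r. alt_sign e * Z_mean \<mu> e)\<bar> \<le> (\<Sum>e\<in>exponents (Suc r). Z_mean \<mu> e) - (\<Sum>e\<in>exponents r. Z_mean \<mu> e)" for r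
      by (rule measure_sieve[OF \<mu> fin[OF Mf] fin[OF some_tower_fin_modules]])
    fix r
    \<comment> \<open>Level \<open>r\<close> involves finitely many modules, so one stage in
      \<open>t\<close> serves them all.\<close>
    have "\<forall>\<^sub>F t in sequentially. \<forall>e\<in>exponents (Suc r). \<forall>x\<in>set (some_tower e). moment R (\<mu>t t) (fst x) < \<infinity>"
      using some_tower_fin_modules by (intro eventually_ball_finite ballI finite_exponents finite_set fint) (metis prod.collapse)
    then show "\<forall>\<^sub>F t in sequentially. \<bar>?a * measure (\<mu>t t) {?c} - (\<Sum>e\<in>exponents r. alt_sign e * Z_mean (\<mu>t t) e)\<bar> \<le>
        (\<Sum>e\<in>exponents (Suc r). Z_mean (\<mu>t t) e) - (\<Sum>e\<in>exponents r. Z_mean (\<mu>t t) e)"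
      using fint[OF Mf]
    proof eventually_elim
      case (elim t)
      show ?case by (rule measure_sieve[OF \<mu>t elim(2)]) (use elim(1) in force)
    qed
  qed
  have "(\<lambda>t. ?a * measure (\<mu>t t) {?c} / ?a) \<longlonglongrightarrow> ?a * measure \<mu> {?c} / ?a"
    using inj_count_class_pos by (intro tendsto_divide am tendsto_const) auto
  then have "(\<lambda>t. measure (\<mu>t t) {?c}) \<longlonglongrightarrow> measure \<mu> {?c}"
    using inj_count_class_pos by (simp add: Suc_le_eq)
  then have "(\<lambda>t. ennreal (measure (\<mu>t t) {?c})) \<longlonglongrightarrow> ennreal (measure \<mu> {?c})"
    by (rule tendsto_ennrealI)
  moreover have "ennreal (measure \<mu> {?c}) = emeasure \<mu> {?c}"
    using emeasure_class_finite[OF \<mu> fin[OF Mf]] by (simp add: emeasure_eq_ennreal_measure)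
  \<comment> \<open>The real-valued \<open>measure\<close> determines \<open>emeasure\<close> only
    where the latter is finite, hence the restriction to large \<open>t\<close>.\<close>
  moreover have "\<forall>\<^sub>F t in sequentially. ennreal (measure (\<mu>t t) {?c}) = emeasure (\<mu>t t) {?c}"
    using fint[OF Mf]
  proof eventually_elim
    case (elim t)
    then show ?case
      using emeasure_class_finite[OF \<mu>t elim] by (simp add: emeasure_eq_ennreal_measure)
  qed
  ultimately show ?thesis by (simp add: tendsto_cong)
qed

end

theorem theorem1p3:
  fixes R :: "('r, 'k) ring_scheme"
    and \<mu> :: "('r, nat) module set measure"
    and \<mu>t :: "nat \<Rightarrow> ('r, nat) module set measure"
    and M :: "('r, 'a) module"
  assumes "ring R"
    and "finite {C \<in> iso_classes R. \<exists>S\<in>C. lmod_simple R S}"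
    and "\<And>K L. K \<in> fin_modules R \<Longrightarrow> L \<in> fin_modules R \<Longrightarrow> finite (Ext1 R K L)"
    and "sets \<mu> = Pow (iso_classes R)"
    and "\<And>t. sets (\<mu>t t) = Pow (iso_classes R)"
    and "\<And>K. K \<in> fin_modules R \<Longrightarrow> (\<lambda>t. moment R (\<mu>t t) K) \<longlonglongrightarrow> moment R \<mu> K"
    and "\<exists>A B :: real. \<forall>K\<in>fin_modules R.
           moment R \<mu> K \<le> ennreal (A * real (card (carrier K)) powr B)"
    and "lmodule R M" and "finite (carrier M)"
  shows "(\<lambda>t. emeasure (\<mu>t t) {iso_class R M}) \<longlonglongrightarrow> emeasure \<mu> {iso_class R M}"
proof -
  \<comment> \<open>Indexing by isomorphism classes makes the chosen simple modules pairwise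
    non-isomorphic and the family complete.\<close>
  let ?I = "{C \<in> iso_classes R. \<exists>S\<in>C. lmod_simple R S}"
  define S where "S C = (SOME S. S \<in> C \<and> lmod_simple R S)" for C :: "('r, nat) module set"
  have S: "S C \<in> C" "lmod_simple R (S C)" if "C \<in> ?I" for C
    using someI_ex[of "\<lambda>S. S \<in> C \<and> lmod_simple R S"] that by (auto simp: S_def)
  have sub: "C \<subseteq> fin_modules R" if "C \<in> iso_classes R" for C
    using in_quotient_imp_subset[OF equiv_iso_rel] that unfolding iso_classes_def .
  have Sf: "S C \<in> fin_modules R" if "C \<in> ?I" for C
    using S(1)[OF that] sub that by blast
  have same: "C = D" if "C \<in> iso_classes R" "D \<in> iso_classes R" "X \<in> C" "Y \<in> D" "lmod_isomorphic R X Y" for C D X Y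
  proof -
    have "(X, Y) \<in> iso_rel R" using that sub[OF that(1)] sub[OF that(2)] by (auto simp: iso_rel_def)
    then show ?thesis
      using quotient_eqI[OF equiv_iso_rel, of C R D X Y] that by (simp add: iso_classes_def)
  qed
  \<comment> \<open>\<open>M\<close> may live on any type. The sieve is run for a copy on
    \<open>nat\<close>, whose isomorphism class is the same set.\<close>
  obtain M' :: "('r, nat) module" where M': "M' \<in> fin_modules R" and MM': "lmod_isomorphic R M M'"
    using fin_modules_representative[OF assms(8,9)] .
  have "iso_class R M = iso_class R M'"
    using MM' assms(8) by (auto simp: iso_class_def intro: lmod_isomorphic_trans lmod_isomorphic_sym)
  moreover have "simple_family R ?I S M'"
  proof (rule simple_family.intro)
    show "finite ?I" by (rule assms(2))
    show "finite (carrier (S C))" if "C \<in> ?I" for C using Sf[OF that] by (simp add: fin_modules_def)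
    show "lmod_simple R (S C)" if "C \<in> ?I" for C by (rule S(2)[OF that])
    show "\<not> lmod_isomorphic R (S C) (S D)" if "C \<in> ?I" "D \<in> ?I" "C \<noteq> D" for C D
      using same[of C D "S C" "S D"] S(1) that by blast
    show "\<exists>C\<in>?I. lmod_isomorphic R T (S C)" if T: "lmod_simple R T" "finite (carrier T)" for T :: "('r, nat) module"
    proof -
      have T': "lmodule R T" "T \<in> fin_modules R" using T by (auto simp: lmod_simple_def fin_modules_def)
      then have C: "iso_class R T \<in> ?I"
        using T iso_class_in_iso_classes[OF T'(1) T(2)] lmod_isomorphic_refl by (auto simp: iso_class_def)
      then show ?thesis using S(1)[OF C] by (auto simp: iso_class_def)
    qed
    show "lmodule R M'" "finite (carrier M')" using M' by (auto simp: fin_modules_def)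
    show "finite (Ext1 R M' (S C))" if "C \<in> ?I" for C by (rule assms(3)[OF M' Sf[OF that]])
  qed
  then interpret simple_family R ?I S M' .
  obtain A B :: real where "\<And>K. K \<in> fin_modules R \<Longrightarrow> moment R \<mu> K \<le> ennreal (A * real (card (carrier K)) powr B)"
    using assms(7) by blast
  from emeasure_class_tendsto[OF assms(4-6) this]
  have "(\<lambda>t. emeasure (\<mu>t t) {iso_class R M'}) \<longlonglongrightarrow> emeasure \<mu> {iso_class R M'}" .
  ultimately show ?thesis by simp
qed

end
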